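(* Let $(x\in X)=\frac{1}{r}(a_1,a_2,a_3,a_4,a_5)$ be a $5$-dimensional cyclic quotient singularity satisfying the following: - $r,a_1,a_2,a_3,a_4,a_5$ are positive integers; - $a_i\leq r$ for every $i\in\{1,2,3,4,5\}$; - $\gcd(a_1,r)=\gcd(a_2,r)=\gcd(a_3,r)=1$; - $\gcd(a_4,r)=\gcd(a_5,r)$; - $\gcd\left(\sum_{i=1}^5a_i,r\right)=1$; - $2-\frac{1}{13}<\operatorname{mld}(x,X)=\frac{1}{r}\sum_{i=1}^5a_i<2$; - one of the following holds: $r\mid a_1+a_2+a_5$; or $r\mid 2a_1+a_5$; or [$r\mid 2a_4+a_5$ and $\gcd(a_4,r)=\gcd(a_5,r)\leq 2$]. Then $$(r,\{a_1,a_2,a_3,a_4,a_5\})\in\big\{(19,\{3,4,5,7,18\}),\ (17,\{2,3,5,7,16\}),\ (14,\{3,5,13,2,4\})\big\}.$$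
   Context: Everything is over $\mathbb{C}$. For positive integers $r,a_1,\dots,a_5$, the cyclic quotient singularity $(x\in X)=\frac1r(a_1,\dots,a_5)$ is the quotient $X=\mathbb{A}^5/\boldsymbol{\mu}_r$ of affine space by the group of $r$-th roots of unity acting by $\xi\cdot(x_1,\dots,x_5)=(\xi^{a_1}x_1,\dots,\xi^{a_5}x_5)$, with $x$ the image of the origin. $\operatorname{mld}(x,X)$ is the minimum of the log discrepancies $a(E,X)$ over all prime divisors $E$ over $X$ with center $\{x\}$ on $X$. By the standard toric formula, $\operatorname{mld}(x,X)=\min_{1\leq j\leq r}\sum_{i=1}^5\left(1+\frac{ja_i}{r}-\left\lceil\frac{ja_i}{r}\right\rceil\right)$. The sets $\{a_1,\dots,a_5\}$ are compared without regard to order (as multisets). *)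

theory Defs
  imports
    "HOL-Analysis.Analysis"
    "HOL-Library.Poly_Mapping"
    "HOL-Library.Multiset"
    "HOL-Library.Extended_Real"
    "HOL-Computational_Algebra.Fraction_Field"
begin

section \<open>Rational functions in several variables\<close>

text \<open>
  The coordinates of affine space are indexed by a finite type \<open>'n\<close>; a monomial is its
  exponent vector. The dimension 5 is obtained with the numeral type \<open>5\<close>, whose elements are
  1, 2, 3, 4, 5 (with 5 = 0). The order on \<open>'n\<close> has no mathematical role: it is what the
  library asks for in order to know that the polynomial ring is an integral domain.
\<close>

type_synonym 'n cpoly = "('n \<Rightarrow>\<^sub>0 nat) \<Rightarrow>\<^sub>0 complex"
type_synonym 'n ratfun = "'n cpoly fract"

definition const :: "complex \<Rightarrow> 'n::{finite,linorder} ratfun" where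
  "const c = Fract (Poly_Mapping.single 0 c) 1"

definition ratfun_eval ::
  "('n \<Rightarrow> 'n ratfun) \<Rightarrow> 'n::{finite,linorder} cpoly \<Rightarrow> 'n ratfun" where
  "ratfun_eval u P =
     (\<Sum>e\<in>Poly_Mapping.keys P.
        const (Poly_Mapping.lookup P e) * (\<Prod>i\<in>UNIV. u i ^ Poly_Mapping.lookup e i))"

definition poly_partial ::
  "'n \<Rightarrow> 'n::{finite,linorder} cpoly \<Rightarrow> 'n cpoly" where
  "poly_partial i p =
     (\<Sum>e\<in>Poly_Mapping.keys p.
        Poly_Mapping.single (e - Poly_Mapping.single i 1)
          (of_nat (Poly_Mapping.lookup e i) * Poly_Mapping.lookup p e))"

lemma poly_partial_superset:
  assumes "finite S" "Poly_Mapping.keys p \<subseteq> S"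
  shows "poly_partial i p =
     (\<Sum>e\<in>S. Poly_Mapping.single (e - Poly_Mapping.single i 1)
          (of_nat (Poly_Mapping.lookup e i) * Poly_Mapping.lookup p e))"
  unfolding poly_partial_def
  by (rule sum.mono_neutral_left) (use assms in \<open>auto simp: in_keys_iff\<close>)

lemma poly_partial_add: "poly_partial i (p + q) = poly_partial i p + poly_partial i q"
proof -
  let ?S = "Poly_Mapping.keys p \<union> Poly_Mapping.keys q"
  have "Poly_Mapping.keys (p + q) \<subseteq> ?S"
    by (rule Poly_Mapping.keys_add)
  then show ?thesis
    by (simp add: poly_partial_superset[where S = ?S] lookup_add distrib_left
        single_add sum.distrib)
qed

lemma poly_partial_0 [simp]: "poly_partial i 0 = 0"
  by (simp add: poly_partial_def)

lemma poly_partial_sum: "poly_partial i (sum f A) = (\<Sum>x\<in>A. poly_partial i (f x))"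
  by (induction A rule: infinite_finite_induct) (simp_all add: poly_partial_add)

lemma poly_partial_single:
  "poly_partial i (Poly_Mapping.single e c) =
     Poly_Mapping.single (e - Poly_Mapping.single i 1) (of_nat (Poly_Mapping.lookup e i) * c)"
  by (simp add: poly_partial_def)

lemma cpoly_sum_monomials:
  fixes p :: "'n cpoly"
  shows "p = (\<Sum>e\<in>Poly_Mapping.keys p. Poly_Mapping.single e (Poly_Mapping.lookup p e))"
proof (rule poly_mapping_eqI)
  fix k
  show "Poly_Mapping.lookup p k =
    Poly_Mapping.lookup
      (\<Sum>e\<in>Poly_Mapping.keys p. Poly_Mapping.single e (Poly_Mapping.lookup p e)) k"
    by (simp add: lookup_sum lookup_single when_def in_keys_iff)
qed

lemma exponent_minus_add:
  fixes d e :: "'n \<Rightarrow>\<^sub>0 nat"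
  assumes "Poly_Mapping.lookup d i \<noteq> 0"
  shows "d + e - Poly_Mapping.single i 1 = (d - Poly_Mapping.single i 1) + e"
  by (rule poly_mapping_eqI)
     (use assms in \<open>auto simp: lookup_add lookup_minus lookup_single when_def\<close>)

lemma poly_partial_mult_single:
  fixes d e :: "'n::{finite,linorder} \<Rightarrow>\<^sub>0 nat"
  shows "poly_partial i (Poly_Mapping.single d b * Poly_Mapping.single e c) =
     poly_partial i (Poly_Mapping.single d b) * Poly_Mapping.single e c
     + Poly_Mapping.single d b * poly_partial i (Poly_Mapping.single e c)"
proof (cases "Poly_Mapping.lookup d i = 0"; cases "Poly_Mapping.lookup e i = 0")
  assume "Poly_Mapping.lookup d i \<noteq> 0" "Poly_Mapping.lookup e i \<noteq> 0"
  then show ?thesis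
    using exponent_minus_add[of d i e] exponent_minus_add[of e i d]
    by (simp add: mult_single poly_partial_single lookup_add algebra_simps single_add)
next
  assume "Poly_Mapping.lookup d i \<noteq> 0" "Poly_Mapping.lookup e i = 0"
  then show ?thesis
    using exponent_minus_add[of d i e]
    by (simp add: mult_single poly_partial_single lookup_add algebra_simps)
next
  assume "Poly_Mapping.lookup d i = 0" "Poly_Mapping.lookup e i \<noteq> 0"
  then show ?thesis
    using exponent_minus_add[of e i d]
    by (simp add: mult_single poly_partial_single lookup_add algebra_simps)
qed (simp add: mult_single poly_partial_single lookup_add)

lemma poly_partial_mult:
  "poly_partial i (p * q) = poly_partial i p * q + p * poly_partial i q"
proof -
  let ?m = "\<lambda>p e. Poly_Mapping.single e (Poly_Mapping.lookup p e)"
  let ?P = "Poly_Mapping.keys p" and ?Q = "Poly_Mapping.keys q"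
  have p: "p = sum (?m p) ?P" and q: "q = sum (?m q) ?Q"
    by (rule cpoly_sum_monomials)+
  have "poly_partial i (sum (?m p) ?P * sum (?m q) ?Q) =
      (\<Sum>d\<in>?P. \<Sum>e\<in>?Q. poly_partial i (?m p d * ?m q e))"
    by (simp add: sum_product poly_partial_sum)
  also have "\<dots> = (\<Sum>d\<in>?P. \<Sum>e\<in>?Q. poly_partial i (?m p d) * ?m q e)
      + (\<Sum>d\<in>?P. \<Sum>e\<in>?Q. ?m p d * poly_partial i (?m q e))"
    by (simp add: poly_partial_mult_single sum.distrib)
  also have "\<dots> = poly_partial i (sum (?m p) ?P) * sum (?m q) ?Q
      + sum (?m p) ?P * poly_partial i (sum (?m q) ?Q)"
    by (simp add: sum_product poly_partial_sum)
  finally show ?thesis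
    using p q by simp
qed

lift_definition ratfun_partial ::
  "'n \<Rightarrow> 'n::{finite,linorder} ratfun \<Rightarrow> 'n ratfun"
  is "\<lambda>i (p, q). (poly_partial i p * q - p * poly_partial i q, q * q)"
proof (clarsimp simp del: mult_cancel_left mult_cancel_right)
  fix i :: 'n and p q s t :: "'n cpoly"
  assume eq: "p * t = s * q"
  let ?D = "poly_partial i"
  have D: "?D p * t + p * ?D t = ?D s * q + s * ?D q"
    using arg_cong[OF eq, of ?D] by (simp add: poly_partial_mult)
  have "(?D p * q - p * ?D q) * (t * t) = q * t * (?D p * t) - (p * t) * ?D q * t"
    by (simp add: algebra_simps)
  also have "\<dots> = q * t * (?D s * q + s * ?D q - p * ?D t) - (s * q) * ?D q * t"
    using D eq by (simp add: eq_diff_eq)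
  also have "\<dots> = ?D s * t * (q * q) - q * ?D t * (p * t)"
    by (simp add: algebra_simps)
  also have "\<dots> = (?D s * t - s * ?D t) * (q * q)"
    unfolding eq by (simp add: algebra_simps)
  finally show "(?D p * q - p * ?D q) * (t * t) = (?D s * t - s * ?D t) * (q * q)" .
qed

text \<open>The Jacobian of the rational functions \<open>u\<close>: the form du is the Jacobian times dx.\<close>

definition jacobian :: "('n \<Rightarrow> 'n ratfun) \<Rightarrow> 'n::{finite,linorder} ratfun" where
  "jacobian u = det (\<chi> i j. ratfun_partial j (u i))"


section \<open>Cyclic quotient singularities\<close>

text \<open>
  The quotient X = (1/r)(a) is the spectrum of the ring of polynomials p with
  \<open>p(\<xi>\<^sup>a x) = p(x)\<close> for all r-th roots of unity \<open>\<xi>\<close>.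
\<close>

definition root_action ::
  "('n \<Rightarrow> nat) \<Rightarrow> complex \<Rightarrow> 'n::{finite,linorder} cpoly \<Rightarrow> 'n cpoly" where
  "root_action a \<xi> p =
     Poly_Mapping.mapp (\<lambda>e c. \<xi> ^ (\<Sum>i\<in>UNIV. a i * Poly_Mapping.lookup e i) * c) p"

definition coordinate_ring :: "nat \<Rightarrow> ('n \<Rightarrow> nat) \<Rightarrow> 'n::{finite,linorder} cpoly set" where
  "coordinate_ring r a = {p. \<forall>\<xi>. \<xi> ^ r = 1 \<longrightarrow> root_action a \<xi> p = p}"

definition function_field :: "nat \<Rightarrow> ('n \<Rightarrow> nat) \<Rightarrow> 'n::{finite,linorder} ratfun set" where
  "function_field r a =
     {Fract p q | p q. p \<in> coordinate_ring r a \<and> q \<in> coordinate_ring r a \<and> q \<noteq> 0}"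


section \<open>Divisors over X and log discrepancies\<close>

text \<open>
  A prime divisor E over X is given by its order function \<open>v = ord\<^sub>E\<close> on the function field
  K of X. The functions arising in this way from prime divisors on normal varieties Y with a
  proper birational morphism to X are exactly the divisorial valuations: the normalized
  discrete valuations of K over the complex numbers having a center on X and a residue field
  of transcendence degree dim X - 1.
  Only the values of v on the nonzero elements of K matter.
\<close>

definition valuation_on :: "'n::{finite,linorder} ratfun set \<Rightarrow> ('n ratfun \<Rightarrow> int) \<Rightarrow> bool" where
  "valuation_on K v \<longleftrightarrow>
     (\<forall>c. c \<noteq> 0 \<longrightarrow> v (const c) = 0) \<and>
     (\<forall>f\<in>K. \<forall>g\<in>K. f \<noteq> 0 \<longrightarrow> g \<noteq> 0 \<longrightarrow> v (f * g) = v f + v g) \<and>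
     (\<forall>f\<in>K. \<forall>g\<in>K. f \<noteq> 0 \<longrightarrow> g \<noteq> 0 \<longrightarrow> f + g \<noteq> 0 \<longrightarrow> min (v f) (v g) \<le> v (f + g))"

text \<open>
  Coordinates at the generic point of E: \<open>u k\<close> is a uniformizer, and the residues of the other
  \<open>dim X - 1\<close> functions \<open>u i\<close> are algebraically independent over the complex numbers, that is,
  every nonzero polynomial P in them is a unit of the valuation ring (taking for P a variable
  shows that so are the \<open>u i\<close> themselves). Since the transcendence degree of the residue field
  is at most \<open>dim X - 1\<close>, such coordinates exist if and only if v is normalized and the residue
  field has transcendence degree equal to \<open>dim X - 1\<close>.
\<close>

definition generic_coordinates ::
  "'n::{finite,linorder} ratfun set \<Rightarrow> ('n ratfun \<Rightarrow> int) \<Rightarrow> 'n \<Rightarrow> ('n \<Rightarrow> 'n ratfun) \<Rightarrow> bool" where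
  "generic_coordinates K v k u \<longleftrightarrow>
     (\<forall>i. u i \<in> K) \<and> u k \<noteq> 0 \<and> v (u k) = 1 \<and>
     (\<forall>P. P \<noteq> 0 \<longrightarrow> (\<forall>e\<in>Poly_Mapping.keys P. Poly_Mapping.lookup e k = 0) \<longrightarrow>
        ratfun_eval u P \<noteq> 0 \<and> v (ratfun_eval u P) = 0)"

definition divisorial_valuation ::
  "'n::{finite,linorder} ratfun set \<Rightarrow> ('n ratfun \<Rightarrow> int) \<Rightarrow> bool" where
  "divisorial_valuation K v \<longleftrightarrow> valuation_on K v \<and> (\<exists>k u. generic_coordinates K v k u)"

text \<open>
  The center of v is the closed point x, the image of the origin: v is nonnegative on the
  coordinate ring, and the ideal where it is positive is the maximal ideal of x.
\<close>

definition centered_at_origin ::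
  "nat \<Rightarrow> ('n \<Rightarrow> nat) \<Rightarrow> ('n::{finite,linorder} ratfun \<Rightarrow> int) \<Rightarrow> bool" where
  "centered_at_origin r a v \<longleftrightarrow>
     (\<forall>p\<in>coordinate_ring r a. p \<noteq> 0 \<longrightarrow>
        0 \<le> v (Fract p 1) \<and> (0 < v (Fract p 1) \<longleftrightarrow> Poly_Mapping.lookup p 0 = 0))"

text \<open>
  The log discrepancy \<open>a(E,X) = 1 + ord\<^sub>E (K\<^sub>Y - f\<^sup>* K\<^sub>X)\<close>, for f the morphism from Y to X.
  As soon as the action has no pseudo-reflections (for example if two of the weights are prime
  to r) the quotient map is etale in codimension 1, so the invariant r-canonical form
  \<open>(dx)\<^sup>r\<close> generates \<open>\<O>\<^sub>X(r K\<^sub>X)\<close>, and therefore \<open>r (a(E,X) - 1)\<close> is the order along E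
  of the pullback of \<open>(dx)\<^sup>r\<close> as a rational section of \<open>r K\<^sub>Y\<close>. In
  generic coordinates u at E, the r-canonical forms on Y are generated by \<open>(du)\<^sup>r\<close>, and
  \<open>(dx)\<^sup>r = J\<^sup>-\<^sup>r (du)\<^sup>r\<close> for J the Jacobian of u. Here \<open>J\<^sup>r\<close> belongs to the function field
  of X although J itself need not. The number obtained does not depend on the choice of u.
\<close>

definition has_log_discrepancy ::
  "nat \<Rightarrow> ('n \<Rightarrow> nat) \<Rightarrow> ('n::{finite,linorder} ratfun \<Rightarrow> int) \<Rightarrow> real \<Rightarrow> bool" where
  "has_log_discrepancy r a v d \<longleftrightarrow>
     (\<exists>k u. generic_coordinates (function_field r a) v k u \<and>
        d = 1 - of_int (v (jacobian u ^ r)) / of_nat r)"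

text \<open>
  Taken as an infimum in the extended reals; it is a minimum because X is log terminal.
\<close>

definition mld :: "nat \<Rightarrow> ('n::{finite,linorder} \<Rightarrow> nat) \<Rightarrow> ereal" where
  "mld r a =
     Inf {ereal d | d v. divisorial_valuation (function_field r a) v \<and>
            centered_at_origin r a v \<and> has_log_discrepancy r a v d}"

end

theory Submission
  imports Defs
begin

text \<open>
  For \<open>j \<ge> 1\<close> let \<open>w\<^sub>i\<close> be the residue of \<open>j a\<^sub>i\<close> modulo r in the range from 1 to r. The monomial valuation
  with weights w, restricted to the function field of X and divided by the generator of its value
  group, is divisorial with center x, and its log discrepancy, computed on Laurent monomials, is at most
  \<open>\<Sum>w\<^sub>i / r\<close>. Hence \<open>\<Sum>a\<^sub>i \<le> \<Sum>w\<^sub>i\<close> for every j.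

  Put \<open>x\<^sub>i = a\<^sub>i / r\<close> and \<open>\<delta> = 2 - \<Sum>x\<^sub>i < 1/13\<close>. The sum of the fractional parts of the \<open>j x\<^sub>i\<close> and of
  \<open>j \<delta>\<close> is an integer. It is at least 3 if \<open>{j \<delta>} > \<delta>\<close>, and at most 3 if \<open>{j \<delta>} < 1 - \<delta>\<close>, as one sees by
  passing from j to -j. Under the divisibility hypothesis only four of the six real parameters are
  free, and these conditions for \<open>j \<le> 24\<close> are contradictory: this is a finite case
  distinction on floors, each case being refuted by a Farkas certificate. It applies
  if \<open>r > 25\<close>, after a small shift that moves integral multiples of \<open>x\<^sub>4\<close> and \<open>x\<^sub>5\<close> away from the integers.
  For \<open>r \<le> 25\<close> one has \<open>\<delta> = 1 / r\<close>, and finitely many weights remain.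
\<close>

section \<open>Monomial valuations\<close>

text \<open>Only an upper bound for the minimal log discrepancy has to be extracted from its
  definition: the theorem prescribes its value, and comparing that value with toric divisors yields
  every inequality used later. The number 13 acts through s = 2 r - (a_1 + ... + a_5), a positive
  integer prime to r with 13 s < r: it forces s = 1 if r \<le> 25, whereas for r \<ge> 26 no j
  \<delta> with 1 \<le> j \<le> 25 is an integer. The main obstacle is that a_4 and a_5 may share a
  factor with r. If r divides j a_4 and j a_5, the toric formula counts 1 for each of them although
  the fractional parts are 0, and the passage from j to -j breaks down. For such j \<le> 24 each
  divisibility alternative, the third one through its gcd bound, fixes the sum of the residues as 4
  r - (j s mod r). Shifting x_4 up and x_5 down turns their joint contribution 2 into about 1, so
  that together with the fractional part of j \<delta> the total is exactly 3, as both conditions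
  demand. The remaining entries of the shift are chosen to preserve the linear relations.\<close>

definition wt :: "('n::finite \<Rightarrow> nat) \<Rightarrow> ('n \<Rightarrow>\<^sub>0 nat) \<Rightarrow> nat" where
  "wt w e = (\<Sum>i\<in>UNIV. w i * Poly_Mapping.lookup e i)"

definition wt_order :: "('n::finite \<Rightarrow> nat) \<Rightarrow> 'n cpoly \<Rightarrow> nat" where
  "wt_order w p = Min (wt w ` Poly_Mapping.keys p)"

lemma wt_0 [simp]: "wt w 0 = 0"
  by (simp add: wt_def)

lemma wt_add [simp]: "wt w (e + f) = wt w e + wt w f"
  by (simp add: wt_def lookup_add distrib_left sum.distrib)

lemma wt_single [simp]: "wt w (Poly_Mapping.single i n) = w i * n"
proof -
  have "wt w (Poly_Mapping.single i n) = (\<Sum>j\<in>UNIV. if j = i then w i * n else 0)"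
    unfolding wt_def by (intro sum.cong) (auto simp: lookup_single when_def)
  then show ?thesis by simp
qed

lemma wt_eq_0_iff:
  assumes "\<And>i. w i > 0"
  shows "wt w e = 0 \<longleftrightarrow> e = 0"
proof -
  have "wt w e = 0 \<longleftrightarrow> (\<forall>i. w i * Poly_Mapping.lookup e i = 0)"
    by (simp add: wt_def)
  also have "\<dots> \<longleftrightarrow> (\<forall>i. Poly_Mapping.lookup e i = 0)"
    using assms by (metis less_irrefl mult_is_0)
  finally have "wt w e = 0 \<longleftrightarrow> (\<forall>i. Poly_Mapping.lookup e i = 0)" .
  then show ?thesis by (simp add: poly_mapping_eq_iff fun_eq_iff)
qed

lemma wt_order_le: "e \<in> Poly_Mapping.keys p \<Longrightarrow> wt_order w p \<le> wt w e"
  by (simp add: wt_order_def)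

lemma wt_order_attained:
  assumes "p \<noteq> 0"
  obtains e where "e \<in> Poly_Mapping.keys p" "wt w e = wt_order w p"
proof -
  have "Min (wt w ` Poly_Mapping.keys p) \<in> wt w ` Poly_Mapping.keys p"
    using assms by (intro Min_in) auto
  then show ?thesis using that by (auto simp: wt_order_def)
qed

lemma wt_order_eqI:
  assumes "e \<in> Poly_Mapping.keys p" "wt w e = n" "\<And>f. f \<in> Poly_Mapping.keys p \<Longrightarrow> n \<le> wt w f"
  shows "wt_order w p = n"
  unfolding wt_order_def using assms by (intro Min_eqI) auto

lemma wt_order_single [simp]: "c \<noteq> 0 \<Longrightarrow> wt_order w (Poly_Mapping.single e c) = wt w e"
  by (simp add: wt_order_def)

lemma single_eq_0_iff [simp]: "Poly_Mapping.single e c = 0 \<longleftrightarrow> c = 0"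
  by (metis lookup_single_eq lookup_zero single_zero)

lemma wt_order_1 [simp]: "wt_order w 1 = 0"
  using wt_order_single[of 1 w 0] by simp

definition initial_form :: "('n::finite \<Rightarrow> nat) \<Rightarrow> 'n cpoly \<Rightarrow> 'n cpoly" where
  "initial_form w p = Poly_Mapping.mapp (\<lambda>e c. c when wt w e = wt_order w p) p"

lemma lookup_initial_form:
  "Poly_Mapping.lookup (initial_form w p) e = (Poly_Mapping.lookup p e when wt w e = wt_order w p)"
  by (auto simp: initial_form_def lookup_mapp when_def in_keys_iff)

lemma initial_form_nonzero:
  assumes "p \<noteq> 0"
  shows "initial_form w p \<noteq> 0"
proof -
  obtain e where "e \<in> Poly_Mapping.keys p" "wt w e = wt_order w p"
    using wt_order_attained[OF assms] by blast
  then have "Poly_Mapping.lookup (initial_form w p) e \<noteq> 0"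
    by (simp add: lookup_initial_form in_keys_iff)
  then show ?thesis by auto
qed

lemma keys_initial_form:
  "e \<in> Poly_Mapping.keys (initial_form w p) \<Longrightarrow> wt w e = wt_order w p"
  by (auto simp: in_keys_iff lookup_initial_form)

lemma keys_minus_initial_form:
  "e \<in> Poly_Mapping.keys (p - initial_form w p) \<Longrightarrow> wt_order w p < wt w e"
  using wt_order_le[of e p w]
  by (auto simp: in_keys_iff lookup_minus lookup_initial_form when_def le_less split: if_splits)

lemma keys_mult_wt:
  assumes "e \<in> Poly_Mapping.keys (p * q)"
  obtains f g where "f \<in> Poly_Mapping.keys p" "g \<in> Poly_Mapping.keys q" "e = f + g"
  using keys_mult[of p q] assms by auto

text \<open>The product of the initial forms is nonzero because polynomials form an integral domain,
  and all other contributions to \<open>p * q\<close> have larger weight, so its monomials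
  survive.\<close>

lemma wt_order_mult:
  fixes p q :: "'n::{finite,linorder} cpoly"
  assumes "p \<noteq> 0" "q \<noteq> 0"
  shows "wt_order w (p * q) = wt_order w p + wt_order w q"
proof -
  let ?p = "initial_form w p" and ?q = "initial_form w q"
  have "?p * ?q \<noteq> 0" using assms by (simp add: initial_form_nonzero)
  then obtain e where e: "e \<in> Poly_Mapping.keys (?p * ?q)"
    by (metis all_not_in_conv keys_eq_empty)
  have wt_e: "wt w e = wt_order w p + wt_order w q"
    using e by (elim keys_mult_wt) (auto dest!: keys_initial_form)
  have r1: "e \<notin> Poly_Mapping.keys (?p * (q - ?q))"
    using wt_e by (auto elim!: keys_mult_wt dest!: keys_initial_form keys_minus_initial_form)
  have r2: "e \<notin> Poly_Mapping.keys ((p - ?p) * q)"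
    using wt_e by (auto elim!: keys_mult_wt dest!: keys_minus_initial_form wt_order_le[of _ q w])
  have "p * q = ?p * ?q + ?p * (q - ?q) + (p - ?p) * q"
    by (simp add: algebra_simps)
  then have "Poly_Mapping.lookup (p * q) e = Poly_Mapping.lookup (?p * ?q) e"
    using r1 r2 by (simp only: lookup_add in_keys_iff) simp
  then have "e \<in> Poly_Mapping.keys (p * q)" using e by (simp add: in_keys_iff)
  then show ?thesis
    using wt_e by (rule wt_order_eqI) (auto elim!: keys_mult_wt intro!: add_mono wt_order_le)
qed

lemma wt_order_add:
  assumes "p + q \<noteq> 0"
  shows "min (wt_order w p) (wt_order w q) \<le> wt_order w (p + q)"
proof -
  obtain e where e: "e \<in> Poly_Mapping.keys (p + q)" "wt w e = wt_order w (p + q)"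
    using wt_order_attained[OF assms] by blast
  then have "e \<in> Poly_Mapping.keys p \<or> e \<in> Poly_Mapping.keys q"
    using keys_add[of p q] by auto
  then show ?thesis using e(2) wt_order_le[of e _ w] by (auto simp: min_le_iff_disj)
qed

text \<open>By additivity of \<open>wt_order\<close> the value does not depend on the chosen
  fraction; at 0 it is arbitrary, hence the nonvanishing hypotheses below.\<close>

definition toric_val :: "('n::{finite,linorder} \<Rightarrow> nat) \<Rightarrow> 'n ratfun \<Rightarrow> int" where
  "toric_val w f =
     (SOME n. \<exists>p q. f = Fract p q \<and> p \<noteq> 0 \<and> q \<noteq> 0 \<and> n = int (wt_order w p) - int (wt_order w q))"

lemma toric_val_Fract:
  assumes "p \<noteq> 0" "q \<noteq> 0"
  shows "toric_val w (Fract p q) = int (wt_order w p) - int (wt_order w q)"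
  unfolding toric_val_def
proof (rule some_equality)
  fix n assume "\<exists>p' q'. Fract p q = Fract p' q' \<and> p' \<noteq> 0 \<and> q' \<noteq> 0 \<and>
    n = int (wt_order w p') - int (wt_order w q')"
  then obtain p' q' where *: "Fract p q = Fract p' q'" "p' \<noteq> 0" "q' \<noteq> 0"
    "n = int (wt_order w p') - int (wt_order w q')" by blast
  then have "p * q' = p' * q" using assms by (simp add: eq_fract)
  then have "wt_order w p + wt_order w q' = wt_order w p' + wt_order w q"
    using assms * by (metis wt_order_mult)
  then show "n = int (wt_order w p) - int (wt_order w q)" using * by simp
qed (use assms in blast)

lemma Fract_eq_0_iff: "q \<noteq> 0 \<Longrightarrow> Fract p q = 0 \<longleftrightarrow> p = 0"
  by (simp add: Zero_fract_def eq_fract)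

lemma nonzero_Fract:
  fixes f :: "'a::idom fract"
  assumes "f \<noteq> 0"
  obtains p q where "f = Fract p q" "p \<noteq> 0" "q \<noteq> 0"
  using assms by (cases f rule: Fract_cases_nonzero) auto

lemma toric_val_mult:
  assumes "f \<noteq> 0" "g \<noteq> 0"
  shows "toric_val w (f * g) = toric_val w f + toric_val w g"
proof -
  obtain p q where f: "f = Fract p q" "p \<noteq> 0" "q \<noteq> 0" using nonzero_Fract[OF assms(1)] by blast
  obtain s t where g: "g = Fract s t" "s \<noteq> 0" "t \<noteq> 0" using nonzero_Fract[OF assms(2)] by blast
  show ?thesis using f g by (simp add: toric_val_Fract wt_order_mult)
qed

lemma toric_val_add:
  assumes "f \<noteq> 0" "g \<noteq> 0" "f + g \<noteq> 0"
  shows "min (toric_val w f) (toric_val w g) \<le> toric_val w (f + g)"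
proof -
  obtain p q where f: "f = Fract p q" "p \<noteq> 0" "q \<noteq> 0" using nonzero_Fract[OF assms(1)] by blast
  obtain s t where g: "g = Fract s t" "s \<noteq> 0" "t \<noteq> 0" using nonzero_Fract[OF assms(2)] by blast
  have fg: "f + g = Fract (p * t + s * q) (q * t)" using f g by simp
  then have "p * t + s * q \<noteq> 0" using assms(3) f g Fract_eq_0_iff[of "q * t"] by auto
  then show ?thesis
    using wt_order_add[of "p * t" "s * q" w] f g
    by (simp add: fg toric_val_Fract wt_order_mult)
qed

lemma toric_val_1 [simp]: "toric_val w 1 = 0"
  using toric_val_mult[of 1 1 w] by simp

lemma toric_val_inverse: "f \<noteq> 0 \<Longrightarrow> toric_val w (inverse f) = - toric_val w f"
  using toric_val_mult[of f "inverse f" w] by simp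

lemma toric_val_power: "f \<noteq> 0 \<Longrightarrow> toric_val w (f ^ n) = int n * toric_val w f"
  by (induction n) (simp_all add: toric_val_mult algebra_simps)

lemma toric_val_prod:
  "(\<And>x. x \<in> A \<Longrightarrow> f x \<noteq> 0) \<Longrightarrow> toric_val w (prod f A) = (\<Sum>x\<in>A. toric_val w (f x))"
proof (induction A rule: infinite_finite_induct)
  case (insert x A)
  then show ?case by (simp add: toric_val_mult)
qed auto

section \<open>Monomials and constants as rational functions\<close>

definition var :: "'n::{finite,linorder} \<Rightarrow> 'n ratfun" where
  "var i = Fract (Poly_Mapping.single (Poly_Mapping.single i 1) 1) 1"

definition monomial :: "('n::{finite,linorder} \<Rightarrow>\<^sub>0 nat) \<Rightarrow> 'n ratfun" where
  "monomial e = Fract (Poly_Mapping.single e 1) 1"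

lemma monomial_nonzero [simp]: "monomial e \<noteq> 0"
  by (simp add: monomial_def Fract_eq_0_iff)

lemma monomial_0 [simp]: "monomial 0 = 1"
  by (simp add: monomial_def One_fract_def)

lemma monomial_add: "monomial (e + f) = monomial e * monomial f"
  by (simp add: monomial_def mult_single)

lemma toric_val_monomial [simp]: "toric_val w (monomial e) = int (wt w e)"
  by (simp add: monomial_def toric_val_Fract)

lemma Fract_single: "Fract (Poly_Mapping.single e 1) (Poly_Mapping.single f 1) = monomial e / monomial f"
  by (simp add: monomial_def)

lemma const_nonzero: "c \<noteq> 0 \<Longrightarrow> const c \<noteq> 0"
  by (simp add: const_def Fract_eq_0_iff)

lemma toric_val_const [simp]: "c \<noteq> 0 \<Longrightarrow> toric_val w (const c) = 0"
  by (simp add: const_def toric_val_Fract)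

lemma const_0 [simp]: "const 0 = 0" by (simp add: const_def Fract_eq_0_iff)

lemma const_1 [simp]: "const 1 = 1" by (simp add: const_def One_fract_def)

lemma const_add: "const (c + d) = const c + const d" by (simp add: const_def single_add)

lemma const_mult: "const (c * d) = const c * const d" by (simp add: const_def mult_single)

lemma const_minus: "const (- c) = - const c" by (simp add: const_def single_uminus)

lemma const_sum: "const (sum f A) = (\<Sum>x\<in>A. const (f x))"
  by (induction A rule: infinite_finite_induct) (simp_all add: const_add)

lemma const_prod: "const (prod f A) = (\<Prod>x\<in>A. const (f x))"
  by (induction A rule: infinite_finite_induct) (simp_all add: const_mult)

lemma const_of_int: "const (of_int n) = of_int n"
proof -
  have "const (of_nat n) = of_nat n" for n
    by (induction n) (simp_all add: const_add)
  then show ?thesis by (cases n rule: int_cases2) (simp_all add: const_minus)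
qed

lemma const_det: "const (det A) = det (\<chi> i j. const (A $ i $ j))"
  by (simp add: det_def const_sum const_mult const_prod const_of_int)

section \<open>Jacobians of Laurent monomials\<close>

lemma ratfun_partial_Fract:
  assumes "q \<noteq> 0"
  shows "ratfun_partial i (Fract p q) = Fract (poly_partial i p * q - p * poly_partial i q) (q * q)"
proof -
  have "ratfun_partial i (Fract p q) = ratfun_partial i (abs_fract (p, q))"
    using assms by (simp only: Fract.abs_eq if_False)
  also have "\<dots> = abs_fract (poly_partial i p * q - p * poly_partial i q, q * q)"
    using assms by (subst ratfun_partial.abs_eq) (simp_all only: fractrel_iff snd_conv fst_conv prod.case simp_thms)
  also have "\<dots> = Fract (poly_partial i p * q - p * poly_partial i q) (q * q)"
    using assms by (simp only: Fract.abs_eq mult_eq_0_iff if_False simp_thms)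
  finally show ?thesis .
qed

text \<open>Multiplying by the variable undoes the truncated subtraction in the exponent, so the
  Euler operator acts by a scalar, also for exponent 0.\<close>

lemma var_mult_partial_monomial:
  "Poly_Mapping.single (Poly_Mapping.single i 1) 1 * poly_partial i (Poly_Mapping.single e 1) =
    of_nat (Poly_Mapping.lookup e i) * (Poly_Mapping.single e 1 :: 'n::{finite,linorder} cpoly)"
proof (cases "Poly_Mapping.lookup e i = 0")
  case False
  then have "Poly_Mapping.single i 1 + (e - Poly_Mapping.single i 1) = e"
    by (intro poly_mapping_eqI) (auto simp: lookup_add lookup_minus lookup_single when_def)
  then show ?thesis
    by (simp add: poly_partial_single mult_single single_of_nat[symmetric] del: single_of_nat)
qed (simp add: poly_partial_single)

lemma ratfun_partial_monomial:
  "ratfun_partial j (monomial e / monomial f) =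
    const (of_int (int (Poly_Mapping.lookup e j) - int (Poly_Mapping.lookup f j))) * (monomial e / monomial f) * inverse (var j)"
proof -
  let ?e = "Poly_Mapping.single e (1::complex)" and ?f = "Poly_Mapping.single f (1::complex)"
  let ?x = "Poly_Mapping.single (Poly_Mapping.single j 1) (1::complex)"
  let ?m = "Poly_Mapping.lookup e j" and ?n = "Poly_Mapping.lookup f j"
  have v: "var j \<noteq> 0" by (simp add: var_def Fract_eq_0_iff)
  have "ratfun_partial j (monomial e / monomial f) * var j =
      Fract ((poly_partial j ?e * ?f - ?e * poly_partial j ?f) * ?x) (?f * ?f)"
    by (simp add: var_def ratfun_partial_Fract flip: Fract_single)
  also have "(poly_partial j ?e * ?f - ?e * poly_partial j ?f) * ?x =
      (?x * poly_partial j ?e) * ?f - ?e * (?x * poly_partial j ?f)"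
    by (simp add: algebra_simps)
  also have "\<dots> = (of_nat ?m - of_nat ?n) * ?e * ?f"
    unfolding var_mult_partial_monomial by (simp add: algebra_simps)
  also have "Fract \<dots> (?f * ?f) = Fract ((of_nat ?m - of_nat ?n) * ?e) ?f"
    by (simp add: eq_fract)
  also have "\<dots> = const (of_int (int ?m - int ?n)) * (monomial e / monomial f)"
    by (simp add: const_def single_diff flip: Fract_single)
  finally show ?thesis using v by (simp add: field_simps)
qed

lemma det_scale:
  fixes A :: "'a::comm_ring_1^'n^'n"
  shows "det (\<chi> i j. c i * d j * A $ i $ j) = (\<Prod>i\<in>UNIV. c i) * (\<Prod>j\<in>UNIV. d j) * det A"
proof -
  have "det (\<chi> i. c i *s (\<chi> j. d j * A $ i $ j)) = (\<Prod>i\<in>UNIV. c i) * det (\<chi> i j. d j * A $ i $ j)"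
    by (rule det_rows_mul)
  moreover have "det (\<chi> i j. d j * A $ i $ j) = det (\<chi> j. d j *s (transpose A $ j))"
    by (subst det_transpose[symmetric]) (simp add: transpose_def vector_scalar_mult_def)
  moreover have "\<dots> = (\<Prod>j\<in>UNIV. d j) * det (transpose A)"
    by (simp add: det_rows_mul)
  moreover have "(\<chi> i j. c i * d j * A $ i $ j) = (\<chi> i. c i *s (\<chi> j. d j * A $ i $ j))"
    by (simp add: vector_scalar_mult_def vec_eq_iff algebra_simps)
  ultimately show ?thesis by (simp add: det_transpose algebra_simps)
qed

lemma var_eq_monomial: "var i = monomial (Poly_Mapping.single i 1)"
  by (simp add: var_def monomial_def)

text \<open>In terms of du_i / u_i and dx_j / x_j the Jacobian matrix is the constant matrix of
  exponents; \<open>det_scale\<close> extracts the row factors u_i and the column factors 1 /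
  x_j.\<close>

lemma jacobian_monomials:
  fixes P Q :: "'n::{finite,linorder} \<Rightarrow> 'n \<Rightarrow>\<^sub>0 nat"
  shows "jacobian (\<lambda>i. monomial (P i) / monomial (Q i)) =
    (\<Prod>i\<in>UNIV. monomial (P i) / monomial (Q i)) * (\<Prod>j\<in>UNIV. inverse (var j)) *
    const (det (\<chi> i j. of_int (int (Poly_Mapping.lookup (P i) j) - int (Poly_Mapping.lookup (Q i) j))))"
proof -
  have "jacobian (\<lambda>i. monomial (P i) / monomial (Q i)) =
    det (\<chi> i j. (monomial (P i) / monomial (Q i)) * inverse (var j) *
      (\<chi> i j. const (of_int (int (Poly_Mapping.lookup (P i) j) - int (Poly_Mapping.lookup (Q i) j)))) $ i $ j)"
    unfolding jacobian_def ratfun_partial_monomial by (simp add: mult_ac)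
  then show ?thesis unfolding det_scale by (simp add: const_det)
qed

section \<open>Toric valuations of a cyclic quotient singularity\<close>

text \<open>Roots of unity act on each monomial by a scalar, and a primitive one detects
  divisibility by r.\<close>

lemma coordinate_ring_iff:
  assumes "r > 0"
  shows "p \<in> coordinate_ring r a \<longleftrightarrow> (\<forall>e\<in>Poly_Mapping.keys p. r dvd wt a e)"
proof
  assume p: "p \<in> coordinate_ring r a"
  define \<xi> where "\<xi> = exp (2 * of_real pi * \<i> / of_nat r)"
  have pow: "\<xi> ^ n = 1 \<longleftrightarrow> r dvd n" for n
    using complex_root_unity_eq_1[of r n] assms
    by (simp add: \<xi>_def mult_ac flip: exp_of_nat_mult)
  have root: "root_action a \<xi> p = p"
    using p pow[of r] by (simp add: coordinate_ring_def)
  show "\<forall>e\<in>Poly_Mapping.keys p. r dvd wt a e"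
  proof
    fix e assume e: "e \<in> Poly_Mapping.keys p"
    have "\<xi> ^ wt a e * Poly_Mapping.lookup p e = Poly_Mapping.lookup (root_action a \<xi> p) e"
      using e by (simp add: root_action_def lookup_mapp wt_def)
    then have "\<xi> ^ wt a e = 1" using e root by (simp add: in_keys_iff)
    then show "r dvd wt a e" by (simp add: pow)
  qed
next
  assume p: "\<forall>e\<in>Poly_Mapping.keys p. r dvd wt a e"
  show "p \<in> coordinate_ring r a"
    unfolding coordinate_ring_def
  proof (intro CollectI allI impI poly_mapping_eqI)
    fix \<xi> :: complex and e assume \<xi>: "\<xi> ^ r = 1"
    show "Poly_Mapping.lookup (root_action a \<xi> p) e = Poly_Mapping.lookup p e"
    proof (cases "e \<in> Poly_Mapping.keys p")
      case True
      then obtain m where "wt a e = r * m" using p by blast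
      then have "\<xi> ^ wt a e = 1" using \<xi> by (simp add: power_mult)
      then show ?thesis using True by (simp add: root_action_def lookup_mapp wt_def)
    qed (simp add: root_action_def lookup_mapp in_keys_iff)
  qed
qed

lemma single_in_coordinate_ring:
  "r > 0 \<Longrightarrow> r dvd wt a e \<Longrightarrow> Poly_Mapping.single e c \<in> coordinate_ring r a"
  by (simp add: coordinate_ring_iff)

lemma monomial_power_single: "monomial (Poly_Mapping.single i m) ^ n = monomial (Poly_Mapping.single i (m * n))"
  by (induction n) (simp_all add: single_add monomial_add)

lemma prod_monomial: "(\<Prod>x\<in>A. monomial (f x)) = monomial (\<Sum>x\<in>A. f x)"
  by (induction A rule: infinite_finite_induct) (simp_all add: monomial_add)

text \<open>\<open>w_dvd\<close> says that \<open>w / r\<close> pairs integrally with invariant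
  exponents, i.e. is a lattice point of the toric variety X. The index k is where the uniformizer
  sits among the coordinates.\<close>

locale toric_weight =
  fixes r :: nat and a w :: "'n::{finite,linorder} \<Rightarrow> nat" and k :: 'n
  assumes r_pos: "r > 0" and w_pos: "\<And>i. w i > 0"
    and w_dvd: "\<And>e. r dvd wt a e \<Longrightarrow> r dvd wt w e"
begin

text \<open>These are the positive values on quotients of invariant monomials; the additive form
  avoids truncated subtraction.\<close>

definition weight_gap :: "nat \<Rightarrow> bool" where
  "weight_gap m \<longleftrightarrow> m > 0 \<and>
     (\<exists>P Q. r dvd wt a P \<and> r dvd wt a Q \<and> wt w P = wt w Q + m)"

definition period :: nat where
  "period = (LEAST m. weight_gap m)"

lemma weight_gapI:
  "m > 0 \<Longrightarrow> r dvd wt a P \<Longrightarrow> r dvd wt a Q \<Longrightarrow> wt w P = wt w Q + m \<Longrightarrow> weight_gap m"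
  unfolding weight_gap_def by (intro conjI exI)

lemma period_props:
  "period > 0 \<and> (\<exists>P Q. r dvd wt a P \<and> r dvd wt a Q \<and> wt w P = wt w Q + period)"
proof -
  \<comment> \<open>The r-th power of the variable k, compared with 1, shows that a gap
    exists.\<close>
  have "weight_gap (w k * r)"
    using w_pos r_pos by (intro weight_gapI[of _ "Poly_Mapping.single k r" 0]) simp_all
  then show ?thesis unfolding period_def weight_gap_def[symmetric] by (rule LeastI)
qed

lemma period_pos: "period > 0"
  using period_props by blast

text \<open>Division with remainder: comparing e plus n copies of Q with n copies of P turns a
  nonzero remainder into a gap smaller than the least one.\<close>

lemma period_dvd:
  assumes "r dvd wt a e"
  shows "period dvd wt w e"
proof (rule ccontr)
  assume "\<not> period dvd wt w e"
  then have m: "0 < wt w e mod period" by (simp add: mod_greater_zero_iff_not_dvd)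
  obtain P Q where PQ: "r dvd wt a P" "r dvd wt a Q" "wt w P = wt w Q + period"
    using period_props by blast
  define n where "n = wt w e div period"
  have mul: "wt c (\<Sum>i<n. f) = n * wt c f" for c :: "'n \<Rightarrow> nat" and f
    by (induction n) simp_all
  have dvd: "r dvd wt a (e + (\<Sum>i<n. Q))" "r dvd wt a (\<Sum>i<n. P)"
    using assms PQ(1,2) by (simp_all add: mul)
  have "wt w e = n * period + wt w e mod period"
    by (simp add: n_def)
  then have "wt w (e + (\<Sum>i<n. Q)) = wt w (\<Sum>i<n. P) + wt w e mod period"
    unfolding wt_add mul PQ(3) by (simp only: distrib_left)
  then have "weight_gap (wt w e mod period)"
    by (rule weight_gapI[OF m dvd])
  then have "period \<le> wt w e mod period"
    unfolding period_def by (rule Least_le)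
  moreover have "wt w e mod period < period"
    using period_pos by simp
  ultimately show False by simp
qed

text \<open>The difference of two invariant weights is a multiple of r. A period larger than r only
  lowers the log discrepancy, which is harmless for an upper bound.\<close>

lemma r_le_period: "r \<le> period"
proof -
  obtain P Q where "r dvd wt a P" "r dvd wt a Q" "wt w P = wt w Q + period"
    using period_props by blast
  then have "r dvd period" using w_dvd[of P] w_dvd[of Q] by (simp add: dvd_add_right_iff)
  then show ?thesis using period_pos by (rule dvd_imp_le)
qed

text \<open>On the function field the division is exact by \<open>function_field_dvd\<close>; it
  normalizes the valuation.\<close>

definition val :: "'n ratfun \<Rightarrow> int" where
  "val f = toric_val w f div int period"

lemma coordinate_ring_dvd:
  assumes "p \<in> coordinate_ring r a" "p \<noteq> 0"
  shows "period dvd wt_order w p"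
proof -
  obtain e where "e \<in> Poly_Mapping.keys p" "wt w e = wt_order w p"
    using wt_order_attained[OF assms(2)] by blast
  then show ?thesis using assms(1) period_dvd[of e] by (auto simp: coordinate_ring_iff[OF r_pos])
qed

lemma function_field_dvd:
  assumes "f \<in> function_field r a" "f \<noteq> 0"
  shows "int period dvd toric_val w f"
proof -
  obtain p q where f: "f = Fract p q" "p \<in> coordinate_ring r a" "q \<in> coordinate_ring r a" "q \<noteq> 0"
    using assms(1) by (auto simp: function_field_def)
  moreover have "p \<noteq> 0" using assms(2) f by (auto simp: Fract_eq_0_iff)
  ultimately show ?thesis
    using coordinate_ring_dvd[of p] coordinate_ring_dvd[of q]
    by (simp add: toric_val_Fract dvd_diff)
qed

lemma valuation_on_val: "valuation_on (function_field r a) val"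
  unfolding valuation_on_def
proof (intro conjI ballI allI impI)
  fix f g assume f: "f \<in> function_field r a" "f \<noteq> 0" and g: "g \<in> function_field r a" "g \<noteq> 0"
  show "val (f * g) = val f + val g"
    using function_field_dvd[OF f] by (simp add: val_def toric_val_mult f g div_plus_div_distrib_dvd_left)
  assume "f + g \<noteq> 0"
  then have "min (toric_val w f) (toric_val w g) \<le> toric_val w (f + g)"
    using f g by (intro toric_val_add)
  then show "min (val f) (val g) \<le> val (f + g)"
    using period_pos unfolding val_def
    by (metis (no_types, opaque_lifting) min_le_iff_disj of_nat_0_less_iff zdiv_mono1)
qed (simp add: val_def)

text \<open>All weights are positive, so weight 0 belongs to the constant monomial alone.\<close>

lemma centered_val: "centered_at_origin r a val"
  unfolding centered_at_origin_def
proof (intro ballI impI)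
  fix p assume p: "p \<in> coordinate_ring r a" "p \<noteq> (0 :: 'n cpoly)"
  obtain e where e: "e \<in> Poly_Mapping.keys p" "wt w e = wt_order w p"
    using wt_order_attained[OF p(2)] by blast
  obtain m where m: "wt_order w p = period * m" using coordinate_ring_dvd[OF p] by blast
  have v: "val (Fract p 1) = int m"
    using p period_pos by (simp add: val_def toric_val_Fract m)
  have "m = 0 \<longleftrightarrow> wt_order w p = 0" using m period_pos by simp
  also have "\<dots> \<longleftrightarrow> Poly_Mapping.lookup p 0 \<noteq> 0"
  proof
    assume "wt_order w p = 0"
    then have "e = 0" using e by (simp add: wt_eq_0_iff[OF w_pos])
    then show "Poly_Mapping.lookup p 0 \<noteq> 0" using e by (simp add: in_keys_iff)
  next
    assume "Poly_Mapping.lookup p 0 \<noteq> 0"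
    then have "wt_order w p \<le> wt w 0" by (intro wt_order_le) (simp add: in_keys_iff)
    then show "wt_order w p = 0" by simp
  qed
  finally show "0 \<le> val (Fract p 1) \<and> (0 < val (Fract p 1) \<longleftrightarrow> Poly_Mapping.lookup p 0 = 0)"
    using v by auto
qed

lemma monomial_quotient_in_function_field:
  assumes "r dvd wt a P" "r dvd wt a Q"
  shows "monomial P / monomial Q \<in> function_field r a"
  unfolding function_field_def Fract_single[symmetric]
  using assms by (auto intro!: exI single_in_coordinate_ring r_pos)

definition gap_pair :: "('n \<Rightarrow>\<^sub>0 nat) \<times> ('n \<Rightarrow>\<^sub>0 nat)" where
  "gap_pair = (SOME (P, Q). r dvd wt a P \<and> r dvd wt a Q \<and> wt w P = wt w Q + period)"

text \<open>For \<open>i \<noteq> k\<close> numerator and denominator both have weight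
  \<open>r * w i * w k\<close>, and the factor r makes each of them invariant; these coordinates
  have value 0.\<close>

definition numer :: "'n \<Rightarrow> 'n \<Rightarrow>\<^sub>0 nat" where
  "numer i = (if i = k then fst gap_pair else Poly_Mapping.single i (r * w k))"

definition denom :: "'n \<Rightarrow> 'n \<Rightarrow>\<^sub>0 nat" where
  "denom i = (if i = k then snd gap_pair else Poly_Mapping.single k (r * w i))"

definition coord :: "'n \<Rightarrow> 'n ratfun" where
  "coord i = monomial (numer i) / monomial (denom i)"

lemma numer_denom_k:
  "r dvd wt a (numer k)" "r dvd wt a (denom k)" "wt w (numer k) = wt w (denom k) + period"
proof -
  obtain P Q where "r dvd wt a P \<and> r dvd wt a Q \<and> wt w P = wt w Q + period"
    using period_props by blast
  then have "case (P, Q) of (P, Q) \<Rightarrow> r dvd wt a P \<and> r dvd wt a Q \<and> wt w P = wt w Q + period"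
    by simp
  then have "case gap_pair of (P, Q) \<Rightarrow> r dvd wt a P \<and> r dvd wt a Q \<and> wt w P = wt w Q + period"
    unfolding gap_pair_def by (rule someI)
  then show "r dvd wt a (numer k)" "r dvd wt a (denom k)" "wt w (numer k) = wt w (denom k) + period"
    by (simp_all add: numer_def denom_def case_prod_beta)
qed

lemma coord_in_function_field: "coord i \<in> function_field r a"
proof (cases "i = k")
  case True
  then show ?thesis
    unfolding coord_def using numer_denom_k by (simp add: monomial_quotient_in_function_field)
next
  case False
  then show ?thesis
    unfolding coord_def by (intro monomial_quotient_in_function_field) (simp_all add: numer_def denom_def)
qed

lemma coord_nonzero: "coord i \<noteq> 0"
  by (simp add: coord_def)

lemma toric_val_coord: "toric_val w (coord i) = (if i = k then int period else 0)"
  using numer_denom_k(3)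
  by (auto simp: coord_def divide_inverse toric_val_mult toric_val_inverse numer_def denom_def)

definition scaled :: "('n \<Rightarrow>\<^sub>0 nat) \<Rightarrow> 'n \<Rightarrow>\<^sub>0 nat" where
  "scaled e = (\<Sum>i\<in>UNIV. Poly_Mapping.single i (r * w k * Poly_Mapping.lookup e i))"

lemma lookup_scaled: "Poly_Mapping.lookup (scaled e) i = r * w k * Poly_Mapping.lookup e i"
proof -
  have "Poly_Mapping.lookup (scaled e) i =
    (\<Sum>j\<in>UNIV. if j = i then r * w k * Poly_Mapping.lookup e i else 0)"
    unfolding scaled_def lookup_sum by (intro sum.cong) (auto simp: lookup_single when_def)
  then show ?thesis by simp
qed

lemma wt_scaled: "wt w (scaled e) = r * w k * wt w e"
  unfolding wt_def lookup_scaled by (simp add: sum_distrib_left mult_ac)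

text \<open>The coordinates other than the uniformizer are \<open>x\<^sub>i\<close> to the power \<open>r w\<^sub>k\<close> over \<open>x\<^sub>k\<close> to the power \<open>r w\<^sub>i\<close>;
  multiplying by a power of \<open>x\<^sub>k\<close> clears all denominators.\<close>

lemma prod_coord:
  assumes "Poly_Mapping.lookup e k = 0"
  shows "(\<Prod>i\<in>UNIV. coord i ^ Poly_Mapping.lookup e i) * monomial (Poly_Mapping.single k (r * wt w e)) =
    monomial (scaled e)"
proof -
  have "(\<Sum>i\<in>UNIV. Poly_Mapping.single k (r * w i * Poly_Mapping.lookup e i)) =
    Poly_Mapping.single k (r * wt w e)"
    by (intro poly_mapping_eqI)
      (auto simp: lookup_sum lookup_single when_def wt_def sum_distrib_left mult_ac)
  then have "(\<Prod>i\<in>UNIV. monomial (Poly_Mapping.single k (r * w i)) ^ Poly_Mapping.lookup e i) =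
    monomial (Poly_Mapping.single k (r * wt w e))"
    by (simp add: monomial_power_single prod_monomial)
  moreover have "(\<Prod>i\<in>UNIV. coord i ^ Poly_Mapping.lookup e i) *
      (\<Prod>i\<in>UNIV. monomial (Poly_Mapping.single k (r * w i)) ^ Poly_Mapping.lookup e i) =
    (\<Prod>i\<in>UNIV. monomial (Poly_Mapping.single i (r * w k)) ^ Poly_Mapping.lookup e i)"
    unfolding prod.distrib[symmetric]
  proof (rule prod.cong[OF refl])
    fix i :: 'n
    show "coord i ^ Poly_Mapping.lookup e i * monomial (Poly_Mapping.single k (r * w i)) ^ Poly_Mapping.lookup e i =
      monomial (Poly_Mapping.single i (r * w k)) ^ Poly_Mapping.lookup e i"
      using assms by (cases "i = k") (simp_all add: coord_def numer_def denom_def power_divide)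
  qed
  ultimately show ?thesis
    by (simp add: monomial_power_single prod_monomial scaled_def)
qed

text \<open>Once multiplied by a high power of x_k, the terms of P are monomials with distinct
  exponents and common weight \<open>w k * N\<close>, so nothing cancels. This gives the algebraic
  independence of the residues.\<close>

lemma ratfun_eval_coord:
  assumes "P \<noteq> 0" and P: "\<And>e. e \<in> Poly_Mapping.keys P \<Longrightarrow> Poly_Mapping.lookup e k = 0"
  shows "ratfun_eval coord P \<noteq> 0 \<and> toric_val w (ratfun_eval coord P) = 0"
proof -
  define N where "N = (\<Sum>e\<in>Poly_Mapping.keys P. r * wt w e)"
  define \<phi> where "\<phi> = (\<lambda>e. scaled e + Poly_Mapping.single k (N - r * wt w e))"
  define p where "p = (\<Sum>e\<in>Poly_Mapping.keys P. Poly_Mapping.single (\<phi> e) (Poly_Mapping.lookup P e))"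
  have N: "r * wt w e \<le> N" if "e \<in> Poly_Mapping.keys P" for e
    unfolding N_def using that member_le_sum[of e "Poly_Mapping.keys P" "\<lambda>e. r * wt w e"] by simp
  \<comment> \<open>Away from k the exponents of \<open>\<phi> e\<close> are those of e times
    \<open>r * w k\<close>; at k both e and f vanish.\<close>
  have inj: "e = f" if "e \<in> Poly_Mapping.keys P" "f \<in> Poly_Mapping.keys P" "\<phi> e = \<phi> f" for e f
  proof (rule poly_mapping_eqI)
    fix i
    have "Poly_Mapping.lookup (\<phi> e) i = Poly_Mapping.lookup (\<phi> f) i" using that by simp
    then show "Poly_Mapping.lookup e i = Poly_Mapping.lookup f i"
      using P[OF that(1)] P[OF that(2)] r_pos w_pos[of k]
      by (cases "i = k") (auto simp: \<phi>_def lookup_add lookup_scaled lookup_single when_def)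
  qed
  have lookup_p: "Poly_Mapping.lookup p (\<phi> e) = Poly_Mapping.lookup P e" if "e \<in> Poly_Mapping.keys P" for e
  proof -
    have "Poly_Mapping.lookup p (\<phi> e) =
      (\<Sum>f\<in>Poly_Mapping.keys P. if f = e then Poly_Mapping.lookup P e else 0)"
      unfolding p_def lookup_sum using that inj
      by (intro sum.cong) (auto simp: lookup_single when_def)
    then show ?thesis using that by simp
  qed
  have keys_p: "\<exists>f\<in>Poly_Mapping.keys P. e = \<phi> f" if "e \<in> Poly_Mapping.keys p" for e
  proof (rule ccontr)
    assume "\<not> (\<exists>f\<in>Poly_Mapping.keys P. e = \<phi> f)"
    then have "Poly_Mapping.lookup p e = 0"
      unfolding p_def lookup_sum by (intro sum.neutral) (auto simp: lookup_single when_def)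
    then show False using that by (simp add: in_keys_iff)
  qed
  have wt_\<phi>: "wt w (\<phi> e) = w k * N" if "e \<in> Poly_Mapping.keys P" for e
    using N[OF that] by (simp add: \<phi>_def wt_scaled algebra_simps flip: distrib_left)
  obtain e where e: "e \<in> Poly_Mapping.keys P" using assms(1) by (metis all_not_in_conv keys_eq_empty)
  then have e': "\<phi> e \<in> Poly_Mapping.keys p" using lookup_p by (simp add: in_keys_iff)
  then have p0: "p \<noteq> 0" by auto
  have order: "wt_order w p = w k * N"
    using e' wt_\<phi>[OF e] by (rule wt_order_eqI) (use keys_p wt_\<phi> in fastforce)
  have "ratfun_eval coord P * monomial (Poly_Mapping.single k N) =
    (\<Sum>e\<in>Poly_Mapping.keys P. const (Poly_Mapping.lookup P e) *
      ((\<Prod>i\<in>UNIV. coord i ^ Poly_Mapping.lookup e i) * monomial (Poly_Mapping.single k N)))"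
    by (simp add: ratfun_eval_def sum_distrib_right mult.assoc)
  also have "\<dots> = (\<Sum>e\<in>Poly_Mapping.keys P. Fract (Poly_Mapping.single (\<phi> e) (Poly_Mapping.lookup P e)) 1)"
  proof (rule sum.cong[OF refl])
    fix e assume e: "e \<in> Poly_Mapping.keys P"
    have "monomial (Poly_Mapping.single k N) =
      monomial (Poly_Mapping.single k (r * wt w e)) * monomial (Poly_Mapping.single k (N - r * wt w e))"
      using N[OF e] by (simp flip: monomial_add single_add)
    then have "(\<Prod>i\<in>UNIV. coord i ^ Poly_Mapping.lookup e i) * monomial (Poly_Mapping.single k N) = monomial (\<phi> e)"
      using prod_coord[OF P[OF e]] by (simp add: \<phi>_def monomial_add flip: mult.assoc)
    then show "const (Poly_Mapping.lookup P e) *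
        ((\<Prod>i\<in>UNIV. coord i ^ Poly_Mapping.lookup e i) * monomial (Poly_Mapping.single k N)) =
      Fract (Poly_Mapping.single (\<phi> e) (Poly_Mapping.lookup P e)) 1"
      by (simp add: monomial_def const_def mult_single)
  qed
  also have "\<dots> = Fract p 1"
  proof -
    have "(\<Sum>x\<in>A. Fract (f x) 1) = Fract (sum f A) 1" for A and f :: "('n \<Rightarrow>\<^sub>0 nat) \<Rightarrow> 'n cpoly"
      by (induction A rule: infinite_finite_induct) (simp_all add: Zero_fract_def)
    then show ?thesis by (simp add: p_def)
  qed
  finally have eq: "ratfun_eval coord P * monomial (Poly_Mapping.single k N) = Fract p 1" .
  have ne: "ratfun_eval coord P \<noteq> 0"
    using eq p0 by (auto simp: Fract_eq_0_iff)
  have "toric_val w (ratfun_eval coord P) + int (w k * N) = toric_val w (Fract p 1)"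
    using toric_val_mult[OF ne monomial_nonzero, of w "Poly_Mapping.single k N"] eq by simp
  then show ?thesis using ne p0 order by (simp add: toric_val_Fract)
qed

lemma generic_coord: "generic_coordinates (function_field r a) val k coord"
  unfolding generic_coordinates_def
proof (intro conjI allI impI)
  fix P :: "'n cpoly"
  assume "P \<noteq> 0" "\<forall>e\<in>Poly_Mapping.keys P. Poly_Mapping.lookup e k = 0"
  then show "ratfun_eval coord P \<noteq> 0" "val (ratfun_eval coord P) = 0"
    using ratfun_eval_coord[of P] by (auto simp: val_def)
next
  show "val (coord k) = 1" using period_pos by (simp add: val_def toric_val_coord)
qed (simp_all add: coord_in_function_field coord_nonzero)

definition expo :: "((complex, 'n) vec, 'n) vec" where
  "expo = (\<chi> i j. of_int (int (Poly_Mapping.lookup (numer i) j) - int (Poly_Mapping.lookup (denom i) j)))"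

text \<open>The rows with \<open>i \<noteq> k\<close> force a kernel vector to be a multiple of w;
  row k pairs w to \<open>period\<close>, which is not 0, so the multiple is 0.\<close>

lemma det_expo: "det expo \<noteq> 0"
proof -
  have "y = 0" if y: "expo *v y = 0" for y
  proof -
    have row: "(\<Sum>j\<in>UNIV. expo $ i $ j * y $ j) = 0" for i
      using y by (simp add: matrix_vector_mult_def vec_eq_iff)
    have ratio: "of_nat (w k) * y $ i = of_nat (w i) * y $ k" for i
    proof (cases "i = k")
      case False
      have "(\<Sum>j\<in>UNIV. expo $ i $ j * y $ j) =
        (\<Sum>j\<in>UNIV. (if j = i then of_nat (r * w k) * y $ i else 0) - (if j = k then of_nat (r * w i) * y $ k else 0))"
        using False by (intro sum.cong) (auto simp: expo_def numer_def denom_def lookup_single when_def)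
      also have "\<dots> = of_nat (r * w k) * y $ i - of_nat (r * w i) * y $ k"
        by (simp add: sum_subtractf)
      finally have "0 = of_nat (r * w k) * y $ i - of_nat (r * w i) * y $ k"
        unfolding row .
      then have "of_nat r * (of_nat (w k) * y $ i - of_nat (w i) * y $ k) = 0"
        by (auto simp: algebra_simps)
      then show ?thesis using r_pos by (auto simp: algebra_simps)
    qed simp
    have "0 = of_nat (w k) * (\<Sum>j\<in>UNIV. expo $ k $ j * y $ j)" by (simp add: row)
    also have "\<dots> = (\<Sum>j\<in>UNIV. expo $ k $ j * (of_nat (w j) * y $ k))"
      by (simp add: sum_distrib_left mult.left_commute[of "of_nat (w k)"] ratio)
    also have "\<dots> = of_int (int (wt w (numer k)) - int (wt w (denom k))) * y $ k"
      by (simp add: expo_def wt_def sum_distrib_left sum_subtractf algebra_simps)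
    also have "\<dots> = of_nat period * y $ k" by (simp add: numer_denom_k(3))
    finally have "y $ k = 0" using period_pos by simp
    then show ?thesis using ratio w_pos[of k] by (simp add: vec_eq_iff)
  qed
  then have "invertible expo"
    unfolding invertible_left_inverse matrix_left_invertible_ker by blast
  then show ?thesis by (simp add: invertible_det_nz)
qed

text \<open>The uniformizer contributes \<open>period\<close> to the weight of the Jacobian, and the
  factors 1 / x_j contribute minus the sum of the weights.\<close>

lemma log_discrepancy_val:
  "has_log_discrepancy r a val (real (\<Sum>i\<in>UNIV. w i) / real period)"
  unfolding has_log_discrepancy_def
proof (intro exI conjI)
  let ?S = "\<Sum>i\<in>UNIV. w i"
  show "generic_coordinates (function_field r a) val k coord" by (rule generic_coord)
  have J: "jacobian coord = (\<Prod>i\<in>UNIV. coord i) * (\<Prod>j\<in>UNIV. inverse (var j)) * const (det expo)"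
    unfolding coord_def[abs_def] expo_def by (rule jacobian_monomials)
  have ne: "(\<Prod>i\<in>UNIV. coord i) \<noteq> 0" "(\<Prod>j\<in>(UNIV::'n set). inverse (var j)) \<noteq> 0" "const (det expo) \<noteq> (0::'n ratfun)"
    by (simp_all add: coord_nonzero var_eq_monomial const_nonzero det_expo)
  then have "toric_val w (jacobian coord) = int period - int ?S"
    unfolding J
    by (simp add: toric_val_mult toric_val_prod coord_nonzero toric_val_coord toric_val_inverse
        var_eq_monomial det_expo sum_negf)
  moreover have "jacobian coord \<noteq> 0" unfolding J using ne by simp
  ultimately have v: "toric_val w (jacobian coord ^ r) = int r * (int period - int ?S)"
    by (simp add: toric_val_power)
  \<comment> \<open>The r-th power of the product of all variables is invariant; hence
    \<open>period\<close> divides r times the sum of the weights, and the division in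
    \<open>val\<close> is exact.\<close>
  have "wt c (\<Sum>i\<in>UNIV. Poly_Mapping.single i r) = r * (\<Sum>i\<in>UNIV. c i)" for c :: "'n \<Rightarrow> nat"
  proof -
    have "Poly_Mapping.lookup (\<Sum>i\<in>UNIV. Poly_Mapping.single i r) j = r" for j :: 'n
      by (simp add: lookup_sum lookup_single when_def)
    then show ?thesis by (simp add: wt_def sum_distrib_left mult_ac)
  qed
  then have "period dvd r * ?S"
    using period_dvd[of "\<Sum>i\<in>UNIV. Poly_Mapping.single i r"] by simp
  then obtain m where m: "r * ?S = period * m" by blast
  have "val (jacobian coord ^ r) = (int period * (int r - int m)) div int period"
    unfolding val_def v using arg_cong[OF m, of int] by (simp add: algebra_simps)
  then have val: "val (jacobian coord ^ r) = int r - int m" using period_pos by simp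
  have "real ?S / real period = real m / real r"
    using arg_cong[OF m, of real] r_pos period_pos by (simp add: field_simps)
  then show "real ?S / real period = 1 - of_int (val (jacobian coord ^ r)) / of_nat r"
    unfolding val using r_pos by (simp add: diff_divide_distrib)
qed

lemma mld_le: "mld r a \<le> ereal (real (\<Sum>i\<in>UNIV. w i) / real r)"
proof -
  have "mld r a \<le> ereal (real (\<Sum>i\<in>UNIV. w i) / real period)"
    unfolding mld_def
    using valuation_on_val generic_coord centered_val log_discrepancy_val
    by (intro Inf_lower) (auto simp: divisorial_valuation_def)
  also have "\<dots> \<le> ereal (real (\<Sum>i\<in>UNIV. w i) / real r)"
    unfolding ereal_less_eq using r_le_period r_pos by (intro divide_left_mono) (simp_all add: sum_nonneg)
  finally show ?thesis .
qed

end

text \<open>Residues are taken in 1..r rather than 0..r-1: positive weights put the center at the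
  origin, and the residue r gives the summand 1 of the toric formula at integral multiples.\<close>

lemma mld_le_weights:
  fixes a :: "'n::{finite,linorder} \<Rightarrow> nat"
  assumes "r > 0" "\<And>i. a i > 0" "j > 0"
  shows "mld r a \<le> ereal (real (\<Sum>i\<in>UNIV. (j * a i - 1) mod r + 1) / real r)"
proof -
  define w where "w = (\<lambda>i. (j * a i - 1) mod r + 1)"
  have w: "int r dvd int (w i) - int j * int (a i)" for i
  proof -
    define b where "b = j * a i"
    have "b \<ge> 1" using assms(2)[of i] assms(3) by (simp add: b_def Suc_le_eq)
    then have "r * ((b - 1) div r) + (b - 1) mod r + 1 = b" by simp
    then have "int r * int ((b - 1) div r) + int ((b - 1) mod r) + 1 = int b"
      by (metis of_nat_1 of_nat_add of_nat_mult)
    moreover have "int (w i) = int ((b - 1) mod r) + 1" by (simp add: w_def b_def)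
    moreover have "int j * int (a i) = int b" by (simp add: b_def)
    ultimately have "int (w i) - int j * int (a i) = int r * - int ((b - 1) div r)"
      by simp
    then show ?thesis by simp
  qed
  have "toric_weight r a w"
  proof
    fix e assume e: "r dvd wt a e"
    have "int (wt w e) - int j * int (wt a e) =
      (\<Sum>i\<in>UNIV. (int (w i) - int j * int (a i)) * int (Poly_Mapping.lookup e i))"
      by (simp add: wt_def sum_distrib_left sum_subtractf algebra_simps)
    also have "int r dvd \<dots>" by (intro dvd_sum dvd_mult2 w)
    finally have "int r dvd int (wt w e) - int j * int (wt a e)" .
    moreover have "int r dvd int j * int (wt a e)" using e by simp
    ultimately have "int r dvd (int (wt w e) - int j * int (wt a e)) + int j * int (wt a e)"
      by (rule dvd_add)
    then have "int r dvd int (wt w e)" by simp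
    then show "r dvd wt w e" by simp
  qed (simp_all add: assms w_def)
  then show ?thesis unfolding w_def by (rule toric_weight.mld_le)
qed

section \<open>Checking Farkas certificates\<close>

fun lin :: "int list \<Rightarrow> real list \<Rightarrow> real" where
  "lin (c # cs) (x # xs) = of_int c * x + lin cs xs"
| "lin _ _ = 0"

text \<open>Missing coefficients count as zero, in accordance with \<open>lin\<close>.\<close>

fun ladd :: "int list \<Rightarrow> int list \<Rightarrow> int list" where
  "ladd (a # as) (b # bs) = (a + b) # ladd as bs"
| "ladd [] bs = bs"
| "ladd as [] = as"

definition lscale :: "int \<Rightarrow> int list \<Rightarrow> int list" where
  "lscale k = map (\<lambda>c. k * c)"

lemma lin_ladd [simp]: "lin (ladd a b) X = lin a X + lin b X"
proof (induction a b arbitrary: X rule: ladd.induct)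
  case (1 a as b bs)
  then show ?case by (cases X) (auto simp: algebra_simps)
qed auto

lemma lin_lscale [simp]: "lin (lscale k a) X = of_int k * lin a X"
proof (induction a arbitrary: X)
  case (Cons c cs)
  then show ?case by (cases X) (auto simp: lscale_def algebra_simps)
qed (auto simp: lscale_def)

lemma lin_zero: "list_all (\<lambda>c. c = 0) a \<Longrightarrow> lin a X = 0"
proof (induction a arbitrary: X)
  case (Cons c cs)
  then show ?case by (cases X) auto
qed auto

text \<open>
  The pair \<open>(s, c)\<close> stands for the inequality \<open>lin c X > 0\<close> if \<open>s\<close> holds and for
  \<open>lin c X \<ge> 0\<close> otherwise.
\<close>

type_synonym ineq = "bool \<times> int list"

fun sat :: "real list \<Rightarrow> ineq \<Rightarrow> bool" where
  "sat X (s, c) \<longleftrightarrow> (if s then 0 < lin c X else 0 \<le> lin c X)"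

text \<open>An index out of range yields the valid inequality 0 \<ge> 0, so a wrong certificate can
  fail but cannot prove anything false.\<close>

fun pick :: "ineq list \<Rightarrow> int \<Rightarrow> ineq" where
  "pick [] i = (False, [])"
| "pick (h # hs) i = (if i = 0 then h else pick hs (i - 1))"

lemma sat_pick: "list_all (sat X) H \<Longrightarrow> sat X (pick H i)"
  by (induction H arbitrary: i) auto

text \<open>Terms with \<open>k \<le> 0\<close> are skipped, so every certificate describes a
  nonnegative combination; it is strict once a strict inequality has a positive multiplier.\<close>

fun combine :: "ineq list \<Rightarrow> (int \<times> int) list \<Rightarrow> ineq" where
  "combine H [] = (False, [])"
| "combine H ((k, i) # ks) =
     (if k > 0 then
        (case pick H i of (s, c) \<Rightarrow> case combine H ks of (s', c') \<Rightarrow> (s \<or> s', ladd (lscale k c) c'))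
      else combine H ks)"

lemma sat_combine: "list_all (sat X) H \<Longrightarrow> sat X (combine H ks)"
proof (induction ks)
  case (Cons a ks)
  obtain k i where a: "a = (k, i)" by (cases a)
  obtain s c where p: "pick H i = (s, c)" by (cases "pick H i")
  obtain s' c' where q: "combine H ks = (s', c')" by (cases "combine H ks")
  have "sat X (s, c)" using sat_pick[OF Cons.prems, of i] p by simp
  moreover have "sat X (s', c')" using Cons q by simp
  ultimately show ?case
    using Cons by (auto simp: a p q add_pos_nonneg add_nonneg_pos split: if_splits)
qed simp

type_synonym farkas = "int \<times> (int \<times> int) list"

text \<open>The positive integer k clears the denominators of rational Farkas multipliers.\<close>

definition proves :: "ineq list \<Rightarrow> farkas \<Rightarrow> int list \<Rightarrow> bool" where
  "proves H = (\<lambda>(k, ks) c. k > 0 \<and>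
     (case combine H ks of (s, c') \<Rightarrow> s \<and> list_all (\<lambda>x. x = 0) (ladd c' (lscale (- k) c))))"

lemma proves_sound:
  assumes "proves H f c" "list_all (sat X) H"
  shows "0 < lin c X"
proof -
  obtain k ks where f: "f = (k, ks)" by (cases f)
  obtain s c' where q: "combine H ks = (s, c')" by (cases "combine H ks")
  have k: "k > 0" and s: "s" and z: "list_all (\<lambda>x. x = 0) (ladd c' (lscale (- k) c))"
    using assms(1) by (auto simp: proves_def f q)
  have "0 < lin c' X"
    using sat_combine[OF assms(2), of ks] q s by simp
  moreover have "lin c' X = of_int k * lin c X"
    using lin_zero[OF z, of X] by simp
  ultimately show ?thesis
    using k by (simp add: zero_less_mult_iff)
qed

text \<open>
  Points are \<open>X = [x, y, z, \<delta>, 1]\<close>, so \<open>bnd j L m\<close> is the form \<open>j L - m\<close> and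
  \<open>dform\<close> is \<open>\<delta>\<close>.
\<close>

definition bnd :: "int \<Rightarrow> int list \<Rightarrow> int \<Rightarrow> int list" where
  "bnd j L m = ladd (lscale j L) [0, 0, 0, 0, - m]"

definition dform :: "int list" where
  "dform = [0, 0, 0, 1, 0]"

fun drop_at :: "int \<Rightarrow> 'a list \<Rightarrow> 'a list" where
  "drop_at i [] = []"
| "drop_at i (x # xs) = (if i = 0 then xs else x # drop_at (i - 1) xs)"

fun entry :: "'a \<Rightarrow> 'a list \<Rightarrow> int \<Rightarrow> 'a" where
  "entry d [] i = d"
| "entry d (x # xs) i = (if i = 0 then x else entry d xs (i - 1))"

lemma entry_mem: "0 \<le> i \<Longrightarrow> i < int (length xs) \<Longrightarrow> entry x xs i \<in> set xs"
  by (induction xs arbitrary: i) auto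

lemma entry_default: "i < 0 \<or> int (length xs) \<le> i \<Longrightarrow> entry x xs i = x"
  by (induction xs arbitrary: i) auto

lemma sum_list_drop_at:
  fixes f :: "'b \<Rightarrow> int"
  shows "0 \<le> i \<Longrightarrow> i < int (length xs) \<Longrightarrow>
    sum_list (map f xs) = f (entry x xs i) + sum_list (map f (drop_at i xs))"
  by (induction xs arbitrary: i) auto

lemma set_drop_at: "set (drop_at i xs) \<subseteq> set xs"
  by (induction xs arbitrary: i) auto

text \<open>
  A certificate is a decision tree. \<open>Split j i m\<close> distinguishes \<open>j L\<^sub>i < m\<close> from \<open>j L\<^sub>i > m\<close>;
  an index i outside 0..4 stands for \<open>\<delta>\<close>. \<open>Upper\<close> and \<open>Lower\<close> bound one of the five
  floors through their sum, from bounds on the other four. Inequalities are referred to by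
  position, the most recently added one being number 0; \<open>(k, ks)\<close> proves \<open>c > 0\<close> by exhibiting
  \<open>k c\<close> as the combination \<open>ks\<close>.
\<close>

datatype cert =
    Absurd "(int \<times> int) list"
  | Split int int int cert cert
  | Upper int int int farkas farkas "(int \<times> farkas) list" cert
  | Lower int int int farkas farkas "(int \<times> farkas) list" cert

text \<open>In \<open>Upper\<close>, f and g certify that n is the floor of j \<delta> and that the
  fractional part exceeds \<delta>; in \<open>Lower\<close>, that it is below 1 - \<delta>. A strict
  upper bound m on j L bounds the floor by m - 1, whence \<open>fst b - 1\<close>. Index 5 may use
  the multiple \<open>J + 1\<close>, which occurs in the condition of \<open>Lower\<close>.\<close>

fun check :: "int \<Rightarrow> int list list \<Rightarrow> ineq list \<Rightarrow> cert \<Rightarrow> bool" where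
  "check J Ls H (Absurd ks) =
     (case combine H ks of (s, c) \<Rightarrow> s \<and> list_all (\<lambda>x. x = 0) c)"
| "check J Ls H (Split j i m t u) =
     (1 \<le> j \<and> j \<le> J + (if i = 5 then 1 else 0) \<and>
      (let L = entry dform Ls i; c = bnd j L m in
        check J Ls ((True, lscale (- 1) c) # H) t \<and> check J Ls ((True, c) # H) u))"
| "check J Ls H (Upper j i n f g bs t) =
     (2 \<le> j \<and> j \<le> J \<and> 0 \<le> i \<and> i < 5 \<and>
      proves H f (bnd (j - 1) dform n) \<and> proves H g (lscale (- 1) (bnd j dform (n + 1))) \<and>
      list_all2 (\<lambda>L (l, e). proves H e (bnd j L l)) (drop_at i Ls) bs \<and>
      check J Ls ((True, lscale (- 1)
         (bnd j (entry dform Ls i) (2 * j - 2 - n - sum_list (map fst bs)))) # H) t)"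
| "check J Ls H (Lower j i n f g bs t) =
     (2 \<le> j \<and> j \<le> J \<and> 0 \<le> i \<and> i < 5 \<and>
      proves H f (bnd j dform n) \<and> proves H g (lscale (- 1) (bnd (j + 1) dform (n + 1))) \<and>
      list_all2 (\<lambda>L (l, e). proves H e (lscale (- 1) (bnd j L l))) (drop_at i Ls) bs \<and>
      check J Ls ((True, bnd j (entry dform Ls i)
         (2 * j - 3 - n - sum_list (map (\<lambda>b. fst b - 1) bs))) # H) t)"

locale floor_pattern =
  fixes J :: int and Ls :: "int list list" and X :: "real list" and d :: real
  assumes len: "length Ls = 5"
    and X_d: "\<And>j m. lin (bnd j dform m) X = of_int j * d - of_int m"
    and X_1: "\<And>j L m. L \<in> set Ls \<Longrightarrow> lin (bnd j L m) X = of_int j * lin L X - of_int m"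
    and nonint: "\<And>j L. 1 \<le> j \<Longrightarrow> j \<le> J \<Longrightarrow> L \<in> set Ls \<Longrightarrow> of_int j * lin L X \<notin> \<int>"
    and nonint_d: "\<And>j. 1 \<le> j \<Longrightarrow> j \<le> J + 1 \<Longrightarrow> of_int j * d \<notin> \<int>"
    and upper: "\<And>j n. 2 \<le> j \<Longrightarrow> j \<le> J \<Longrightarrow> of_int n < of_int (j - 1) * d \<Longrightarrow>
      of_int j * d < of_int n + 1 \<Longrightarrow> (\<Sum>L\<leftarrow>Ls. \<lfloor>of_int j * lin L X\<rfloor>) + n \<le> 2 * j - 3"
    and lower: "\<And>j n. 2 \<le> j \<Longrightarrow> j \<le> J \<Longrightarrow> of_int n < of_int j * d \<Longrightarrow>
      of_int (j + 1) * d < of_int n + 1 \<Longrightarrow> 2 * j - 3 \<le> (\<Sum>L\<leftarrow>Ls. \<lfloor>of_int j * lin L X\<rfloor>) + n"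
begin

text \<open>A leaf is a linear contradiction, and inner nodes add only inequalities true at X: by
  nonintegrality for \<open>Split\<close>, by the floor bounds for the other two.\<close>

lemma check_sound: "check J Ls H t \<Longrightarrow> list_all (sat X) H \<Longrightarrow> False"
proof (induction t arbitrary: H)
  case (Absurd ks)
  obtain s c where q: "combine H ks = (s, c)" by (cases "combine H ks")
  from Absurd(1) have "s" "list_all (\<lambda>x. x = 0) c" by (auto simp: q)
  with sat_combine[OF Absurd(2), of ks] lin_zero[of c X] show ?case by (simp add: q)
next
  case (Split j i m t u)
  define c where "c = bnd j (entry dform Ls i) m"
  have j: "1 \<le> j" "j \<le> J + (if i = 5 then 1 else 0)"
    and t: "check J Ls ((True, lscale (- 1) c) # H) t" "check J Ls ((True, c) # H) u"
    using Split.prems(1) by (auto simp: c_def Let_def)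
  have "lin c X \<noteq> 0"
  proof (cases "0 \<le> i \<and> i < 5")
    case True
    then have m: "entry dform Ls i \<in> set Ls" using len by (intro entry_mem) auto
    from True j have "of_int j * lin (entry dform Ls i) X \<notin> \<int>" by (intro nonint m) auto
    then have "of_int j * lin (entry dform Ls i) X \<noteq> of_int m" by (metis Ints_of_int)
    then show ?thesis unfolding c_def X_1[OF m] by simp
  next
    case False
    then have a: "entry dform Ls i = dform" using len by (intro entry_default) auto
    have "of_int j * d \<notin> \<int>" using j by (intro nonint_d) (auto split: if_splits)
    then have "of_int j * d \<noteq> of_int m" by (metis Ints_of_int)
    then show ?thesis by (simp add: c_def a X_d)
  qed
  then consider "lin c X < 0" | "lin c X > 0" by linarith
  then show ?case
    using Split.IH(1)[OF t(1)] Split.IH(2)[OF t(2)] Split.prems(2) by cases auto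
next
  case (Upper j i n f g bs t)
  define L where "L = entry dform Ls i"
  define fl where "fl = (\<lambda>L. \<lfloor>of_int j * lin L X\<rfloor>)"
  from Upper.prems(1) have j: "2 \<le> j" "j \<le> J" and i: "0 \<le> i" "i < 5"
    and f: "proves H f (bnd (j - 1) dform n)"
    and g: "proves H g (lscale (- 1) (bnd j dform (n + 1)))"
    and bs: "list_all2 (\<lambda>L (l, e). proves H e (bnd j L l)) (drop_at i Ls) bs"
    and t: "check J Ls ((True, lscale (- 1)
         (bnd j L (2 * j - 2 - n - sum_list (map fst bs)))) # H) t"
    by (auto simp: L_def)
  have L: "L \<in> set Ls" unfolding L_def using len i by (intro entry_mem) auto
  have "(\<Sum>L\<leftarrow>Ls. fl L) + n \<le> 2 * j - 3"
    using proves_sound[OF f Upper.prems(2)] proves_sound[OF g Upper.prems(2)] unfolding fl_def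
    by (intro upper j) (simp_all only: lin_lscale X_d, auto)
  moreover have "(\<Sum>L\<leftarrow>Ls. fl L) = fl L + (\<Sum>L\<leftarrow>drop_at i Ls. fl L)"
    unfolding L_def using i len by (intro sum_list_drop_at) auto
  moreover have "sum_list (map fst bs) \<le> (\<Sum>L\<leftarrow>drop_at i Ls. fl L)"
    using bs set_drop_at[of i Ls]
  proof (induction rule: list_all2_induct)
    case (Cons L Ls' b bs)
    then have "L \<in> set Ls" by auto
    moreover have "0 < lin (bnd j L (fst b)) X"
      using Cons by (intro proves_sound[OF _ Upper.prems(2)]) (auto simp: case_prod_beta)
    ultimately have "of_int (fst b) < of_int j * lin L X"
      by (simp only: X_1)
    then have "fst b \<le> fl L" unfolding fl_def by linarith
    with Cons show ?case by auto
  qed simp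
  ultimately have "fl L < 2 * j - 2 - n - sum_list (map fst bs)" by linarith
  then have "of_int j * lin L X < of_int (2 * j - 2 - n - sum_list (map fst bs))"
    unfolding fl_def by (simp add: floor_less_iff)
  then have "0 < lin (lscale (- 1) (bnd j L (2 * j - 2 - n - sum_list (map fst bs)))) X"
    by (simp only: lin_lscale X_1[OF L]) simp
  then show ?case using Upper.IH[OF t] Upper.prems(2) by simp
next
  case (Lower j i n f g bs t)
  define L where "L = entry dform Ls i"
  define fl where "fl = (\<lambda>L. \<lfloor>of_int j * lin L X\<rfloor>)"
  define b where "b = 2 * j - 3 - n - sum_list (map (\<lambda>b. fst b - 1) bs)"
  from Lower.prems(1) have j: "2 \<le> j" "j \<le> J" and i: "0 \<le> i" "i < 5"
    and f: "proves H f (bnd j dform n)"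
    and g: "proves H g (lscale (- 1) (bnd (j + 1) dform (n + 1)))"
    and bs: "list_all2 (\<lambda>L (l, e). proves H e (lscale (- 1) (bnd j L l))) (drop_at i Ls) bs"
    and t: "check J Ls ((True, bnd j L b) # H) t"
    by (auto simp: L_def b_def)
  have L: "L \<in> set Ls" unfolding L_def using len i by (intro entry_mem) auto
  have "2 * j - 3 \<le> (\<Sum>L\<leftarrow>Ls. fl L) + n"
    using proves_sound[OF f Lower.prems(2)] proves_sound[OF g Lower.prems(2)] unfolding fl_def
    by (intro lower j) (simp_all only: lin_lscale X_d, auto)
  moreover have "(\<Sum>L\<leftarrow>Ls. fl L) = fl L + (\<Sum>L\<leftarrow>drop_at i Ls. fl L)"
    unfolding L_def using i len by (intro sum_list_drop_at) auto
  moreover have "(\<Sum>L\<leftarrow>drop_at i Ls. fl L) \<le> sum_list (map (\<lambda>b. fst b - 1) bs)"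
    using bs set_drop_at[of i Ls]
  proof (induction rule: list_all2_induct)
    case (Cons L Ls' b bs)
    then have "L \<in> set Ls" by auto
    moreover have "0 < lin (lscale (- 1) (bnd j L (fst b))) X"
      using Cons by (intro proves_sound[OF _ Lower.prems(2)]) (auto simp: case_prod_beta)
    ultimately have "of_int j * lin L X < of_int (fst b)"
      by (simp only: X_1 lin_lscale) simp
    then have "fl L < fst b" unfolding fl_def by (simp add: floor_less_iff)
    with Cons show ?case by auto
  qed simp
  ultimately have "b \<le> fl L" unfolding b_def by linarith
  then have le: "of_int b \<le> of_int j * lin L X"
    unfolding fl_def by (simp add: le_floor_iff)
  \<comment> \<open>The floor bound alone is not strict; nonintegrality makes it so.\<close>
  have "of_int j * lin L X \<notin> \<int>" using j by (intro nonint L) auto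
  then have "of_int j * lin L X \<noteq> of_int b" by (metis Ints_of_int)
  with le have "0 < lin (bnd j L b) X" unfolding X_1[OF L] by simp
  then show ?case using Lower.IH[OF t] Lower.prems(2) by simp
qed

end

section \<open>The certificates\<close>

text \<open>
  The certificates were found by a branch-and-bound search with exact linear programming.
  A belongs to \<open>(x, y, 1 - x - y | z, 1 - z - \<delta>)\<close>, B1 and B2 to
  \<open>(x, -2x, y, z, x - y - z - \<delta>)\<close> with all entries moved into the unit interval, for
  \<open>x < 1/2\<close> and for \<open>x > 1/2\<close>. The nonstrict hypotheses order the entries that may be permuted.
\<close>

definition formsA :: "int list list" where "formsA = [[1, 0, 0, 0, 0], [0, 1, 0, 0, 0], [-1, -1, 0, 0, 1], [0, 0, 1, 0, 0], [0, 0, -1, -1, 1]]"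
text \<open>In order: 0 < x \<le> y \<le> 1 - x - y, positivity of this third entry, 0 < z \<le> 1 -
  z - \<delta>, 0 < \<delta> < 1/13, and finally 1 > 0, which supplies constants to the Farkas
  combinations.\<close>

definition hypsA :: "ineq list" where "hypsA = [(True, [1, 0, 0, 0, 0]), (False, [-1, 1, 0, 0, 0]), (False, [-1, -2, 0, 0, 1]), (True, [-1, -1, 0, 0, 1]), (True, [0, 0, 1, 0, 0]), (False, [0, 0, -2, -1, 1]), (True, [0, 0, 0, 1, 0]), (True, [0, 0, 0, -13, 1]), (True, [0, 0, 0, 0, 1])]"
definition certA :: cert where "certA =
Split 3 0 1
(Split 3 2 2
(Split 6 3 1
(Upper 2 2 0 (1,[(1,9)]) (13,[(11,11),(2,10)]) [(0,(1,[(2,3)])),(0,(3,[(1,1),(3,4),(1,11)])),(0,(1,[(2,7)])),(1,(23,[(20,8),(1,0),(2,10)]))]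
(Upper 3 1 0 (1,[(2,10)]) (13,[(10,12),(3,11)]) [(0,(1,[(3,4)])),(1,(2,[(1,3),(3,6)])),(0,(1,[(3,8)])),(2,(46,[(21,9),(16,1),(9,11)]))]
(Upper 4 0 0 (1,[(3,11)]) (13,[(9,13),(4,12)]) [(1,(1,[(1,1),(2,6)])),(1,(1,[(1,6),(2,7),(1,8)])),(0,(1,[(4,9)])),(3,(23,[(1,10),(15,2),(7,12)]))]
(Lower 6 4 0 (1,[(6,12)]) (13,[(6,14),(7,13)]) [(2,(2,[(3,0),(1,14)])),(2,(1,[(2,1)])),(3,(1,[(3,2)])),(1,(1,[(1,3)]))]
(Upper 5 0 0 (1,[(4,13)]) (13,[(8,15),(5,14)]) [(1,(2,[(1,5),(5,8),(1,3)])),(2,(1,[(1,2),(1,9),(1,1)])),(0,(1,[(5,11)])),(4,(58,[(13,12),(44,0),(1,14)]))]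
(Upper 7 4 0 (1,[(6,14)]) (13,[(6,16),(7,15)]) [(1,(1,[(1,8),(3,4),(2,3)])),(2,(1,[(3,4),(1,9),(1,0)])),(3,(1,[(1,0),(1,3),(2,10)])),(0,(1,[(7,12)]))]
(Lower 8 3 0 (1,[(8,15)]) (13,[(4,17),(9,16)]) [(2,(3,[(4,1),(2,10),(2,12)])),(3,(1,[(1,9),(2,4),(1,11)])),(4,(1,[(4,5)])),(7,(7,[(1,17),(8,0)]))]
(Upper 11 0 0 (1,[(10,16)]) (13,[(2,18),(11,17)]) [(3,(1,[(4,6),(3,11),(1,2)])),(5,(1,[(2,2),(3,5),(1,12)])),(1,(8,[(3,18),(11,0)])),(9,(58,[(13,15),(102,3),(1,17)]))]
(Upper 7 3 0 (1,[(6,17)]) (13,[(6,19),(7,18)]) [(1,(1,[(1,11),(3,7),(2,6)])),(2,(3,[(8,7),(5,12),(1,0)])),(3,(5,[(2,0),(3,6),(13,13)])),(5,(58,[(65,16),(46,4),(5,18)]))]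
(Lower 14 0 0 (1,[(14,18)]) (11,[(8,5),(9,19),(6,2)]) [(5,(1,[(1,12),(4,7),(1,14)])),(7,(1,[(7,8)])),(2,(1,[(2,0)])),(12,(1,[(2,3)]))]
(Absurd [(14,2),(65,19),(5,20),(11,0)])))))))))))
(Split 2 4 1
(Lower 2 2 0 (1,[(2,10)]) (13,[(10,12),(3,11)]) [(1,(1,[(1,5),(1,7)])),(1,(1,[(1,4),(1,6)])),(1,(1,[(1,9),(1,10)])),(1,(1,[(1,0)]))]
(Upper 3 1 0 (1,[(2,11)]) (13,[(10,13),(3,12)]) [(0,(1,[(3,5)])),(1,(1,[(1,0),(1,8)])),(1,(40,[(7,2),(39,1),(6,12)])),(1,(26,[(10,13),(39,10),(3,12)]))]
(Lower 6 0 0 (1,[(6,12)]) (13,[(6,14),(7,13)]) [(2,(1,[(2,0)])),(4,(1,[(2,4)])),(3,(1,[(3,11),(3,12)])),(3,(1,[(3,2)]))]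
(Lower 4 1 0 (1,[(4,13)]) (13,[(8,15),(5,14)]) [(1,(1,[(2,8),(1,2)])),(3,(3,[(1,15),(4,5)])),(2,(1,[(2,12),(2,13)])),(2,(1,[(2,3)]))]
(Upper 5 0 0 (1,[(4,14)]) (13,[(8,16),(5,15)]) [(1,(4,[(1,16),(5,0)])),(2,(1,[(1,3),(2,10),(1,9)])),(2,(40,[(3,5),(91,4),(14,15)])),(2,(26,[(8,16),(65,13),(5,15)]))]
(Lower 10 1 0 (1,[(10,15)]) (13,[(2,17),(11,16)]) [(2,(1,[(2,0)])),(6,(3,[(2,7),(6,1),(4,2)])),(5,(1,[(5,14),(5,15)])),(5,(1,[(5,5)]))]
(Upper 7 3 0 (1,[(6,16)]) (13,[(6,18),(7,17)]) [(1,(6,[(1,18),(7,3)])),(2,(10,[(1,18),(7,0)])),(3,(2,[(2,5),(5,12),(1,1)])),(3,(26,[(6,18),(91,15),(7,17)]))]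
(Lower 9 0 0 (1,[(9,17)]) (13,[(3,19),(10,18)]) [(3,(1,[(3,5)])),(5,(10,[(15,4),(2,19),(9,1)])),(4,(7,[(9,0),(1,19)])),(5,(4,[(1,8),(6,17),(15,7)]))]
(Absurd [(1,19),(13,18),(5,0),(9,3)])))))))))
(Upper 2 2 0 (1,[(1,10)]) (13,[(11,12),(2,11)]) [(0,(1,[(2,4)])),(0,(3,[(1,2),(3,5),(1,12)])),(0,(3,[(1,1),(1,12)])),(1,(1,[(1,0)]))]
(Split 3 4 2
(Upper 4 0 0 (1,[(3,12)]) (13,[(9,14),(4,13)]) [(1,(1,[(1,1),(2,7)])),(1,(1,[(1,7),(2,8),(1,9)])),(1,(21,[(1,3),(26,0),(6,13)])),(2,(1,[(2,2)]))]
(Split 3 1 1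
(Lower 3 3 0 (1,[(3,14)]) (13,[(9,16),(4,15)]) [(1,(4,[(3,1),(1,16)])),(1,(1,[(1,0)])),(2,(1,[(1,6)])),(2,(1,[(1,2)]))]
(Split 5 0 1
(Upper 7 4 0 (1,[(6,16)]) (13,[(6,18),(7,17)]) [(1,(1,[(1,10),(3,5),(2,2)])),(2,(1,[(3,5),(1,11),(1,0)])),(3,(1,[(1,0),(1,2),(2,12)])),(2,(3,[(1,7),(5,1)]))]
(Lower 12 3 0 (1,[(12,17)]) (1,[(1,18)]) [(3,(1,[(2,1),(1,12),(1,14)])),(4,(1,[(4,3)])),(6,(1,[(6,6)])),(7,(7,[(1,19),(12,0)]))]
(Upper 7 3 0 (1,[(6,18)]) (13,[(6,20),(7,19)]) [(1,(1,[(1,12),(3,7),(2,4)])),(2,(1,[(3,7),(1,13),(1,2)])),(3,(1,[(1,2),(1,4),(2,14)])),(3,(26,[(6,20),(91,17),(7,19)]))]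
(Lower 9 4 0 (1,[(9,19)]) (13,[(3,21),(10,20)]) [(2,(3,[(5,3),(1,14),(1,16)])),(3,(1,[(3,5)])),(5,(1,[(1,11),(3,8)])),(4,(7,[(9,0),(1,21)]))]
(Lower 14 0 0 (1,[(14,20)]) (23,[(8,0),(21,21),(6,2)]) [(5,(1,[(1,14),(4,6),(1,16)])),(7,(1,[(7,9)])),(6,(1,[(2,1)])),(8,(1,[(2,3)]))]
(Absurd [(3,3),(14,5),(5,0),(36,21),(4,1)]))))))
(Upper 5 3 0 (1,[(4,16)]) (13,[(8,18),(5,17)]) [(1,(1,[(1,0)])),(1,(2,[(1,8),(5,11),(1,5)])),(2,(1,[(1,2),(1,12),(1,3)])),(2,(26,[(8,18),(65,15),(5,17)]))]
(Upper 5 4 0 (1,[(4,17)]) (13,[(8,19),(5,18)]) [(1,(1,[(1,1)])),(1,(2,[(1,9),(5,12),(1,6)])),(2,(1,[(1,3),(1,13),(1,4)])),(1,(3,[(2,8),(1,2)]))]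
(Lower 12 4 0 (1,[(12,18)]) (1,[(1,19)]) [(3,(1,[(3,5)])),(4,(1,[(4,4)])),(6,(1,[(6,7)])),(5,(5,[(1,20),(12,1)]))]
(Lower 8 3 0 (1,[(8,19)]) (13,[(4,21),(9,20)]) [(2,(1,[(2,6)])),(3,(2,[(1,3),(2,5),(5,15)])),(4,(1,[(4,8)])),(5,(5,[(1,21),(8,1)]))]
(Lower 15 2 0 (1,[(15,20)]) (11,[(6,1),(8,21),(9,0)]) [(4,(1,[(3,7),(2,15),(1,16)])),(5,(1,[(5,6)])),(6,(1,[(3,3)])),(9,(1,[(3,2)]))]
(Upper 11 1 0 (1,[(10,21)]) (13,[(2,23),(11,22)]) [(2,(1,[(1,15),(2,5)])),(5,(15,[(11,0),(2,23)])),(4,(10,[(1,12),(13,1)])),(6,(12,[(5,23),(11,2)]))]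
(Upper 9 0 0 (1,[(8,22)]) (13,[(4,24),(9,23)]) [(2,(2,[(1,14),(9,17),(3,11)])),(4,(5,[(3,1),(1,24)])),(3,(10,[(3,13),(9,2)])),(5,(4,[(1,24),(3,3)]))]
(Absurd [(3,3),(24,23),(99,12),(2,4),(18,1),(22,0)]))))))))))
(Upper 3 3 0 (1,[(2,14)]) (13,[(10,16),(3,15)]) [(0,(1,[(3,8)])),(1,(1,[(1,0)])),(1,(3,[(1,1),(4,10),(1,11)])),(1,(26,[(10,16),(39,13),(3,15)]))]
(Lower 6 0 0 (1,[(6,15)]) (13,[(6,17),(7,16)]) [(3,(1,[(3,9),(3,11)])),(3,(1,[(3,4)])),(2,(1,[(2,0)])),(4,(1,[(2,3)]))]
(Lower 12 2 0 (1,[(12,16)]) (1,[(1,17)]) [(3,(1,[(3,3)])),(5,(1,[(1,0),(6,12)])),(4,(1,[(4,1)])),(8,(1,[(4,4)]))]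
(Split 9 0 2
(Lower 9 2 0 (1,[(9,18)]) (13,[(3,20),(10,19)]) [(2,(1,[(1,0)])),(4,(4,[(1,20),(3,2),(18,14)])),(3,(1,[(3,3)])),(6,(1,[(3,6)]))]
(Upper 7 3 0 (1,[(6,19)]) (13,[(6,21),(7,20)]) [(1,(6,[(1,21),(7,3)])),(2,(3,[(1,11),(3,14),(5,5)])),(3,(3,[(1,0),(1,2)])),(4,(2,[(1,18),(4,4),(1,20)]))]
(Lower 10 0 0 (1,[(10,20)]) (13,[(2,22),(11,21)]) [(4,(3,[(4,4),(2,1),(6,16)])),(5,(1,[(5,9)])),(3,(7,[(1,22),(10,0)])),(7,(3,[(1,22),(10,8)]))]
(Upper 5 0 0 (1,[(4,21)]) (13,[(8,23),(5,22)]) [(1,(3,[(2,13),(6,16),(1,7)])),(2,(12,[(5,4),(1,23)])),(1,(21,[(11,12),(13,9),(3,22)])),(3,(32,[(17,20),(18,1),(11,22)]))]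
(Absurd [(1,1),(2,0)])))))
(Upper 5 4 0 (1,[(4,18)]) (13,[(8,20),(5,19)]) [(1,(9,[(1,20),(5,0)])),(1,(3,[(2,10),(6,13),(1,4)])),(2,(12,[(5,1),(1,20)])),(1,(21,[(11,9),(13,6),(3,19)]))]
(Lower 8 0 0 (1,[(8,19)]) (13,[(4,21),(9,20)]) [(3,(3,[(2,1),(1,2),(6,15)])),(4,(3,[(2,11),(6,5),(2,1)])),(3,(1,[(1,18),(2,4),(1,19)])),(5,(5,[(1,21),(8,0)]))]
(Absurd [(1,0),(2,7)])))))))))
(Upper 3 1 0 (1,[(2,12)]) (13,[(10,14),(3,13)]) [(0,(1,[(3,6)])),(1,(2,[(1,5),(3,8)])),(0,(2,[(1,3),(1,14)])),(2,(1,[(1,0)]))]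
(Split 12 2 5
(Upper 4 4 0 (1,[(3,14)]) (13,[(9,16),(4,15)]) [(1,(3,[(4,1),(1,0)])),(1,(6,[(1,16),(12,9),(1,0)])),(1,(1,[(1,9),(2,10),(1,11)])),(0,(3,[(2,5),(2,16)]))]
(Lower 12 3 0 (1,[(12,15)]) (1,[(1,16)]) [(4,(1,[(4,8)])),(4,(1,[(4,2)])),(5,(1,[(1,1)])),(9,(1,[(3,0)]))]
(Upper 4 0 0 (1,[(3,16)]) (13,[(9,18),(4,17)]) [(1,(6,[(1,18),(12,11),(1,2)])),(1,(1,[(1,11),(2,12),(1,13)])),(1,(3,[(1,0)])),(2,(8,[(1,17),(13,15),(2,4)]))]
(Absurd [(3,0),(4,4),(1,3)]))))
(Split 5 0 1
(Upper 7 4 0 (1,[(6,15)]) (13,[(6,17),(7,16)]) [(1,(1,[(1,9),(3,4),(2,2)])),(2,(1,[(3,4),(1,10),(1,0)])),(3,(9,[(3,0),(5,2),(4,1)])),(1,(6,[(1,17),(7,6)]))]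
(Lower 4 3 0 (1,[(4,16)]) (13,[(8,18),(5,17)]) [(1,(11,[(4,1),(12,11),(1,2)])),(2,(1,[(2,10),(2,12)])),(2,(1,[(2,5)])),(3,(7,[(1,18),(4,0)]))]
(Upper 7 3 0 (1,[(6,17)]) (13,[(6,19),(7,18)]) [(1,(1,[(1,11),(3,6),(2,4)])),(2,(1,[(3,6),(1,12),(1,2)])),(3,(9,[(3,2),(5,4),(4,3)])),(4,(8,[(1,18),(13,16),(10,5)]))]
(Lower 10 4 0 (1,[(10,18)]) (13,[(2,20),(11,19)]) [(2,(1,[(2,3)])),(4,(1,[(2,12),(2,5),(2,14)])),(5,(1,[(5,7)])),(3,(7,[(1,20),(10,0)]))]
(Lower 14 0 0 (1,[(14,19)]) (7,[(4,0),(5,20),(10,2)]) [(5,(1,[(1,13),(4,6),(1,15)])),(7,(1,[(7,8)])),(4,(1,[(2,1)])),(10,(1,[(2,3)]))]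
(Absurd [(5,3),(14,5),(20,20),(2,1),(5,0)]))))))
(Upper 5 3 0 (1,[(4,15)]) (13,[(8,17),(5,16)]) [(1,(1,[(1,0)])),(1,(2,[(1,7),(5,10),(1,4)])),(2,(12,[(5,1),(1,17)])),(3,(16,[(1,16),(13,14),(18,3)]))]
(Upper 5 4 0 (1,[(4,16)]) (13,[(8,18),(5,17)]) [(1,(1,[(1,1)])),(1,(2,[(1,8),(5,11),(1,5)])),(2,(12,[(5,2),(1,18)])),(0,(6,[(5,7),(5,18)]))]
(Lower 10 1 0 (1,[(10,17)]) (13,[(2,19),(11,18)]) [(3,(12,[(5,3),(60,12),(1,19)])),(5,(1,[(5,6)])),(2,(1,[(2,1)])),(8,(1,[(2,0)]))]
(Upper 7 2 0 (1,[(6,18)]) (13,[(6,20),(7,19)]) [(1,(1,[(2,12),(1,3)])),(2,(10,[(1,20),(7,0)])),(1,(6,[(1,20),(7,9)])),(5,(17,[(23,2),(9,19),(2,17)]))]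
(Lower 9 4 0 (1,[(9,19)]) (13,[(3,21),(10,20)]) [(3,(8,[(3,5),(36,14),(3,21)])),(3,(1,[(3,6)])),(4,(7,[(1,21),(9,0)])),(2,(3,[(1,18),(5,3),(1,19)]))]
(Upper 4 0 0 (1,[(3,20)]) (13,[(9,22),(4,21)]) [(1,(5,[(1,22),(2,2)])),(1,(3,[(1,6),(2,22)])),(0,(3,[(2,11),(2,22)])),(3,(74,[(13,19),(30,0),(1,21)]))]
(Upper 13 0 0 (1,[(12,21)]) (1,[(1,22)]) [(4,(6,[(4,2),(5,3),(7,0)])),(5,(12,[(13,7),(5,23)])),(2,(6,[(1,23),(13,12)])),(10,(74,[(13,20),(104,1),(1,22)]))]
(Absurd [(4,2),(36,22),(6,13),(39,3),(91,9),(21,0)])))))))))))))))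
(Upper 2 4 0 (1,[(1,8)]) (13,[(11,10),(2,9)]) [(0,(1,[(2,2)])),(0,(1,[(2,2),(2,3)])),(1,(3,[(1,0),(2,4),(1,3)])),(0,(1,[(2,6)]))]
(Upper 3 0 0 (1,[(2,9)]) (13,[(10,11),(3,10)]) [(0,(1,[(3,3),(3,4)])),(2,(1,[(1,1)])),(1,(11,[(7,7),(13,0),(2,10)])),(1,(26,[(10,11),(39,8),(3,10)]))]
(Absurd [(1,0),(3,4)]))))
(Absurd [(2,2),(1,3),(1,0)])"
lemma check_certA: "check 24 formsA hypsA certA"
  by code_simp

definition formsB1 :: "int list list" where "formsB1 = [[1, 0, 0, 0, 0], [-2, 0, 0, 0, 1], [0, 1, 0, 0, 0], [0, 0, 1, 0, 0], [1, -1, -1, -1, 1]]"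
text \<open>Here w = 1 + x - y - z - \<delta> is the last entry; the two nonstrict inequalities say
  y \<le> z \<le> w, and the form after them is 1 - w.\<close>

definition hypsB1 :: "ineq list" where "hypsB1 = [(True, [1, 0, 0, 0, 0]), (True, [-2, 0, 0, 0, 1]), (True, [0, 1, 0, 0, 0]), (False, [0, -1, 1, 0, 0]), (False, [1, -1, -2, -1, 1]), (True, [-1, 1, 1, 1, 0]), (True, [0, 0, 0, 1, 0]), (True, [0, 0, 0, -13, 1]), (True, [0, 0, 0, 0, 1])]"
definition certB1 :: cert where "certB1 =
Split 4 0 1
(Upper 2 4 0 (1,[(1,7)]) (13,[(11,9),(2,8)]) [(0,(1,[(2,1)])),(1,(1,[(1,0)])),(0,(1,[(2,3)])),(0,(1,[(2,3),(2,4)]))]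
(Split 8 0 1
(Split 4 2 1
(Upper 3 3 0 (1,[(2,10)]) (13,[(10,12),(3,11)]) [(0,(1,[(3,4)])),(2,(3,[(2,1),(1,5)])),(0,(1,[(3,6)])),(1,(9,[(13,4),(3,0),(14,8),(1,11),(1,7)]))]
(Lower 8 1 0 (1,[(8,11)]) (13,[(4,13),(9,12)]) [(1,(1,[(1,2)])),(2,(1,[(2,1)])),(3,(5,[(2,9),(2,7),(12,0),(2,11),(1,6)])),(4,(1,[(4,3)]))]
(Lower 6 2 0 (1,[(6,12)]) (13,[(6,14),(7,13)]) [(1,(7,[(2,0),(5,7)])),(6,(1,[(12,6)])),(2,(1,[(2,1)])),(3,(1,[(3,4)]))]
(Lower 12 4 0 (1,[(12,13)]) (1,[(1,14)]) [(1,(7,[(5,1),(2,8)])),(12,(1,[(24,7)])),(3,(1,[(3,3)])),(4,(1,[(4,2)]))]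
(Lower 12 1 0 (1,[(12,14)]) (1,[(1,15)]) [(1,(7,[(5,2),(2,9)])),(3,(1,[(3,4)])),(4,(1,[(4,3)])),(6,(1,[(6,6)]))]
(Upper 5 2 0 (1,[(4,15)]) (13,[(8,17),(5,16)]) [(0,(1,[(5,9)])),(4,(11,[(4,0),(7,10)])),(1,(14,[(26,9),(3,2),(44,12),(13,7),(2,16)])),(2,(12,[(1,17),(5,1)]))]
(Lower 10 3 0 (1,[(10,16)]) (13,[(2,18),(11,17)]) [(1,(11,[(4,1),(7,11)])),(10,(1,[(20,10)])),(2,(1,[(2,0)])),(5,(1,[(5,8)]))]
(Upper 7 4 0 (1,[(6,17)]) (13,[(6,19),(7,18)]) [(0,(1,[(7,11)])),(6,(11,[(6,2),(5,12)])),(1,(6,[(1,19),(7,4)])),(2,(10,[(1,19),(7,0)]))]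
(Lower 9 0 0 (1,[(9,18)]) (13,[(3,20),(10,19)]) [(9,(1,[(18,12)])),(2,(5,[(9,2),(1,20)])),(3,(1,[(3,7)])),(4,(4,[(1,17),(5,0)]))]
(Absurd [(15,13),(1,0),(1,4)]))))))))))
(Upper 4 0 0 (1,[(3,10)]) (13,[(9,12),(4,11)]) [(3,(1,[(1,1)])),(1,(1,[(1,0)])),(1,(1,[(1,0),(4,7)])),(1,(39,[(52,4),(52,7),(104,8),(4,11),(9,12)]))]
(Absurd [(4,5),(1,0)])))
(Lower 4 2 0 (1,[(4,9)]) (13,[(8,11),(5,10)]) [(1,(1,[(1,2)])),(3,(1,[(1,0)])),(2,(1,[(4,7),(2,1)])),(2,(1,[(2,1)]))]
(Split 3 3 1
(Lower 3 1 0 (1,[(3,11)]) (13,[(9,13),(4,12)]) [(1,(2,[(1,4),(1,6)])),(1,(1,[(1,0),(3,8)])),(1,(1,[(1,0)])),(2,(1,[(1,10),(1,3)]))]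
(Lower 6 0 0 (1,[(6,12)]) (13,[(6,14),(7,13)]) [(5,(2,[(1,14),(3,3)])),(2,(1,[(2,1),(6,9)])),(2,(1,[(2,1)])),(3,(1,[(3,4)]))]
(Absurd [(1,0),(1,1)])))
(Upper 3 1 0 (1,[(2,11)]) (13,[(10,13),(3,12)]) [(0,(8,[(3,2),(3,13)])),(0,(1,[(3,7)])),(1,(1,[(1,0)])),(1,(104,[(5,13),(13,2),(208,9),(8,12),(104,8)]))]
(Upper 3 2 0 (1,[(2,12)]) (13,[(10,14),(3,13)]) [(0,(8,[(3,3),(3,14)])),(1,(1,[(1,5),(1,7)])),(1,(1,[(1,1)])),(1,(104,[(5,14),(13,3),(208,10),(8,13),(104,9)]))]
(Split 5 3 2
(Lower 12 1 0 (1,[(12,14)]) (1,[(1,15)]) [(3,(1,[(3,7)])),(4,(1,[(4,1)])),(5,(5,[(1,16),(12,0)])),(6,(1,[(6,6)]))]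
(Lower 9 4 0 (1,[(9,15)]) (13,[(3,17),(10,16)]) [(2,(8,[(3,0),(1,17)])),(6,(1,[(3,3)])),(3,(1,[(3,2)])),(4,(5,[(2,17),(9,1)]))]
(Upper 7 2 0 (1,[(6,16)]) (13,[(6,18),(7,17)]) [(1,(2,[(1,7),(1,4)])),(4,(12,[(7,1),(1,18)])),(2,(193,[(104,13),(13,7),(8,17),(104,15),(381,5)])),(3,(9,[(1,18),(7,0)]))]
(Lower 10 0 0 (1,[(10,17)]) (13,[(2,19),(11,18)]) [(7,(1,[(1,8),(2,5)])),(3,(7,[(10,0),(1,19)])),(4,(1,[(2,3)])),(5,(1,[(5,9)]))]
(Lower 10 0 0 (1,[(10,18)]) (13,[(2,20),(11,19)]) [(6,(1,[(2,0)])),(3,(7,[(10,1),(1,20)])),(4,(1,[(2,4)])),(5,(1,[(5,10)]))]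
(Absurd [(5,4),(11,20),(143,19),(12,0)]))))))
(Upper 5 0 0 (1,[(4,14)]) (13,[(8,16),(5,15)]) [(2,(1,[(2,7),(1,9)])),(1,(1,[(1,10),(1,4)])),(2,(1,[(1,0)])),(2,(1,[(5,12),(1,0)]))]
(Upper 5 0 0 (1,[(4,15)]) (13,[(8,17),(5,16)]) [(3,(1,[(2,0)])),(1,(1,[(1,11),(1,5)])),(2,(1,[(1,1)])),(2,(1,[(5,13),(1,1)]))]
(Absurd [(5,4),(65,16),(6,0),(5,17)]))))))))))
(Split 5 4 3
(Split 20 0 7
(Split 2 3 1
(Lower 2 4 0 (1,[(2,10)]) (13,[(10,12),(3,11)]) [(1,(10,[(1,1),(3,12)])),(1,(1,[(1,3)])),(1,(30,[(20,8),(1,1),(40,7),(20,10),(3,12)])),(1,(1,[(1,0)]))]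
(Upper 4 2 0 (1,[(3,11)]) (13,[(9,13),(4,12)]) [(1,(1,[(1,4)])),(1,(5,[(2,2),(1,13)])),(1,(65,[(23,4),(10,12),(130,8),(38,5),(26,3)])),(2,(1,[(2,0)]))]
(Lower 8 1 0 (1,[(8,12)]) (13,[(4,14),(9,13)]) [(3,(5,[(2,3),(1,14)])),(2,(1,[(2,0)])),(4,(1,[(4,2)])),(5,(2,[(1,11),(3,4)]))]
(Lower 6 2 0 (1,[(6,13)]) (13,[(6,15),(7,14)]) [(2,(6,[(1,0),(1,4)])),(3,(1,[(3,6)])),(3,(1,[(3,3)])),(4,(1,[(1,12),(1,5)]))]
(Split 24 0 7
(Lower 10 2 0 (1,[(10,15)]) (13,[(2,17),(11,16)]) [(3,(14,[(5,0),(1,6)])),(5,(1,[(5,8)])),(5,(1,[(5,5)])),(6,(1,[(2,7)]))]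
(Upper 5 3 0 (1,[(4,16)]) (13,[(8,18),(5,17)]) [(1,(1,[(1,10),(1,9)])),(2,(14,[(5,1),(1,7)])),(1,(2,[(1,0)])),(2,(88,[(39,9),(7,4),(284,14),(12,17),(128,13)]))]
(Lower 10 0 0 (1,[(10,17)]) (13,[(2,19),(11,18)]) [(5,(1,[(5,10)])),(3,(2,[(5,5),(1,19)])),(4,(1,[(2,0)])),(6,(1,[(2,9)]))]
(Absurd [(12,0),(1,19),(5,3),(13,18)]))))
(Lower 12 4 0 (1,[(12,15)]) (1,[(1,16)]) [(4,(3,[(1,2),(1,6)])),(5,(1,[(1,0)])),(3,(1,[(3,3)])),(6,(1,[(6,5)]))]
(Upper 7 3 0 (1,[(6,16)]) (13,[(6,18),(7,17)]) [(2,(24,[(1,18),(7,1)])),(2,(10,[(7,7),(1,18)])),(1,(6,[(1,18),(7,2)])),(4,(12,[(1,18),(7,0)]))]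
(Lower 9 2 0 (1,[(9,17)]) (13,[(3,19),(10,18)]) [(3,(4,[(1,4),(1,8)])),(4,(4,[(1,19),(3,2)])),(4,(7,[(9,0),(1,19)])),(6,(2,[(3,16),(3,9)]))]
(Lower 12 3 0 (1,[(12,18)]) (1,[(1,19)]) [(4,(3,[(1,5),(1,9)])),(5,(1,[(1,3)])),(3,(1,[(3,6)])),(8,(1,[(2,17),(2,10)]))]
(Upper 5 1 0 (1,[(4,19)]) (13,[(8,21),(5,20)]) [(1,(24,[(11,21),(5,4)])),(1,(9,[(1,21),(5,1)])),(2,(12,[(1,21),(5,0)])),(2,(12,[(11,21),(5,3)]))]
(Split 19 5 1
(Lower 15 0 0 (1,[(15,21)]) (2,[(1,0),(1,22)]) [(6,(1,[(3,1)])),(4,(4,[(15,9),(1,23)])),(7,(7,[(15,4),(4,23)])),(9,(1,[(3,13)]))]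
(Absurd [(5,1),(95,22),(16,0),(15,9)]))
(Upper 24 0 1 (19,[(4,23),(23,0)]) (13,[(2,23),(24,22)]) [(9,(1,[(3,8)])),(5,(3,[(1,23),(8,3)])),(10,(1,[(2,2)])),(14,(1,[(2,5)]))]
(Absurd [(12,2),(13,22),(1,23),(5,0)])))))))))))))
(Upper 2 0 0 (1,[(1,10)]) (13,[(11,12),(2,11)]) [(0,(5,[(1,1),(3,12)])),(0,(1,[(2,6)])),(1,(1,[(1,0)])),(1,(1,[(1,0),(2,8)]))]
(Absurd [(1,4),(13,11),(1,12),(2,0)])))
(Upper 3 2 0 (1,[(2,9)]) (13,[(10,11),(3,10)]) [(1,(20,[(1,11),(3,0)])),(0,(1,[(3,4)])),(1,(1040,[(25,8),(120,10),(1560,6),(307,1),(78,0)])),(1,(260,[(71,11),(13,0),(520,7),(20,10),(260,6)]))]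
(Lower 10 2 0 (1,[(10,10)]) (13,[(2,12),(11,11)]) [(5,(1,[(5,5)])),(3,(1,[(1,1)])),(6,(1,[(10,8),(2,2)])),(6,(1,[(2,2)]))]
(Split 2 3 1
(Lower 6 1 0 (1,[(6,12)]) (13,[(6,14),(7,13)]) [(3,(1,[(3,7)])),(2,(1,[(2,2)])),(3,(1,[(3,0)])),(4,(1,[(1,11),(1,4)]))]
(Lower 2 4 0 (1,[(2,13)]) (13,[(10,15),(3,14)]) [(1,(6,[(1,0),(1,15)])),(1,(5,[(2,15),(1,4)])),(1,(18,[(12,11),(1,0),(24,10),(12,13),(1,15)])),(1,(1,[(1,1)]))]
(Lower 10 2 0 (1,[(10,14)]) (13,[(2,16),(11,15)]) [(5,(6,[(5,1),(5,16)])),(3,(1,[(1,5)])),(5,(1,[(5,2)])),(6,(1,[(2,6)]))]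
(Split 18 0 7
(Lower 10 2 0 (1,[(10,16)]) (13,[(2,18),(11,17)]) [(4,(9,[(5,0),(1,18)])),(3,(1,[(1,7)])),(5,(1,[(5,4)])),(6,(1,[(2,8)]))]
(Upper 4 1 0 (1,[(3,17)]) (13,[(9,19),(4,18)]) [(1,(5,[(2,19),(1,8)])),(1,(5,[(1,2),(1,0)])),(1,(260,[(26,8),(40,18),(520,14),(225,16),(59,9)])),(2,(1,[(2,3)]))]
(Lower 12 4 0 (1,[(12,18)]) (1,[(1,19)]) [(5,(3,[(2,2),(1,20)])),(3,(1,[(3,0)])),(4,(1,[(4,8)])),(6,(1,[(6,6)]))]
(Upper 7 3 0 (1,[(6,19)]) (13,[(6,21),(7,20)]) [(2,(20,[(9,21),(7,10)])),(1,(9,[(7,3),(5,21)])),(2,(10,[(1,4),(6,2)])),(4,(12,[(1,21),(7,0)]))]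
(Lower 12 3 0 (1,[(12,20)]) (1,[(1,21)]) [(5,(3,[(2,4),(1,22)])),(3,(1,[(3,2)])),(4,(1,[(4,10)])),(8,(1,[(2,19),(2,12)]))]
(Split 19 5 1
(Lower 15 0 0 (1,[(15,22)]) (2,[(1,0),(1,23)]) [(4,(2,[(1,13),(5,4)])),(5,(1,[(5,12)])),(7,(7,[(4,24),(15,2)])),(9,(1,[(3,14)]))]
(Absurd [(6,0),(1,1),(5,7),(19,23)]))
(Upper 24 0 1 (19,[(4,24),(23,0)]) (13,[(2,24),(24,23)]) [(5,(3,[(8,6),(1,24)])),(7,(5,[(1,7),(11,5)])),(10,(1,[(2,1)])),(14,(1,[(2,3)]))]
(Absurd [(3,5),(1,0)]))))))))
(Lower 9 3 0 (1,[(9,16)]) (13,[(3,18),(10,17)]) [(4,(4,[(3,3),(1,18)])),(2,(1,[(1,0)])),(3,(1,[(3,6)])),(6,(2,[(3,15),(3,8)]))]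
(Lower 12 4 0 (1,[(12,17)]) (1,[(1,18)]) [(5,(1,[(1,4)])),(3,(7,[(3,8),(6,1)])),(4,(1,[(4,7)])),(6,(1,[(6,5)]))]
(Upper 7 2 0 (1,[(6,18)]) (13,[(6,20),(7,19)]) [(2,(20,[(9,20),(7,9)])),(1,(6,[(7,5),(1,20)])),(3,(9,[(1,20),(7,1)])),(4,(12,[(1,20),(7,0)]))]
(Lower 10 1 0 (1,[(10,19)]) (13,[(2,21),(11,20)]) [(5,(6,[(5,6),(5,21)])),(3,(7,[(10,0),(1,21)])),(5,(1,[(5,7)])),(6,(1,[(2,11)]))]
(Lower 10 0 0 (1,[(10,20)]) (13,[(2,22),(11,21)]) [(3,(1,[(1,11)])),(3,(7,[(10,1),(1,22)])),(5,(1,[(5,8)])),(6,(1,[(2,12)]))]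
(Absurd [(2,0),(1,1)]))))))))))
(Upper 2 0 0 (1,[(1,12)]) (13,[(11,14),(2,13)]) [(0,(1,[(2,7)])),(0,(5,[(1,14),(1,1)])),(1,(1,[(1,0)])),(1,(1,[(1,0),(2,10)]))]
(Absurd [(10,0),(7,14),(91,13),(1,4)]))))))
(Upper 2 3 0 (1,[(1,8)]) (13,[(11,10),(2,9)]) [(0,(1,[(2,2)])),(0,(1,[(2,3)])),(0,(1,[(2,4)])),(1,(5,[(2,0),(1,10)]))]
(Split 8 0 3
(Split 4 3 1
(Split 16 0 5
(Split 6 2 1
(Lower 6 3 0 (1,[(6,13)]) (13,[(6,15),(7,14)]) [(2,(8,[(3,1),(1,15)])),(3,(1,[(3,6)])),(1,(1,[(1,0)])),(6,(1,[(6,12)]))]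
(Lower 6 4 0 (1,[(6,14)]) (13,[(6,16),(7,15)]) [(2,(8,[(3,2),(1,16)])),(3,(1,[(3,7)])),(1,(1,[(1,1)])),(2,(2,[(1,16),(3,3)]))]
(Split 24 0 7
(Upper 5 3 0 (1,[(4,16)]) (13,[(8,18),(5,17)]) [(1,(1,[(1,10),(1,9)])),(2,(12,[(5,0),(1,18)])),(0,(1,[(5,12)])),(4,(7,[(1,8),(5,1)]))]
(Lower 10 2 0 (1,[(10,17)]) (13,[(2,19),(11,18)]) [(3,(12,[(5,1),(1,19)])),(5,(1,[(5,10)])),(2,(1,[(2,0)])),(10,(1,[(10,16)]))]
(Lower 10 4 0 (1,[(10,18)]) (13,[(2,20),(11,19)]) [(3,(12,[(5,2),(1,20)])),(5,(1,[(5,11)])),(2,(3,[(5,5),(1,20)])),(2,(1,[(2,1)]))]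
(Upper 12 4 0 (1,[(11,19)]) (13,[(1,21),(12,20)]) [(3,(1,[(3,12)])),(5,(1,[(1,3)])),(1,(5,[(1,21),(6,1)])),(2,(1,[(2,5)]))]
(Upper 8 2 0 (1,[(7,20)]) (13,[(5,22),(8,21)]) [(2,(1,[(2,13)])),(3,(3,[(2,4),(1,22)])),(1,(3,[(1,22),(4,6)])),(7,(5,[(1,22),(4,1)]))]
(Split 19 5 1
(Lower 14 0 0 (1,[(14,22)]) (3,[(1,0),(2,23)]) [(7,(1,[(7,15)])),(2,(4,[(7,1),(1,24)])),(3,(43,[(12,20),(118,5),(1,2)])),(13,(6,[(1,24),(7,2)]))]
(Lower 13 0 0 (1,[(13,23)]) (6,[(1,1),(5,24)]) [(6,(7,[(3,25),(13,0)])),(2,(8,[(13,2),(3,25)])),(3,(43,[(24,21),(107,6),(2,3)])),(12,(12,[(1,25),(13,3)]))]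
(Absurd [(95,24),(13,8),(5,2),(24,0)])))
(Lower 24 1 1 (19,[(5,24),(24,0)]) (13,[(1,24),(25,23)]) [(7,(1,[(1,6)])),(3,(1,[(3,1)])),(5,(8425,[(2280,20),(228,4),(39528,5),(120,0),(95,6)])),(22,(1,[(2,2)]))]
(Upper 20 0 1 (1,[(1,1)]) (13,[(6,25),(20,24)]) [(9,(6,[(5,0),(1,25)])),(2,(1,[(2,5)])),(3,(3,[(1,25),(10,9)])),(18,(1,[(2,4)]))]
(Absurd [(5,17),(1,0)])))))))))
(Lower 12 4 0 (1,[(12,16)]) (1,[(1,17)]) [(4,(4,[(3,4),(1,18)])),(5,(1,[(1,0)])),(2,(1,[(2,3)])),(3,(1,[(3,5)]))]
(Lower 12 2 0 (1,[(12,17)]) (1,[(1,18)]) [(4,(4,[(3,5),(1,19)])),(5,(1,[(1,1)])),(3,(1,[(3,6)])),(12,(1,[(12,16)]))]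
(Upper 8 2 0 (1,[(7,18)]) (13,[(5,20),(8,19)]) [(2,(3,[(1,20),(1,2)])),(3,(1,[(1,6)])),(1,(3,[(1,20),(4,4)])),(7,(3,[(1,20),(2,1)]))]
(Split 17 5 1
(Lower 16 3 0 (1,[(16,20)]) (1,[(1,0)]) [(5,(1,[(1,8)])),(7,(3,[(1,22),(4,4)])),(2,(1,[(2,1)])),(16,(1,[(16,19)]))]
(Upper 11 2 0 (1,[(10,21)]) (13,[(2,23),(11,22)]) [(3,(24,[(5,23),(11,5)])),(4,(8,[(11,9),(1,23)])),(2,(16,[(1,23),(11,0)])),(10,(12,[(1,23),(11,4)]))]
(Lower 9 3 0 (1,[(9,22)]) (13,[(3,24),(10,23)]) [(3,(16,[(9,10),(3,24)])),(4,(4,[(1,24),(3,6)])),(1,(11,[(9,0),(2,24)])),(9,(1,[(9,21)]))]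
(Upper 14 4 0 (1,[(13,23)]) (4,[(1,3),(3,24)]) [(4,(12,[(1,25),(7,7)])),(5,(4,[(7,11),(1,25)])),(1,(6,[(1,25),(7,5)])),(3,(5,[(1,2),(6,0)]))]
(Lower 16 0 0 (1,[(16,24)]) (1,[(1,4)]) [(7,(3,[(1,26),(4,8)])),(2,(11,[(16,2),(6,26)])),(4,(1,[(4,13)])),(15,(7,[(1,26),(8,0)]))]
(Absurd [(1,0),(1,13)]))))))
(Upper 24 3 1 (17,[(6,22),(23,0)]) (13,[(2,22),(24,21)]) [(7,(1,[(1,4)])),(9,(1,[(3,8)])),(2,(1,[(2,2)])),(22,(1,[(2,3)]))]
(Lower 9 2 0 (17,[(9,1),(9,23)]) (13,[(3,23),(10,22)]) [(3,(16,[(9,9),(3,23)])),(4,(4,[(1,23),(3,5)])),(2,(8,[(3,0),(1,23)])),(9,(1,[(9,20)]))]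
(Upper 18 1 1 (1,[(1,2)]) (13,[(8,24),(18,23)]) [(5,(4,[(1,24),(3,6)])),(2,(1,[(2,0)])),(3,(1,[(3,8)])),(16,(2,[(1,24),(3,5)]))]
(Lower 5 3 0 (17,[(5,3),(5,25)]) (13,[(7,25),(6,24)]) [(2,(16,[(5,11),(7,25)])),(2,(18,[(1,25),(5,0)])),(1,(8,[(5,4),(3,25)])),(5,(1,[(5,22)]))]
(Upper 10 0 0 (17,[(9,4),(9,26)]) (13,[(3,26),(10,25)]) [(3,(4,[(5,12),(3,26)])),(1,(3,[(1,6),(2,2)])),(2,(1,[(2,0)])),(9,(6,[(1,26),(5,7)]))]
(Absurd [(5,2),(13,25),(1,26),(18,0)])))))))))))))
(Upper 6 4 0 (1,[(5,13)]) (13,[(7,15),(6,14)]) [(1,(1,[(2,7),(1,6)])),(2,(4,[(3,1),(1,15)])),(1,(1,[(1,0)])),(1,(1,[(6,10),(1,0)]))]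
(Lower 12 1 0 (1,[(12,14)]) (1,[(1,15)]) [(4,(4,[(3,2),(1,16)])),(3,(1,[(12,11),(3,3)])),(3,(1,[(3,3)])),(10,(1,[(2,0)]))]
(Split 5 3 1
(Lower 10 0 0 (1,[(10,16)]) (13,[(2,18),(11,17)]) [(5,(1,[(5,9)])),(2,(1,[(10,13),(2,0)])),(2,(1,[(2,0)])),(9,(3,[(2,18),(5,2)]))]
(Absurd [(1,18),(12,0),(13,17),(5,2)]))
(Upper 5 2 0 (1,[(4,16)]) (13,[(8,18),(5,17)]) [(1,(1,[(1,10),(1,9)])),(2,(12,[(5,1),(1,18)])),(1,(1,[(1,0)])),(3,(1,[(1,8)]))]
(Lower 10 4 0 (1,[(10,17)]) (13,[(2,19),(11,18)]) [(3,(12,[(5,2),(1,19)])),(5,(1,[(5,10)])),(2,(1,[(2,0)])),(3,(2,[(1,19),(5,6)]))]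
(Upper 5 0 0 (1,[(4,18)]) (13,[(8,20),(5,19)]) [(2,(12,[(5,3),(1,20)])),(0,(6,[(5,20),(5,5)])),(1,(1,[(1,2)])),(4,(2,[(1,0)]))]
(Absurd [(5,12),(4,0),(13,19),(1,20)]))))))))
(Lower 8 4 0 (1,[(8,12)]) (13,[(4,14),(9,13)]) [(3,(1,[(1,2)])),(3,(1,[(1,0)])),(2,(1,[(8,9),(2,1)])),(2,(1,[(2,1)]))]
(Lower 8 2 0 (1,[(8,13)]) (13,[(4,15),(9,14)]) [(3,(1,[(1,3)])),(3,(1,[(1,1)])),(2,(1,[(2,2)])),(8,(1,[(8,12)]))]
(Split 6 2 1
(Lower 5 3 0 (1,[(5,15)]) (13,[(7,17),(6,16)]) [(2,(2,[(1,5),(1,10)])),(2,(8,[(1,17),(5,3)])),(1,(6,[(5,0),(1,17)])),(5,(1,[(5,14)]))]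
(Split 3 0 1
(Upper 10 4 0 (1,[(9,17)]) (13,[(3,19),(10,18)]) [(3,(8,[(1,19),(5,5)])),(3,(1,[(4,0),(1,7)])),(1,(4,[(1,19),(5,3)])),(2,(1,[(2,1)]))]
(Lower 12 0 0 (1,[(12,18)]) (1,[(1,19)]) [(5,(2,[(1,20),(3,6)])),(2,(1,[(2,3)])),(3,(1,[(3,7)])),(11,(5,[(1,20),(6,0)]))]
(Absurd [(4,2),(1,0)])))
(Lower 12 4 0 (1,[(12,17)]) (1,[(1,18)]) [(5,(1,[(1,7),(2,12)])),(4,(1,[(8,0)])),(2,(1,[(2,2)])),(3,(1,[(3,6)]))]
(Upper 10 1 0 (1,[(9,18)]) (13,[(3,20),(10,19)]) [(3,(8,[(1,20),(5,6)])),(1,(4,[(1,20),(5,4)])),(2,(1,[(2,2)])),(9,(6,[(1,20),(5,0)]))]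
(Upper 9 3 0 (1,[(8,19)]) (13,[(4,21),(9,20)]) [(3,(20,[(3,21),(9,0)])),(2,(1,[(2,9),(1,14)])),(1,(8,[(1,21),(9,5)])),(8,(4,[(1,21),(3,1)]))]
(Split 15 5 1
(Lower 13 2 0 (1,[(13,21)]) (2,[(1,0),(1,22)]) [(5,(2,[(3,11),(1,16)])),(4,(10,[(1,23),(13,2)])),(3,(9,[(13,1),(1,23)])),(13,(1,[(13,20)]))]
(Upper 7 1 0 (1,[(6,22)]) (13,[(6,24),(7,23)]) [(2,(20,[(9,24),(7,3)])),(1,(13,[(1,24),(7,0)])),(1,(5,[(2,24),(7,6)])),(6,(12,[(5,24),(7,4)]))]
(Lower 13 4 0 (1,[(13,23)]) (2,[(1,2),(1,24)]) [(5,(2,[(3,13),(1,18)])),(4,(10,[(1,25),(13,4)])),(3,(6,[(13,8),(5,25)])),(3,(9,[(13,3),(1,25)]))]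
(Split 19 5 1
(Lower 18 1 0 (1,[(18,25)]) (1,[(1,0)]) [(7,(1,[(2,15),(1,20)])),(3,(1,[(3,10)])),(4,(1,[(2,5)])),(18,(1,[(18,24)]))]
(Upper 15 4 0 (1,[(14,26)]) (3,[(2,27),(1,1)]) [(5,(4,[(1,28),(3,7)])),(4,(6,[(5,0),(1,28)])),(2,(13,[(4,28),(15,4)])),(3,(1,[(3,10)]))]
(Lower 16 0 0 (1,[(16,27)]) (3,[(1,28),(2,2)]) [(5,(5,[(1,29),(8,8)])),(3,(3,[(8,12),(1,29)])),(4,(9,[(16,7),(4,29)])),(15,(15,[(1,29),(16,0)]))]
(Absurd [(38,28),(2,3),(9,0),(4,2)]))))
(Upper 20 0 1 (1,[(1,0)]) (13,[(6,27),(20,26)]) [(5,(1,[(5,15)])),(3,(13,[(1,27),(20,3)])),(4,(1,[(4,9)])),(18,(13,[(6,27),(20,1)]))]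
(Absurd [(1,5),(10,3),(15,26),(7,0)]))))))
(Upper 16 4 1 (1,[(1,0)]) (13,[(10,23),(16,22)]) [(5,(5,[(3,23),(4,2)])),(4,(1,[(4,11)])),(2,(1,[(2,7)])),(3,(5,[(1,23),(16,5)]))]
(Lower 18 1 1 (5,[(1,24),(6,1)]) (13,[(7,24),(19,23)]) [(7,(1,[(2,12),(1,17)])),(3,(1,[(3,7)])),(4,(1,[(2,2)])),(17,(8,[(1,24),(9,0)]))]
(Upper 20 2 1 (15,[(4,25),(19,2)]) (13,[(6,25),(20,24)]) [(7,(1,[(1,4)])),(5,(9,[(10,0),(5,25)])),(4,(1,[(4,7)])),(18,(3,[(1,25),(5,5)]))]
(Lower 22 2 1 (15,[(7,26),(22,3)]) (13,[(3,26),(23,25)]) [(8,(18,[(11,1),(1,26)])),(7,(5,[(2,26),(11,5)])),(5,(9,[(22,4),(1,26)])),(21,(8,[(3,26),(11,2)]))]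
(Lower 19 3 1 (15,[(4,27),(19,4)]) (13,[(6,27),(20,26)]) [(7,(36,[(19,2),(5,27)])),(6,(10,[(3,27),(19,6)])),(3,(20,[(19,1),(3,27)])),(18,(16,[(3,27),(19,3)]))]
(Upper 24 1 1 (15,[(8,28),(23,5)]) (13,[(2,28),(24,27)]) [(8,(5,[(2,28),(6,7)])),(3,(11,[(3,28),(12,1)])),(5,(19,[(1,28),(24,0)])),(22,(1,[(2,8)]))]
(Upper 23 3 1 (15,[(7,29),(22,6)]) (13,[(3,29),(23,28)]) [(8,(48,[(7,29),(23,0)])),(6,(18,[(23,4),(7,29)])),(3,(22,[(3,29),(23,2)])),(21,(26436,[(65,0),(156,3),(3120,25),(50149,9),(240,28)]))]
(Split 14 5 1
(Lower 13 0 0 (15,[(13,31),(13,8)]) (1,[(1,0)]) [(4,(24,[(5,31),(13,2)])),(2,(20,[(13,5),(1,31)])),(3,(23,[(13,1),(4,31)])),(13,(16,[(13,31),(13,7)]))]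
(Absurd [(36,0),(143,30),(11,31),(13,7)]))
(Upper 15 0 1 (1,[(1,0)]) (13,[(11,31),(15,30)]) [(4,(6,[(5,6),(1,31)])),(2,(22,[(1,31),(15,4)])),(3,(19,[(3,31),(15,3)])),(13,(8812,[(195,2),(468,5),(9360,27),(9455,11),(720,30)]))]
(Absurd [(5,3),(65,30),(5,31),(16,0)]))))))))))))))))
(Upper 6 0 0 (1,[(5,15)]) (13,[(7,17),(6,16)]) [(1,(1,[(1,5),(2,10)])),(1,(1,[(1,0)])),(1,(1,[(6,12),(1,0)])),(5,(4,[(1,17),(3,2)]))]
(Upper 6 0 0 (1,[(5,16)]) (13,[(7,18),(6,17)]) [(2,(1,[(2,0)])),(1,(1,[(1,1)])),(1,(1,[(6,13),(1,1)])),(5,(4,[(1,18),(3,3)]))]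
(Absurd [(3,5),(91,17),(7,18),(8,0)])))))))
(Upper 4 4 0 (1,[(3,11)]) (13,[(9,13),(4,12)]) [(1,(1,[(1,4)])),(1,(1,[(1,1)])),(0,(1,[(4,7)])),(1,(1,[(1,0)]))]
(Upper 4 2 0 (1,[(3,12)]) (13,[(9,14),(4,13)]) [(1,(1,[(1,5)])),(1,(1,[(1,2)])),(1,(1,[(1,1)])),(2,(5,[(4,4),(2,14)]))]
(Split 16 0 5
(Split 3 3 1
(Lower 6 2 0 (1,[(6,15)]) (13,[(6,17),(7,16)]) [(2,(8,[(3,1),(1,17)])),(3,(1,[(3,8)])),(2,(1,[(2,0)])),(5,(1,[(2,14),(1,3)]))]
(Lower 12 1 0 (1,[(12,16)]) (1,[(1,17)]) [(4,(4,[(3,2),(1,18)])),(3,(1,[(3,3)])),(4,(1,[(4,1)])),(9,(1,[(3,4)]))]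
(Upper 5 2 0 (1,[(4,17)]) (13,[(8,19),(5,18)]) [(1,(1,[(1,11),(1,10)])),(2,(12,[(5,0),(1,19)])),(1,(4,[(1,19),(5,6)])),(3,(1,[(1,9)]))]
(Lower 10 3 0 (1,[(10,18)]) (13,[(2,20),(11,19)]) [(3,(12,[(5,1),(1,20)])),(5,(1,[(5,11)])),(2,(1,[(2,0)])),(8,(1,[(2,17),(2,6)]))]
(Lower 9 1 0 (1,[(9,19)]) (13,[(3,21),(10,20)]) [(3,(8,[(3,2),(3,21)])),(2,(5,[(9,1),(1,21)])),(3,(1,[(3,4)])),(7,(1,[(1,18),(2,7)]))]
(Upper 7 4 0 (1,[(6,20)]) (13,[(6,22),(7,21)]) [(1,(1,[(3,14),(1,13)])),(3,(3,[(1,0),(1,3)])),(1,(6,[(1,22),(7,4)])),(2,(10,[(1,22),(7,1)]))]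
(Lower 10 4 0 (1,[(10,21)]) (13,[(2,23),(11,22)]) [(3,(12,[(5,4),(1,23)])),(5,(1,[(5,14)])),(2,(1,[(2,3)])),(4,(33,[(48,19),(8,5),(78,6),(48,21),(2,4)]))]
(Split 16 5 1
(Lower 14 0 0 (1,[(14,23)]) (3,[(2,0),(1,24)]) [(7,(1,[(7,16)])),(3,(5,[(14,5),(1,25)])),(5,(33,[(24,21),(4,7),(138,8),(24,23),(1,6)])),(10,(1,[(2,2)]))]
(Absurd [(7,4),(1,1),(16,24),(9,0)]))
(Upper 20 1 1 (16,[(3,25),(19,0)]) (13,[(6,25),(20,24)]) [(5,(1,[(5,16)])),(3,(3,[(1,25),(10,7)])),(6,(1,[(2,4)])),(14,(1,[(2,1)]))]
(Lower 21 2 1 (16,[(5,26),(21,1)]) (13,[(4,26),(22,25)]) [(6,(2,[(1,4),(1,7)])),(10,(20,[(11,26),(21,0)])),(7,(1,[(7,9)])),(15,(1,[(3,3)]))]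
(Upper 23 3 1 (8,[(3,27),(11,2)]) (13,[(3,27),(23,26)]) [(6,(40,[(13,27),(23,1)])),(10,(3,[(5,5),(2,8)])),(4,(21,[(8,27),(23,0)])),(16,(10,[(1,27),(23,3)]))]
(Upper 17 4 1 (1,[(1,3)]) (13,[(9,28),(17,27)]) [(4,(40,[(27,28),(17,2)])),(7,(12,[(17,9),(1,28)])),(3,(21,[(5,28),(17,1)])),(5,(10,[(1,28),(17,7)]))]
(Lower 24 0 1 (2,[(1,29),(3,4)]) (13,[(1,29),(25,28)]) [(11,(5,[(1,29),(6,3)])),(5,(5,[(24,9),(1,29)])),(8,(23,[(24,1),(16,29)])),(17,(17,[(1,29),(24,0)]))]
(Absurd [(1,29),(4,8),(13,28),(3,0)]))))))))))))))
(Upper 3 4 0 (1,[(2,15)]) (13,[(10,17),(3,16)]) [(0,(1,[(3,9)])),(1,(8,[(3,1),(1,17)])),(0,(1,[(3,11)])),(1,(1,[(1,0)]))]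
(Lower 6 2 0 (1,[(6,16)]) (13,[(6,18),(7,17)]) [(2,(8,[(3,2),(1,18)])),(3,(1,[(3,9)])),(3,(1,[(3,7)])),(4,(1,[(2,0)]))]
(Split 7 0 2
(Upper 5 3 0 (1,[(4,18)]) (13,[(8,20),(5,19)]) [(1,(1,[(1,12),(1,11)])),(2,(3,[(2,0),(1,4)])),(0,(6,[(5,20),(5,1)])),(3,(1,[(1,10)]))]
(Upper 5 2 0 (1,[(4,19)]) (13,[(8,21),(5,20)]) [(1,(1,[(1,13),(1,12)])),(2,(3,[(2,1),(1,5)])),(1,(4,[(1,21),(5,8)])),(3,(1,[(1,11)]))]
(Lower 10 0 0 (1,[(10,20)]) (13,[(2,22),(11,21)]) [(5,(1,[(5,13)])),(2,(1,[(2,0)])),(4,(1,[(2,1)])),(7,(1,[(1,8),(2,4)]))]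
(Absurd [(13,21),(7,0),(1,22),(10,3)]))))
(Upper 7 3 0 (1,[(6,18)]) (13,[(6,20),(7,19)]) [(2,(1,[(1,0)])),(2,(8,[(7,4),(5,20)])),(1,(6,[(1,20),(7,1)])),(4,(5,[(7,10),(1,20)]))]
(Lower 9 2 0 (1,[(9,19)]) (13,[(3,21),(10,20)]) [(3,(16,[(9,5),(3,21)])),(4,(7,[(1,21),(18,1)])),(4,(7,[(1,21),(9,0)])),(6,(1,[(3,3)]))]
(Upper 5 1 0 (1,[(4,20)]) (13,[(8,22),(5,21)]) [(1,(7,[(3,22),(5,2)])),(1,(9,[(1,22),(5,0)])),(1,(4,[(1,22),(5,9)])),(3,(1,[(1,12)]))]
(Lower 12 3 0 (1,[(12,21)]) (1,[(1,22)]) [(4,(4,[(3,7),(1,23)])),(5,(5,[(1,23),(12,0)])),(3,(1,[(3,8)])),(8,(1,[(4,5)]))]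
(Upper 5 0 0 (1,[(4,22)]) (13,[(8,24),(5,23)]) [(1,(8,[(5,8),(7,24)])),(1,(9,[(1,24),(5,2)])),(2,(12,[(1,24),(5,0)])),(3,(1,[(1,14)]))]
(Absurd [(1,2),(2,0),(13,23),(1,24)]))))))))))
(Lower 8 3 0 (1,[(8,14)]) (13,[(4,16),(9,15)]) [(3,(1,[(1,4)])),(3,(1,[(1,0)])),(2,(1,[(2,1)])),(6,(1,[(2,2)]))]
(Lower 8 2 0 (1,[(8,15)]) (13,[(4,17),(9,16)]) [(3,(1,[(1,5)])),(3,(1,[(1,1)])),(4,(1,[(4,6)])),(6,(1,[(2,3)]))]
(Lower 8 4 0 (1,[(8,16)]) (13,[(4,18),(9,17)]) [(3,(1,[(1,6)])),(3,(1,[(1,2)])),(2,(1,[(2,3)])),(4,(1,[(4,7)]))]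
(Split 3 0 1
(Upper 3 4 0 (1,[(2,18)]) (13,[(10,20),(3,19)]) [(0,(16,[(3,4),(15,20)])),(1,(1,[(2,0)])),(0,(8,[(3,20),(3,2)])),(1,(8,[(1,20),(3,3)]))]
(Lower 6 2 0 (1,[(6,19)]) (13,[(6,21),(7,20)]) [(2,(1,[(2,1)])),(3,(4,[(3,21),(3,5)])),(3,(1,[(3,10)])),(4,(1,[(2,0)]))]
(Upper 7 3 0 (1,[(6,20)]) (13,[(6,22),(7,21)]) [(2,(16,[(3,22),(7,6)])),(2,(1,[(2,2),(1,10)])),(1,(2,[(1,4),(1,0)])),(4,(8,[(7,3),(3,22)]))]
(Lower 9 2 0 (1,[(9,21)]) (13,[(3,23),(10,22)]) [(3,(1,[(3,3)])),(4,(8,[(5,23),(9,7)])),(4,(7,[(1,23),(9,0)])),(6,(1,[(3,2)]))]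
(Lower 12 3 0 (1,[(12,22)]) (1,[(1,23)]) [(4,(1,[(4,4)])),(5,(2,[(1,24),(3,8)])),(3,(1,[(3,9)])),(8,(1,[(4,3)]))]
(Upper 5 0 0 (1,[(4,23)]) (13,[(8,25),(5,24)]) [(1,(1,[(1,13),(1,18)])),(1,(7,[(1,7),(3,1)])),(2,(12,[(1,25),(5,0)])),(3,(8,[(5,6),(1,25)]))]
(Absurd [(9,25),(117,24),(5,10),(16,0)])))))))
(Upper 3 4 0 (1,[(2,18)]) (13,[(10,20),(3,19)]) [(1,(1,[(1,0)])),(0,(1,[(3,13)])),(0,(8,[(3,20),(3,2)])),(1,(8,[(1,20),(3,3)]))]
(Lower 6 2 0 (1,[(6,19)]) (13,[(6,21),(7,20)]) [(3,(1,[(3,14)])),(2,(1,[(4,1)])),(3,(1,[(3,10)])),(4,(1,[(2,0)]))]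
(Lower 12 3 0 (1,[(12,20)]) (1,[(1,21)]) [(5,(1,[(1,10),(2,15)])),(4,(1,[(8,2)])),(3,(1,[(3,7)])),(8,(1,[(4,1)]))]
(Upper 5 2 0 (1,[(4,21)]) (13,[(8,23),(5,22)]) [(1,(16,[(9,23),(5,7)])),(1,(1,[(1,11),(1,16)])),(2,(12,[(1,23),(5,0)])),(3,(8,[(5,4),(1,23)]))]
(Lower 10 1 0 (1,[(10,22)]) (13,[(2,24),(11,23)]) [(4,(1,[(1,12),(1,17)])),(2,(1,[(2,0)])),(5,(1,[(5,13)])),(7,(1,[(1,10),(2,3)]))]
(Upper 7 3 0 (1,[(6,23)]) (13,[(6,25),(7,24)]) [(2,(16,[(3,25),(7,9)])),(2,(10,[(7,0),(1,25)])),(1,(2,[(1,7),(1,3)])),(4,(8,[(7,6),(3,25)]))]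
(Lower 9 0 0 (1,[(9,24)]) (13,[(3,26),(10,25)]) [(3,(1,[(6,6)])),(2,(5,[(9,2),(1,26)])),(4,(7,[(1,26),(9,0)])),(6,(1,[(3,5)]))]
(Absurd [(20,0),(221,25),(17,26),(9,2)]))))))))))))))))
(Split 4 2 1
(Lower 4 4 0 (1,[(4,11)]) (13,[(8,13),(5,12)]) [(2,(1,[(2,6)])),(1,(1,[(1,1)])),(1,(1,[(1,0)])),(2,(1,[(2,2)]))]
(Upper 3 3 0 (1,[(2,12)]) (13,[(10,14),(3,13)]) [(1,(8,[(1,14),(3,2)])),(0,(1,[(3,7)])),(0,(1,[(3,8)])),(2,(3,[(1,0),(1,4)]))]
(Lower 4 3 0 (1,[(4,13)]) (13,[(8,15),(5,14)]) [(2,(1,[(2,8)])),(1,(1,[(1,3)])),(1,(1,[(1,2)])),(4,(1,[(4,12)]))]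
(Split 12 0 5
(Lower 12 4 0 (1,[(12,15)]) (1,[(1,16)]) [(5,(1,[(1,0)])),(3,(1,[(3,5)])),(3,(1,[(3,4)])),(4,(1,[(4,2)]))]
(Upper 6 2 0 (1,[(5,16)]) (13,[(7,18),(6,17)]) [(2,(4,[(1,18),(3,6)])),(1,(1,[(1,1)])),(1,(2,[(1,18),(3,2)])),(5,(2,[(1,0)]))]
(Lower 12 4 0 (1,[(12,17)]) (1,[(1,18)]) [(5,(1,[(1,2)])),(3,(1,[(3,7)])),(2,(1,[(2,0)])),(4,(1,[(4,4)]))]
(Lower 12 2 0 (1,[(12,18)]) (1,[(1,19)]) [(5,(1,[(1,3)])),(3,(1,[(3,8)])),(4,(1,[(4,5)])),(12,(1,[(12,17)]))]
(Upper 8 2 0 (1,[(7,19)]) (13,[(5,21),(8,20)]) [(3,(1,[(1,9)])),(1,(3,[(4,4),(1,21)])),(2,(1,[(2,5)])),(7,(3,[(1,1),(1,3)]))]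
(Lower 7 3 0 (1,[(7,20)]) (13,[(5,22),(8,21)]) [(3,(12,[(7,5),(1,22)])),(2,(4,[(1,22),(7,10)])),(1,(8,[(7,0),(1,22)])),(7,(1,[(7,19)]))]
(Split 5 0 2
(Upper 11 2 0 (1,[(10,22)]) (13,[(2,24),(11,23)]) [(4,(8,[(1,24),(11,12)])),(2,(1,[(2,0),(1,7)])),(3,(7,[(1,24),(11,1)])),(10,(12,[(10,4),(1,6)]))]
(Lower 9 1 0 (1,[(9,23)]) (13,[(3,25),(10,24)]) [(4,(4,[(3,8),(1,25)])),(1,(11,[(9,0),(2,25)])),(3,(1,[(3,10)])),(9,(1,[(9,22)]))]
(Lower 10 3 0 (1,[(10,24)]) (13,[(2,26),(11,25)]) [(4,(9,[(5,0),(1,26)])),(3,(2,[(1,26),(5,14)])),(1,(11,[(10,1),(1,26)])),(10,(1,[(10,23)]))]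
(Split 18 5 1
(Upper 14 4 0 (1,[(13,26)]) (5,[(1,0),(4,27)]) [(5,(4,[(1,28),(7,16)])),(3,(9,[(14,2),(1,28)])),(1,(6,[(1,28),(7,7)])),(4,(5,[(1,28),(7,1)]))]
(Lower 15 0 0 (1,[(15,27)]) (5,[(3,1),(2,28)]) [(4,(4,[(1,29),(15,17)])),(2,(11,[(15,4),(7,29)])),(5,(1,[(5,14)])),(14,(14,[(1,29),(15,0)]))]
(Absurd [(18,28),(6,0),(1,2),(5,4)])))
(Upper 24 0 1 (18,[(5,28),(23,0)]) (13,[(2,28),(24,27)]) [(5,(3,[(8,2),(1,28)])),(2,(1,[(2,7)])),(7,(5,[(1,28),(12,1)])),(22,(1,[(2,8)]))]
(Absurd [(3,17),(1,0)]))))))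
(Lower 9 2 0 (1,[(9,22)]) (13,[(3,24),(10,23)]) [(4,(4,[(3,7),(1,24)])),(2,(1,[(1,12),(2,0)])),(3,(1,[(3,9)])),(9,(1,[(9,21)]))]
(Upper 10 3 0 (1,[(9,23)]) (13,[(3,25),(10,24)]) [(4,(1,[(2,1)])),(1,(3,[(5,8),(2,25)])),(1,(3,[(1,4),(2,0)])),(9,(6,[(4,5),(1,7)]))]
(Upper 11 1 0 (1,[(10,24)]) (13,[(2,26),(11,25)]) [(4,(8,[(1,26),(11,14)])),(1,(3,[(2,5),(1,1)])),(3,(7,[(1,26),(11,3)])),(10,(12,[(10,6),(1,8)]))]
(Split 17 5 1
(Lower 16 0 0 (1,[(16,26)]) (1,[(1,0)]) [(3,(11,[(1,28),(16,1)])),(2,(1,[(2,6)])),(5,(5,[(1,28),(8,2)])),(16,(1,[(16,25)]))]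
(Absurd [(4,12),(3,0),(1,1),(17,27)]))
(Upper 18 0 1 (1,[(1,0)]) (13,[(8,28),(18,27)]) [(3,(1,[(3,11)])),(2,(1,[(2,3)])),(5,(7,[(1,28),(18,5)])),(16,(2,[(2,8),(1,10)]))]
(Absurd [(9,2),(52,27),(4,28),(11,0)])))))))))))))
(Lower 6 2 0 (1,[(6,15)]) (13,[(6,17),(7,16)]) [(3,(1,[(3,10)])),(1,(1,[(1,0)])),(2,(1,[(2,2)])),(6,(1,[(6,14)]))]
(Lower 6 4 0 (1,[(6,16)]) (13,[(6,18),(7,17)]) [(3,(1,[(3,11)])),(1,(1,[(1,1)])),(2,(2,[(3,5),(1,18)])),(2,(1,[(2,3)]))]
(Upper 5 2 0 (1,[(4,17)]) (13,[(8,19),(5,18)]) [(2,(12,[(1,19),(5,2)])),(0,(1,[(5,12)])),(1,(4,[(1,19),(5,3)])),(4,(7,[(1,9),(5,0)]))]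
(Split 9 0 4
(Lower 9 4 0 (1,[(9,19)]) (13,[(3,21),(10,20)]) [(4,(1,[(1,0)])),(2,(2,[(1,21),(3,4)])),(2,(5,[(9,1),(1,21)])),(3,(1,[(3,6)]))]
(Upper 8 1 0 (1,[(7,20)]) (13,[(5,22),(8,21)]) [(3,(3,[(1,22),(2,5)])),(1,(3,[(1,22),(4,4)])),(2,(1,[(2,6)])),(7,(9,[(1,22),(8,0)]))]
(Upper 12 4 0 (1,[(11,21)]) (13,[(1,23),(12,22)]) [(5,(4,[(1,23),(3,0)])),(1,(1,[(2,2),(3,16)])),(2,(1,[(2,5)])),(3,(1,[(3,7)]))]
(Upper 7 3 0 (1,[(6,22)]) (13,[(6,24),(7,23)]) [(3,(16,[(1,24),(7,1)])),(0,(1,[(7,17)])),(1,(6,[(1,24),(7,6)])),(6,(9,[(2,24),(7,2)]))]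
(Split 19 5 1
(Lower 13 0 0 (1,[(13,24)]) (6,[(1,0),(5,25)]) [(2,(8,[(3,26),(13,3)])),(3,(5,[(13,6),(2,26)])),(4,(7,[(2,26),(13,1)])),(12,(12,[(1,26),(13,2)]))]
(Absurd [(38,25),(13,6),(2,1),(9,0)]))
(Lower 24 0 1 (19,[(5,26),(24,0)]) (13,[(1,26),(25,25)]) [(3,(1,[(3,3)])),(5,(5,[(24,6),(1,26)])),(7,(7,[(1,26),(24,1)])),(22,(1,[(2,2)]))]
(Absurd [(13,25),(8,6),(1,26),(3,0)])))))))
(Lower 9 4 0 (1,[(9,19)]) (13,[(3,21),(10,20)]) [(5,(2,[(9,14),(1,21)])),(1,(1,[(2,0)])),(2,(5,[(9,1),(1,21)])),(3,(1,[(3,6)]))]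
(Upper 7 3 0 (1,[(6,20)]) (13,[(6,22),(7,21)]) [(3,(3,[(1,5),(1,1)])),(0,(1,[(7,15)])),(1,(6,[(1,22),(7,4)])),(6,(9,[(2,22),(7,0)]))]
(Lower 10 1 0 (1,[(10,21)]) (13,[(2,23),(11,22)]) [(5,(1,[(5,16)])),(2,(1,[(2,3)])),(3,(7,[(1,23),(10,0)])),(10,(1,[(10,20)]))]
(Upper 12 4 0 (1,[(11,22)]) (13,[(1,24),(12,23)]) [(5,(1,[(1,7)])),(1,(5,[(6,0),(1,24)])),(2,(1,[(2,6)])),(3,(1,[(3,8)]))]
(Lower 24 0 1 (53,[(140,4),(105,0),(252,5),(12,23),(180,2)]) (13,[(1,25),(25,24)]) [(3,(1,[(1,8),(4,4)])),(5,(5,[(24,5),(1,25)])),(7,(7,[(1,25),(24,2)])),(22,(1,[(2,0)]))]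
(Absurd [(13,24),(6,2),(1,25),(5,0)]))))))))))))))
(Upper 4 4 0 (1,[(3,11)]) (13,[(9,13),(4,12)]) [(1,(2,[(1,13),(1,1)])),(0,(1,[(4,6)])),(1,(1,[(1,0)])),(1,(1,[(4,8),(1,0)]))]
(Split 3 3 1
(Lower 6 1 0 (1,[(6,13)]) (13,[(6,15),(7,14)]) [(3,(1,[(3,8)])),(2,(1,[(6,10),(2,0)])),(2,(1,[(2,0)])),(5,(1,[(2,12),(1,1)]))]
(Lower 12 0 0 (1,[(12,14)]) (1,[(1,15)]) [(3,(1,[(3,4)])),(4,(1,[(12,11),(4,1)])),(4,(1,[(4,1)])),(9,(1,[(3,2)]))]
(Absurd [(1,0),(1,1)])))
(Upper 3 2 0 (1,[(2,13)]) (13,[(10,15),(3,14)]) [(1,(8,[(1,15),(3,3)])),(0,(1,[(3,8)])),(1,(1,[(1,0)])),(1,(5,[(4,15),(3,5)]))]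
(Upper 3 4 0 (1,[(2,14)]) (13,[(10,16),(3,15)]) [(1,(8,[(1,16),(3,4)])),(0,(1,[(3,9)])),(0,(1,[(3,10)])),(1,(1,[(1,1)]))]
(Lower 6 1 0 (1,[(6,15)]) (13,[(6,17),(7,16)]) [(3,(1,[(3,10)])),(2,(1,[(2,1)])),(3,(1,[(3,6)])),(4,(1,[(2,0)]))]
(Lower 12 3 0 (1,[(12,16)]) (1,[(1,17)]) [(5,(1,[(1,0)])),(3,(1,[(3,6)])),(4,(1,[(4,2)])),(8,(1,[(4,1)]))]
(Upper 5 1 0 (1,[(4,17)]) (13,[(8,19),(5,18)]) [(1,(8,[(7,19),(5,7)])),(1,(1,[(1,13),(1,6)])),(2,(12,[(1,19),(5,0)])),(3,(1,[(1,9)]))]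
(Upper 5 0 0 (1,[(4,18)]) (13,[(8,20),(5,19)]) [(0,(6,[(5,2),(5,20)])),(1,(1,[(1,14),(1,7)])),(2,(12,[(1,20),(5,1)])),(3,(1,[(1,10)]))]
(Absurd [(2,0),(1,1)])))))))))))))"
lemma check_certB1: "check 24 formsB1 hypsB1 certB1"
  by code_simp

definition formsB2 :: "int list list" where "formsB2 = [[1, 0, 0, 0, 0], [-2, 0, 0, 0, 2], [0, 1, 0, 0, 0], [0, 0, 1, 0, 0], [1, -1, -1, -1, 0]]"
text \<open>Here w = x - y - z - \<delta>, and 1/2 < x < 1 places 2 - 2 x in the unit
  interval.\<close>

definition hypsB2 :: "ineq list" where "hypsB2 = [(True, [2, 0, 0, 0, -1]), (True, [-1, 0, 0, 0, 1]), (True, [0, 1, 0, 0, 0]), (False, [0, -1, 1, 0, 0]), (False, [1, -1, -2, -1, 0]), (True, [0, 0, 0, 1, 0]), (True, [0, 0, 0, -13, 1]), (True, [0, 0, 0, 0, 1])]"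
definition certB2 :: cert where "certB2 =
Upper 2 1 0 (1,[(1,5)]) (13,[(11,7),(2,6)]) [(1,(1,[(1,0)])),(0,(1,[(2,2)])),(0,(1,[(2,2),(2,3)])),(0,(39,[(11,7),(26,3),(52,4),(13,0),(2,6)]))]
(Upper 2 4 0 (1,[(1,6)]) (13,[(11,8),(2,7)]) [(1,(1,[(1,1)])),(0,(1,[(4,2)])),(0,(1,[(2,3)])),(0,(1,[(2,3),(2,4)]))]
(Split 6 0 5
(Upper 3 4 0 (1,[(2,8)]) (13,[(10,10),(3,9)]) [(2,(2,[(1,3),(1,2)])),(1,(1,[(1,0)])),(0,(1,[(3,5)])),(0,(52,[(6,9),(6,2),(78,6),(27,3),(39,1)]))]
(Lower 6 2 0 (1,[(6,9)]) (13,[(6,11),(7,10)]) [(5,(1,[(1,1)])),(3,(1,[(3,3)])),(2,(1,[(6,8),(2,0)])),(2,(1,[(2,0)]))]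
(Split 4 3 1
(Lower 12 1 0 (1,[(12,11)]) (1,[(1,12)]) [(10,(1,[(2,3)])),(3,(1,[(3,0),(12,9)])),(3,(1,[(3,0)])),(4,(1,[(4,2)]))]
(Lower 4 4 0 (1,[(4,12)]) (13,[(8,14),(5,13)]) [(4,(6,[(1,0),(5,14)])),(2,(1,[(2,6)])),(1,(1,[(1,1),(4,10)])),(1,(1,[(1,1)]))]
(Split 5 3 1
(Lower 5 0 0 (1,[(5,14)]) (13,[(7,16),(6,15)]) [(3,(1,[(1,9),(2,8)])),(1,(1,[(1,0),(5,12)])),(1,(1,[(1,0)])),(2,(3,[(5,5),(1,16)]))]
(Absurd [(24,0),(1,16),(13,15),(5,3)]))
(Upper 5 2 0 (1,[(4,14)]) (13,[(8,16),(5,15)]) [(3,(2,[(3,9),(1,8)])),(2,(12,[(5,2),(1,16)])),(1,(1,[(1,0)])),(1,(4,[(5,1),(1,16)]))]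
(Lower 10 4 0 (1,[(10,15)]) (13,[(2,17),(11,16)]) [(8,(12,[(5,3),(1,17)])),(5,(1,[(5,9)])),(2,(1,[(2,0)])),(3,(2,[(1,17),(5,4)]))]
(Upper 7 1 0 (1,[(6,16)]) (13,[(6,18),(7,17)]) [(5,(2,[(1,11),(3,10)])),(1,(6,[(1,18),(7,6)])),(1,(5,[(7,2),(2,18)])),(2,(10,[(7,0),(1,18)]))]
(Lower 9 3 0 (1,[(9,17)]) (13,[(3,19),(10,18)]) [(8,(8,[(3,5),(7,19)])),(4,(4,[(1,12),(5,0)])),(2,(5,[(9,2),(1,19)])),(3,(1,[(3,8)]))]
(Lower 11 2 0 (1,[(11,18)]) (13,[(1,20),(12,19)]) [(9,(24,[(11,6),(7,20)])),(5,(2,[(1,13),(3,1)])),(3,(4,[(1,20),(11,7)])),(4,(3,[(11,9),(1,20)]))]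
(Split 17 5 1
(Lower 15 0 0 (1,[(15,20)]) (4,[(3,0),(1,21)]) [(7,(1,[(1,15),(2,3)])),(3,(1,[(3,5)])),(4,(4,[(1,22),(15,9)])),(5,(1,[(5,11)]))]
(Absurd [(17,21),(8,0),(1,1),(5,9)]))
(Upper 18 0 1 (1,[(1,0)]) (13,[(8,22),(18,21)]) [(7,(2,[(3,8),(1,22)])),(3,(11,[(3,22),(18,1)])),(4,(1,[(2,2)])),(5,(5,[(9,4),(2,22)]))]
(Absurd [(13,21),(9,4),(1,22),(7,0)])))))))))))
(Upper 4 0 0 (1,[(3,11)]) (13,[(9,13),(4,12)]) [(1,(3,[(4,3),(1,13)])),(0,(3,[(2,13),(2,1)])),(1,(1,[(1,0)])),(1,(1,[(4,10),(1,0)]))]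
(Absurd [(1,6),(1,0)])))))
(Split 8 0 7
(Upper 4 3 0 (1,[(3,9)]) (13,[(9,11),(4,10)]) [(3,(2,[(1,4),(1,1)])),(1,(1,[(1,0)])),(0,(1,[(4,6)])),(1,(78,[(208,8),(17,1),(1,4),(8,10),(104,7)]))]
(Lower 8 4 0 (1,[(8,10)]) (13,[(4,12),(9,11)]) [(7,(1,[(1,1)])),(3,(2,[(1,5),(5,2)])),(2,(1,[(2,0),(8,8)])),(2,(1,[(2,0)]))]
(Lower 8 2 0 (1,[(8,11)]) (13,[(4,13),(9,12)]) [(7,(1,[(1,2)])),(3,(2,[(1,6),(5,3)])),(2,(1,[(2,1)])),(4,(1,[(4,4)]))]
(Split 6 3 1
(Lower 6 0 0 (1,[(6,13)]) (13,[(6,15),(7,14)]) [(2,(1,[(2,5)])),(1,(1,[(1,0),(6,11)])),(1,(1,[(1,0)])),(3,(1,[(3,6)]))]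
(Absurd [(1,0),(6,10)]))
(Upper 6 2 0 (1,[(5,13)]) (13,[(7,15),(6,14)]) [(5,(1,[(1,5)])),(1,(2,[(3,4),(1,15)])),(1,(1,[(1,0)])),(2,(4,[(3,2),(1,15)]))]
(Lower 12 4 0 (1,[(12,14)]) (1,[(1,15)]) [(11,(2,[(3,5),(1,16)])),(4,(1,[(4,6)])),(2,(1,[(2,0)])),(3,(1,[(3,4)]))]
(Upper 5 3 0 (1,[(4,15)]) (13,[(8,17),(5,16)]) [(4,(4,[(1,10),(3,7)])),(1,(4,[(5,6),(1,17)])),(0,(8,[(5,17),(5,3)])),(2,(12,[(5,0),(1,17)]))]
(Lower 10 1 0 (1,[(10,16)]) (13,[(2,18),(11,17)]) [(9,(4,[(5,7),(1,18)])),(2,(3,[(5,2),(1,18)])),(2,(1,[(2,0)])),(5,(1,[(5,9)]))]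
(Lower 9 4 0 (1,[(9,17)]) (13,[(3,19),(10,18)]) [(8,(20,[(9,0),(7,19)])),(3,(1,[(3,9)])),(2,(2,[(3,3),(1,19)])),(2,(5,[(1,19),(9,1)]))]
(Upper 7 2 0 (1,[(6,18)]) (13,[(6,20),(7,19)]) [(5,(4,[(5,13),(3,10)])),(2,(10,[(7,1),(1,20)])),(1,(6,[(1,20),(7,5)])),(3,(3,[(1,0),(1,3)]))]
(Split 17 5 1
(Lower 14 0 0 (1,[(14,20)]) (2,[(1,0),(1,21)]) [(5,(2,[(1,15),(9,12)])),(2,(1,[(2,1)])),(3,(5,[(1,22),(14,4)])),(7,(1,[(7,13)]))]
(Absurd [(10,0),(1,1),(17,21),(7,4)]))
(Upper 18 0 1 (1,[(1,0)]) (13,[(8,22),(18,21)]) [(5,(5,[(9,3),(2,22)])),(2,(4,[(1,22),(9,8)])),(3,(1,[(3,7)])),(8,(1,[(2,2)]))]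
(Absurd [(3,13),(1,0)])))))))))))))
(Split 3 4 1
(Lower 3 0 0 (1,[(3,10)]) (13,[(9,12),(4,11)]) [(1,(3,[(1,5),(2,1)])),(1,(1,[(1,9),(2,8),(1,10),(1,6)])),(1,(1,[(3,9),(1,0)])),(1,(1,[(1,0)]))]
(Absurd [(1,0),(3,7)]))
(Upper 3 3 0 (1,[(2,10)]) (13,[(10,12),(3,11)]) [(2,(6,[(5,5),(1,1)])),(0,(1,[(6,6)])),(0,(1,[(3,7)])),(1,(1,[(1,0)]))]
(Split 5 2 1
(Lower 4 3 0 (1,[(4,12)]) (13,[(8,14),(5,13)]) [(4,(1,[(4,8)])),(1,(1,[(1,3)])),(1,(5,[(4,0),(1,14)])),(2,(1,[(2,5)]))]
(Split 12 0 11
(Lower 12 2 0 (1,[(12,14)]) (1,[(1,15)]) [(11,(1,[(1,0)])),(3,(1,[(3,5)])),(4,(1,[(4,3)])),(6,(1,[(6,7)]))]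
(Upper 6 2 0 (1,[(5,15)]) (13,[(7,17),(6,16)]) [(5,(3,[(1,10),(2,6)])),(1,(1,[(1,1)])),(1,(2,[(1,17),(3,2)])),(2,(1,[(2,5)]))]
(Lower 12 4 0 (1,[(12,16)]) (1,[(1,17)]) [(11,(1,[(1,2)])),(3,(1,[(3,7)])),(2,(1,[(2,0)])),(4,(1,[(4,5)]))]
(Upper 5 1 0 (1,[(4,17)]) (13,[(8,19),(5,18)]) [(4,(2,[(1,12),(1,8)])),(0,(12,[(5,19),(5,2)])),(1,(4,[(1,19),(5,4)])),(2,(12,[(5,0),(1,19)]))]
(Upper 8 2 0 (1,[(7,18)]) (13,[(5,20),(8,19)]) [(7,(4,[(1,13),(3,0)])),(1,(3,[(4,4),(1,20)])),(2,(1,[(2,5)])),(3,(3,[(2,1),(1,20)]))]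
(Split 7 3 2
(Lower 10 2 0 (1,[(10,20)]) (13,[(2,22),(11,21)]) [(10,(6,[(5,6),(5,22)])),(2,(1,[(2,2)])),(3,(7,[(10,0),(1,22)])),(5,(1,[(5,13)]))]
(Split 19 5 1
(Lower 14 0 0 (1,[(14,22)]) (3,[(1,0),(2,23)]) [(3,(4,[(1,17),(11,4)])),(2,(4,[(7,3),(1,24)])),(4,(1,[(2,2)])),(7,(1,[(7,15)]))]
(Absurd [(6,0),(1,1),(19,23),(7,9)]))
(Upper 20 4 1 (1,[(1,0)]) (13,[(6,24),(20,23)]) [(18,(1,[(2,4)])),(3,(3,[(10,8),(1,24)])),(2,(1,[(2,1)])),(5,(1,[(5,9)]))]
(Lower 24 0 1 (19,[(5,25),(24,1)]) (13,[(1,25),(25,24)]) [(5,(4,[(1,18),(19,5)])),(3,(1,[(3,4)])),(7,(7,[(24,3),(1,25)])),(11,(5,[(6,0),(1,25)]))]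
(Absurd [(1,0),(2,10)])))))
(Upper 7 4 0 (1,[(6,20)]) (13,[(6,22),(7,21)]) [(6,(8,[(3,15),(5,2)])),(1,(6,[(7,6),(1,22)])),(0,(12,[(7,22),(7,5)])),(2,(1,[(1,0)]))]
(Lower 9 2 0 (1,[(9,21)]) (13,[(3,23),(10,22)]) [(9,(4,[(3,7),(3,23)])),(2,(4,[(1,16),(7,3)])),(3,(1,[(3,10)])),(4,(7,[(9,0),(1,23)]))]
(Upper 10 3 0 (1,[(9,22)]) (13,[(3,24),(10,23)]) [(9,(1,[(1,4)])),(1,(3,[(5,8),(2,24)])),(1,(3,[(1,7),(2,0)])),(4,(6,[(5,5),(1,24)]))]
(Lower 23 0 1 (13,[(28,5),(40,2),(35,4),(19,23),(28,0)]) (13,[(2,25),(24,24)]) [(5,(2,[(1,18),(9,5)])),(3,(8,[(23,4),(1,25)])),(7,(10,[(23,0),(1,25)])),(10,(7,[(23,2),(1,25)]))]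
(Upper 18 0 1 (383,[(71,24),(920,3),(805,5),(644,1),(280,0)]) (13,[(8,26),(18,25)]) [(3,(1,[(3,10)])),(2,(1,[(2,2)])),(5,(7,[(1,26),(18,4)])),(7,(2,[(3,7),(1,26)]))]
(Absurd [(18,1),(130,25),(23,0),(10,26)]))))))))))))
(Lower 6 2 0 (1,[(6,14)]) (13,[(6,16),(7,15)]) [(6,(1,[(6,10)])),(1,(1,[(1,0)])),(2,(1,[(2,3)])),(3,(1,[(3,7)]))]
(Lower 5 4 0 (1,[(5,15)]) (13,[(7,17),(6,16)]) [(5,(1,[(5,11)])),(1,(5,[(1,10),(4,1)])),(1,(1,[(1,3)])),(2,(3,[(1,17),(5,4)]))]
(Upper 8 1 0 (1,[(7,16)]) (13,[(5,18),(8,17)]) [(7,(5,[(2,11),(3,2)])),(1,(3,[(1,18),(4,1)])),(2,(1,[(2,3)])),(3,(5,[(8,0),(1,18)]))]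
(Split 22 0 21
(Upper 12 4 0 (1,[(11,18)]) (13,[(1,20),(12,19)]) [(11,(7,[(2,13),(5,1)])),(1,(11,[(12,0),(1,20)])),(2,(1,[(2,3)])),(3,(1,[(3,5)]))]
(Lower 9 1 0 (1,[(9,19)]) (13,[(3,21),(10,20)]) [(9,(22,[(9,1),(9,21)])),(2,(5,[(9,7),(1,21)])),(3,(1,[(3,8)])),(4,(4,[(3,0),(1,21)]))]
(Lower 7 3 0 (1,[(7,20)]) (13,[(5,22),(8,21)]) [(7,(22,[(7,2),(7,22)])),(1,(7,[(1,15),(6,3)])),(2,(5,[(7,8),(3,22)])),(3,(12,[(7,1),(1,22)]))]
(Upper 10 3 0 (1,[(9,21)]) (13,[(3,23),(10,22)]) [(9,(7,[(3,16),(4,4)])),(1,(2,[(1,1),(1,3)])),(1,(3,[(2,23),(5,6)])),(4,(1,[(2,5)]))]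
(Upper 11 2 0 (1,[(10,22)]) (13,[(2,24),(11,23)]) [(10,(14,[(5,17),(9,5)])),(1,(1,[(1,4)])),(3,(7,[(1,24),(11,1)])),(4,(5,[(11,6),(2,24)]))]
(Split 17 5 1
(Lower 16 0 0 (1,[(16,24)]) (1,[(1,0)]) [(2,(1,[(2,7)])),(3,(11,[(16,1),(1,26)])),(5,(5,[(1,26),(8,2)])),(7,(3,[(4,5),(1,26)]))]
(Absurd [(1,0),(16,21)]))
(Upper 18 0 1 (1,[(1,0)]) (13,[(8,26),(18,25)]) [(2,(1,[(2,4)])),(3,(1,[(3,9)])),(5,(7,[(1,26),(18,3)])),(7,(799,[(2762,8),(286,23),(143,19),(26,1),(22,25)]))]
(Absurd [(8,0),(9,8),(7,26),(91,25)]))))))))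
(Lower 10 3 0 (1,[(10,18)]) (13,[(2,20),(11,19)]) [(10,(1,[(10,14)])),(1,(10,[(1,13),(9,0)])),(2,(1,[(2,6)])),(5,(1,[(5,11)]))]
(Upper 7 4 0 (1,[(6,19)]) (13,[(6,21),(7,20)]) [(6,(4,[(3,14),(1,1)])),(0,(1,[(14,15)])),(1,(6,[(1,21),(7,4)])),(2,(10,[(1,21),(7,0)]))]
(Lower 9 0 0 (1,[(9,20)]) (13,[(3,22),(10,21)]) [(1,(5,[(1,15),(4,2)])),(2,(5,[(9,8),(1,22)])),(3,(1,[(3,9)])),(4,(7,[(9,0),(1,22)]))]
(Absurd [(9,17),(1,0)]))))))))))
(Upper 6 1 0 (1,[(5,12)]) (13,[(7,14),(6,13)]) [(5,(3,[(1,7),(2,3)])),(1,(1,[(1,9),(1,0)])),(1,(53,[(13,3),(8,13),(214,10),(52,5),(22,0)])),(2,(1,[(2,2)]))]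
(Upper 5 4 0 (1,[(4,13)]) (13,[(8,15),(5,14)]) [(4,(10,[(7,8),(3,0)])),(0,(1,[(10,9)])),(1,(1,[(1,1)])),(1,(1,[(1,1),(5,11)]))]
(Split 4 3 1
(Lower 4 0 0 (1,[(4,15)]) (13,[(8,17),(5,16)]) [(1,(5,[(2,10),(3,2)])),(1,(1,[(4,13),(1,0)])),(1,(1,[(1,0)])),(2,(5,[(4,1),(2,17)]))]
(Absurd [(1,0),(4,12)]))
(Upper 4 2 0 (1,[(3,15)]) (13,[(9,17),(4,16)]) [(3,(5,[(4,10),(1,2)])),(0,(1,[(8,11)])),(1,(1,[(1,0)])),(1,(195,[(520,14),(17,2),(28,10),(20,16),(260,13)]))]
(Lower 12 1 0 (1,[(12,16)]) (1,[(1,17)]) [(12,(1,[(12,12)])),(3,(1,[(3,0)])),(4,(1,[(4,5)])),(5,(5,[(12,2),(1,18)]))]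
(Split 16 0 15
(Upper 8 4 0 (1,[(7,18)]) (13,[(5,20),(8,19)]) [(7,(5,[(2,13),(3,5)])),(1,(1,[(1,0)])),(1,(1,[(3,15),(1,6)])),(2,(1,[(2,3)]))]
(Upper 10 3 0 (1,[(9,19)]) (13,[(3,21),(10,20)]) [(9,(5,[(1,14),(4,6)])),(1,(2,[(1,1),(1,2)])),(2,(1,[(2,7)])),(3,(75,[(312,18),(94,9),(13,6),(12,20),(156,17)]))]
(Upper 9 2 0 (1,[(8,20)]) (13,[(4,22),(9,21)]) [(8,(10,[(3,15),(7,7)])),(1,(4,[(3,2),(1,3)])),(2,(1040,[(114,15),(360,21),(4680,18),(585,1),(371,7)])),(3,(1,[(3,10)]))]
(Split 14 5 1
(Lower 13 1 0 (1,[(13,22)]) (1,[(1,0)]) [(13,(24,[(13,5),(13,24)])),(3,(9,[(13,1),(1,24)])),(4,(10,[(1,24),(13,2)])),(5,(8,[(13,3),(1,24)]))]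
(Lower 13 0 0 (1,[(13,23)]) (1,[(1,1)]) [(3,(1,[(1,18),(2,10)])),(3,(9,[(13,2),(1,25)])),(4,(10,[(1,25),(13,3)])),(5,(8,[(13,4),(1,25)]))]
(Absurd [(1,1),(2,0)])))
(Lower 18 3 1 (7,[(2,24),(9,0)]) (13,[(7,24),(19,23)]) [(17,(4,[(3,4),(1,5)])),(3,(1,[(3,9)])),(4,(1,[(2,1)])),(7,(4,[(9,3),(1,24)]))]
(Upper 15 1 1 (1,[(1,1)]) (13,[(11,25),(15,24)]) [(13,(10,[(9,18),(11,10)])),(3,(1,[(3,11)])),(4,(6,[(1,25),(5,0)])),(5,(1,[(5,13)]))]
(Upper 15 0 1 (1,[(1,2)]) (13,[(11,26),(15,25)]) [(1,(4,[(5,7),(1,26)])),(3,(1,[(3,12)])),(4,(6,[(1,26),(5,1)])),(5,(80,[(114,4),(90,25),(130,3),(39,0),(30,23)]))]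
(Absurd [(1,1),(2,0)]))))))))
(Lower 8 4 0 (1,[(8,18)]) (13,[(4,20),(9,19)]) [(8,(3,[(1,1),(1,20)])),(1,(1,[(1,0)])),(2,(1,[(2,2)])),(3,(3,[(1,20),(8,7)]))]
(Lower 7 3 0 (1,[(7,19)]) (13,[(5,21),(8,20)]) [(7,(24,[(7,2),(7,21)])),(1,(7,[(1,14),(6,1)])),(2,(4,[(7,3),(1,21)])),(3,(5,[(7,5),(1,21)]))]
(Upper 11 1 0 (1,[(10,20)]) (13,[(2,22),(11,21)]) [(10,(14,[(5,15),(9,2)])),(2,(1,[(1,17),(2,8)])),(3,(7,[(1,22),(11,0)])),(4,(8,[(11,1),(1,22)]))]
(Lower 9 2 0 (1,[(9,21)]) (13,[(3,23),(10,22)]) [(9,(8,[(3,4),(3,23)])),(1,(5,[(1,16),(4,0)])),(3,(1,[(3,10)])),(4,(5,[(9,7),(2,23)]))]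
(Lower 10 3 0 (1,[(10,22)]) (13,[(2,24),(11,23)]) [(10,(12,[(5,5),(5,24)])),(1,(10,[(1,17),(9,1)])),(3,(2,[(5,6),(1,24)])),(4,(1,[(2,8)]))]
(Upper 14 0 0 (1,[(13,23)]) (74,[(40,1),(52,24),(45,4),(36,0),(15,6)]) [(1,(6,[(7,6),(1,25)])),(3,(9,[(1,25),(14,1)])),(4,(5,[(1,25),(7,0)])),(5,(4,[(7,4),(1,25)]))]
(Absurd [(1,0),(1,3),(8,20)])))))))))))))))))))"
lemma check_certB2: "check 24 formsB2 hypsB2 certB2"
  by code_simp

section \<open>Exhaustive search for small r\<close>

text \<open>The list \<open>ws\<close> holds the residues of \<open>j as\<close> modulo r in the range from 1 to r, for j = 1, 2, and so on.\<close>

function survive :: "int \<Rightarrow> int \<Rightarrow> int \<Rightarrow> int list \<Rightarrow> int list \<Rightarrow> bool" where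
  "survive m r S as ws = (if m \<le> 0 then True else
     (let ws' = map2 (\<lambda>a w. if a + w \<le> r then a + w else a + w - r) as ws in
       S \<le> sum_list ws' \<and> survive (m - 1) r S as ws'))"
  by auto
termination by (relation "Wellfounded.measure (\<lambda>(m, _). nat m)") auto

declare survive.simps [simp del]

definition units_mod :: "int \<Rightarrow> int list" where
  "units_mod r = filter (\<lambda>a. gcd a r = 1) [1..r - 1]"

text \<open>For r \<le> 25 the weights add up to 2 r - 1. Starting from j = 1, the r - 2 steps test
  j = 2, ..., r - 1.\<close>

definition admissible :: "int \<Rightarrow> int list \<Rightarrow> bool" where
  "admissible r as \<longleftrightarrow> survive (r - 2) r (2 * r - 1) as as"

definition exceptional :: "(int \<times> int list) list" where
  "exceptional = [(19, [3, 4, 5, 7, 18]), (17, [2, 3, 5, 7, 16]), (14, [2, 3, 4, 5, 13])]"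

text \<open>The equations a1 + a2 + a5 = r and a3 + a4 + 1 = r leave three units to enumerate. No
  exceptional alternative occurs: this relation has no solution in the range searched.\<close>

definition searchA :: "int \<Rightarrow> bool" where
  "searchA r \<longleftrightarrow> (let us = units_mod r in
     list_all (\<lambda>a1. list_all (\<lambda>a2. a2 < a1 \<or> r \<le> a1 + a2 \<or>
       list_all (\<lambda>a3. r - 1 \<le> a3 \<or> \<not> admissible r [a1, a2, a3, r - 1 - a3, r - a1 - a2] \<or>
         gcd (r - 1 - a3) r \<noteq> gcd (r - a1 - a2) r) us) us) us)"

text \<open>The relation determines a5 as a representative of -2 a1, and the total 2 r - 1 then
  determines a4.\<close>

definition searchB :: "int \<Rightarrow> bool" where
  "searchB r \<longleftrightarrow> (let us = units_mod r in
     list_all (\<lambda>a1. let a5 = (if 2 * a1 < r then r - 2 * a1 else 2 * r - 2 * a1) in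
       list_all (\<lambda>a2. list_all (\<lambda>a3. let a4 = 2 * r - 1 - a1 - a2 - a3 - a5; as = [a1, a2, a3, a4, a5] in
         a3 < a2 \<or> a4 \<le> 0 \<or> r \<le> a4 \<or> \<not> admissible r as \<or>
         gcd a4 r \<noteq> gcd a5 r \<or> List.member exceptional (r, sort as)) us) us) us)"

definition searchC :: "int \<Rightarrow> bool" where
  "searchC r \<longleftrightarrow> (let us = units_mod r in
     list_all (\<lambda>a4. let a5 = (if 2 * a4 < r then r - 2 * a4 else 2 * r - 2 * a4) in
       list_all (\<lambda>a1. list_all (\<lambda>a2. let a3 = 2 * r - 1 - a1 - a2 - a4 - a5; as = [a1, a2, a3, a4, a5] in
         a2 < a1 \<or> a3 < a2 \<or> r \<le> a3 \<or> \<not> admissible r as \<or> gcd a3 r \<noteq> 1 \<or>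
         gcd a4 r \<noteq> gcd a5 r \<or> List.member exceptional (r, sort as)) us) us) [1..r - 1])"

lemma searchA_range: "list_all searchA [14..25]" by code_simp

lemma searchB_range: "list_all searchB [14..25]" by code_simp

lemma searchC_range: "list_all searchC [14..25]" by code_simp

section \<open>Floor patterns\<close>

text \<open>
  With \<open>x\<^sub>i = a\<^sub>i / r\<close> and \<open>\<delta> = 2 - \<Sum>x\<^sub>i\<close>, the bound on the floors says that the fractional parts
  of the \<open>j x\<^sub>i\<close> and of \<open>j \<delta>\<close> add up to at least (respectively at most) 3.
\<close>

definition pattern :: "real \<Rightarrow> real list \<Rightarrow> bool" where
  "pattern d xs \<longleftrightarrow> length xs = 5 \<and> 0 < d \<and> 13 * d < 1 \<and> (\<forall>x\<in>set xs. 0 < x \<and> x < 1) \<and>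
     (\<forall>j\<in>{1..24::int}. \<forall>x\<in>set xs. of_int j * x \<notin> \<int>) \<and> (\<forall>j\<in>{1..25::int}. of_int j * d \<notin> \<int>) \<and>
     (\<forall>j\<in>{2..24::int}. \<forall>n::int.
       (of_int n < of_int (j - 1) * d \<longrightarrow> of_int j * d < of_int n + 1 \<longrightarrow>
          (\<Sum>x\<leftarrow>xs. \<lfloor>of_int j * x\<rfloor>) + n \<le> 2 * j - 3) \<and>
       (of_int n < of_int j * d \<longrightarrow> of_int (j + 1) * d < of_int n + 1 \<longrightarrow>
          2 * j - 3 \<le> (\<Sum>x\<leftarrow>xs. \<lfloor>of_int j * x\<rfloor>) + n))"

text \<open>The entries enter only through their number, their set and a sum, so they may be sorted
  as the certificates require.\<close>

lemma pattern_perm: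
  assumes "mset xs = mset ys" "pattern d xs"
  shows "pattern d ys"
proof -
  have len: "length xs = length ys" and set: "set xs = set ys"
    using assms(1) by (metis size_mset) (metis assms(1) mset_eq_setD)
  have sum: "(\<Sum>x\<leftarrow>xs. f x) = (\<Sum>x\<leftarrow>ys. f x)" for f :: "real \<Rightarrow> int"
    using assms(1) by (metis mset_map sum_mset_sum_list)
  show ?thesis using assms(2) unfolding pattern_def len set sum .
qed

lemma floor_pattern_of_pattern:
  assumes "pattern d (map (\<lambda>L. lin L [x, y, z, d, 1]) Ls)"
  shows "floor_pattern 24 Ls [x, y, z, d, 1] d"
proof
  show "length Ls = 5" using assms by (simp add: pattern_def)
  show "of_int j * lin L [x, y, z, d, 1] \<notin> \<int>" if "1 \<le> j" "j \<le> 24" "L \<in> set Ls" for j L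
    using assms that by (simp add: pattern_def)
  show "of_int j * d \<notin> \<int>" if "1 \<le> j" "j \<le> 24 + 1" for j
    using assms that by (simp add: pattern_def)
  show "(\<Sum>L\<leftarrow>Ls. \<lfloor>of_int j * lin L [x, y, z, d, 1]\<rfloor>) + n \<le> 2 * j - 3"
    if "2 \<le> j" "j \<le> 24" "of_int n < of_int (j - 1) * d" "of_int j * d < of_int n + 1" for j n
    using assms that by (simp add: pattern_def comp_def)
  show "2 * j - 3 \<le> (\<Sum>L\<leftarrow>Ls. \<lfloor>of_int j * lin L [x, y, z, d, 1]\<rfloor>) + n"
    if "2 \<le> j" "j \<le> 24" "of_int n < of_int j * d" "of_int (j + 1) * d < of_int n + 1" for j n
    using assms that by (simp add: pattern_def comp_def)
  show "lin (bnd j dform m) [x, y, z, d, 1] = of_int j * d - of_int m" for j m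
    by (simp add: bnd_def dform_def lscale_def)
  show "lin (bnd j L m) [x, y, z, d, 1] = of_int j * lin L [x, y, z, d, 1] - of_int m" for j L m
    by (simp add: bnd_def)
qed

text \<open>The relations are symmetric in p, q, t and in u, w; the certificate treats the sorted
  case.\<close>

lemma no_pattern_A:
  assumes "pattern d [p, q, t, u, w]" and sums: "p + q + t = 1" "u + w + d = 1"
  shows False
proof -
  have sorted: False
    if "pattern d [p, q, t, u, w]" "p \<le> q" "q \<le> t" "u \<le> w" "p + q + t = 1" "u + w + d = 1" for p q t u w
  proof -
    have "map (\<lambda>L. lin L [p, q, u, d, 1]) formsA = [p, q, t, u, w]"
      using that by (simp add: formsA_def)
    then interpret floor_pattern 24 formsA "[p, q, u, d, 1]" d
      using that(1) by (intro floor_pattern_of_pattern) simp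
    have "list_all (sat [p, q, u, d, 1]) hypsA"
      using that unfolding hypsA_def pattern_def by simp
    with check_certA show False by (rule check_sound)
  qed
  have half_sorted: False
    if P: "pattern d [p, q, t, u, w]" and le: "p \<le> q" "q \<le> t" and "p + q + t = 1" for p q t
  proof (cases "u \<le> w")
    case True
    then show False using sorted[OF P le _ that(4) sums(2)] by simp
  next
    case False
    have "pattern d [p, q, t, w, u]" by (rule pattern_perm[OF _ P]) simp
    then show False using sorted[of p q t w u] le that(4) sums(2) False by simp
  qed
  have perm: "pattern d [p', q', t', u, w]" if "mset [p', q', t'] = mset [p, q, t]" for p' q' t'
  proof -
    have "mset ([p, q, t] @ [u, w]) = mset ([p', q', t'] @ [u, w])"
      by (simp only: mset_append that)
    from pattern_perm[OF this] show ?thesis using assms(1) by simp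
  qed
  consider "p \<le> q" "q \<le> t" | "p \<le> t" "t \<le> q" | "q \<le> p" "p \<le> t" | "q \<le> t" "t \<le> p"
    | "t \<le> p" "p \<le> q" | "t \<le> q" "q \<le> p" by linarith
  then show False
  proof cases
    case 1
    then show False using half_sorted[OF perm[of p q t]] sums(1) by (simp add: add_mset_commute add_ac)
  next
    case 2
    then show False using half_sorted[OF perm[of p t q]] sums(1) by (simp add: add_mset_commute add_ac)
  next
    case 3
    then show False using half_sorted[OF perm[of q p t]] sums(1) by (simp add: add_mset_commute add_ac)
  next
    case 4
    then show False using half_sorted[OF perm[of q t p]] sums(1) by (simp add: add_mset_commute add_ac)
  next
    case 5
    then show False using half_sorted[OF perm[of t p q]] sums(1) by (simp add: add_mset_commute add_ac)
  next
    case 6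
    then show False using half_sorted[OF perm[of t q p]] sums(1) by (simp add: add_mset_commute add_ac)
  qed
qed

text \<open>The relation ties u to x, its two forms being x < 1/2 and x > 1/2 since 0 < u < 1. The
  other three entries are interchangeable and are sorted.\<close>

lemma no_pattern_B:
  assumes "pattern d [x, u, y, z, w]" and u: "u = 1 - 2 * x \<or> u = 2 - 2 * x"
    and sum: "x + u + y + z + w + d = 2"
  shows False
proof -
  have sorted: False
    if P: "pattern d [x, u, y, z, w]" and le: "y \<le> z" "z \<le> w" and sum: "x + u + y + z + w + d = 2" for y z w
    using u
  proof
    assume u: "u = 1 - 2 * x"
    have "map (\<lambda>L. lin L [x, y, z, d, 1]) formsB1 = [x, u, y, z, w]"
      using u sum by (simp add: formsB1_def)
    then interpret floor_pattern 24 formsB1 "[x, y, z, d, 1]" d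
      using P by (intro floor_pattern_of_pattern) simp
    have "list_all (sat [x, y, z, d, 1]) hypsB1"
      using P le sum u unfolding hypsB1_def pattern_def by simp
    with check_certB1 show False by (rule check_sound)
  next
    assume u: "u = 2 - 2 * x"
    have "map (\<lambda>L. lin L [x, y, z, d, 1]) formsB2 = [x, u, y, z, w]"
      using u sum by (simp add: formsB2_def)
    then interpret floor_pattern 24 formsB2 "[x, y, z, d, 1]" d
      using P by (intro floor_pattern_of_pattern) simp
    have "list_all (sat [x, y, z, d, 1]) hypsB2"
      using P le sum u unfolding hypsB2_def pattern_def by simp
    with check_certB2 show False by (rule check_sound)
  qed
  have perm: "pattern d [x, u, y', z', w']" if "mset [y', z', w'] = mset [y, z, w]" for y' z' w'
    by (rule pattern_perm[OF _ assms(1)]) (use that in simp)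
  consider "y \<le> z" "z \<le> w" | "y \<le> w" "w \<le> z" | "z \<le> y" "y \<le> w" | "z \<le> w" "w \<le> y"
    | "w \<le> y" "y \<le> z" | "w \<le> z" "z \<le> y" by linarith
  then show False
  proof cases
    case 1
    then show False using sorted[OF perm[of y z w]] sum by (simp add: add_mset_commute add_ac)
  next
    case 2
    then show False using sorted[OF perm[of y w z]] sum by (simp add: add_mset_commute add_ac)
  next
    case 3
    then show False using sorted[OF perm[of z y w]] sum by (simp add: add_mset_commute add_ac)
  next
    case 4
    then show False using sorted[OF perm[of z w y]] sum by (simp add: add_mset_commute add_ac)
  next
    case 5
    then show False using sorted[OF perm[of w y z]] sum by (simp add: add_mset_commute add_ac)
  next
    case 6
    then show False using sorted[OF perm[of w z y]] sum by (simp add: add_mset_commute add_ac)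
  qed
qed

section \<open>Residues\<close>

definition residue :: "int \<Rightarrow> int \<Rightarrow> int" where
  "residue r x = (x - 1) mod r + 1"

lemma residue_eq: "residue r x = x - r * ((x - 1) div r)"
  unfolding residue_def by (simp add: minus_div_mult_eq_mod[symmetric] algebra_simps)

lemma residue_bounds: "r > 0 \<Longrightarrow> 1 \<le> residue r x \<and> residue r x \<le> r"
  by (simp add: residue_def add1_zle_eq)

lemma residue_eqI:
  assumes "1 \<le> y" "y \<le> r" "r dvd x - y"
  shows "residue r x = y"
proof -
  obtain m where m: "x = y + r * m" using assms(3) by (metis dvdE diff_eq_eq add.commute)
  have "(x - 1) mod r = (y - 1) mod r" unfolding m by (metis add_diff_eq diff_add_eq mod_mult_self2)
  also have "\<dots> = y - 1" using assms by (intro mod_pos_pos_trivial) auto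
  finally show ?thesis by (simp add: residue_def)
qed

lemma residue_dvd_diff: "r dvd x - residue r x"
  by (simp add: residue_eq)

lemma residue_of_multiple: "r > 0 \<Longrightarrow> r dvd x \<Longrightarrow> residue r x = r"
  by (rule residue_eqI) auto

lemma residue_less:
  assumes "r > 0" "\<not> r dvd x"
  shows "residue r x < r"
  using assms residue_bounds[of r x] residue_dvd_diff[of r x]
  by (metis dvd_add_triv_right_iff diff_add_cancel order_le_less)

lemma residue_minus:
  assumes "r > 0" "\<not> r dvd x"
  shows "residue r (- x) = r - residue r x"
proof (rule residue_eqI)
  have "r dvd - (x - residue r x) - r"
    using residue_dvd_diff[of r x] by (intro dvd_diff) (simp_all only: dvd_minus_iff dvd_refl)
  moreover have "- x - (r - residue r x) = - (x - residue r x) - r" by simp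
  ultimately show "r dvd - x - (r - residue r x)" by (simp only:)
qed (use residue_bounds[OF assms(1), of x] residue_less[OF assms] in auto)

lemma residue_cong: "r > 0 \<Longrightarrow> r dvd x - y \<Longrightarrow> residue r x = residue r y"
proof (rule residue_eqI)
  assume "r > 0" "r dvd x - y"
  then show "r dvd x - residue r y" using residue_dvd_diff[of r y] by (metis add_diff_cancel_left diff_add_cancel dvd_add diff_diff_eq2 add.commute)
qed (use residue_bounds in auto)

section \<open>Large r\<close>

text \<open>
  The shift by \<open>v\<close> moves a point with an integral multiple \<open>j a / r\<close> off the lattice while keeping
  the floors of all other multiples.
\<close>

lemma floor_shifted:
  fixes r a j :: int and v :: real
  assumes "r > 0" "1 \<le> j" "j \<le> 24" "\<bar>v\<bar> \<le> 2" "r dvd j * a \<Longrightarrow> v \<noteq> 0"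
  defines "x \<equiv> (of_int a + v / 100) / of_int r"
  shows "\<lfloor>of_int j * x\<rfloor> = (j * a - 1) div r + (if r dvd j * a \<and> v > 0 then 1 else 0)"
    and "of_int j * x \<notin> \<int>"
proof -
  define b e q where "b = j * a" and "e = of_int j * v / 100"
    and "q = (b - 1) div r + (if r dvd b \<and> v > 0 then 1 else 0)"
  have "\<bar>of_int j * v\<bar> \<le> 24 * 2"
    unfolding abs_mult using assms by (intro mult_mono) auto
  \<comment> \<open>The numerator moves by at most 24 * 2 / 100, less than half the spacing of the
    integers.\<close>
  then have e: "- 1 / 2 < e" "e < 1 / 2" unfolding e_def by linarith+
  have x: "of_int j * x = (of_int b + e) / of_int r"
    by (simp add: x_def b_def e_def field_simps)
  \<comment> \<open>\<open>(b - 1) div r\<close> is the floor of b / r approached from below: at a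
    multiple of r it is one less than b / r, and an upward shift restores the missing 1.\<close>
  define c m where "c = (b - 1) div r" and "m = (b - 1) mod r"
  have b: "b = r * c + m + 1"
    using mult_div_mod_eq[of r "b - 1"] unfolding c_def m_def by linarith
  have m: "0 \<le> m" "m < r" using assms(1) by (simp_all add: m_def)
  have dvd_b: "r dvd b \<longleftrightarrow> m = r - 1"
  proof
    assume "r dvd b"
    then have "r dvd m + 1" using b by (simp add: add.assoc dvd_add_right_iff)
    then show "m = r - 1" using m zdvd_imp_le[of r "m + 1"] by simp
  next
    assume "m = r - 1"
    then have "b = r * (c + 1)" using b by (simp add: distrib_left)
    then show "r dvd b" by simp
  qed
  have q: "q = c + (if r dvd b \<and> v > 0 then 1 else 0)" by (simp add: q_def c_def)
  have r1: "of_int r \<ge> (1::real)" using assms(1) by simp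
  have "of_int (r * q) < of_int b + e \<and> of_int b + e < of_int (r * q + r)"
  proof (cases "r dvd b")
    case False
    then have "r * q + 1 \<le> b" "b + 1 \<le> r * q + r" using b m dvd_b by (auto simp: q)
    then have "of_int (r * q + 1) \<le> (of_int b :: real)" "(of_int (b + 1) :: real) \<le> of_int (r * q + r)"
      by (simp_all only: of_int_le_iff)
    then show ?thesis using e by simp
  next
    case True
    then have b: "b = r * c + r" and v: "v \<noteq> 0" using b dvd_b assms(5) by (auto simp: b_def)
    show ?thesis
    proof (cases "v > 0")
      case vpos: True
      then have "r * q = b" using b True by (simp add: q distrib_left)
      moreover have "e > 0" unfolding e_def using vpos assms(2) by simp
      ultimately show ?thesis using e r1 by simp
    next
      case False
      then have "r * q + r = b" using b by (simp add: q)
      then have "of_int b = (of_int (r * q) + of_int r :: real)" by (simp only: flip: of_int_add)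
      moreover have "e < 0" unfolding e_def using False v assms(2) by (simp add: mult_less_0_iff)
      ultimately show ?thesis using e r1 by simp
    qed
  qed
  then have q_less: "of_int q < of_int j * x" "of_int j * x < of_int q + 1"
    unfolding x using assms(1) by (simp_all add: field_simps)
  show "of_int j * x \<notin> \<int>"
  proof
    assume "of_int j * x \<in> \<int>"
    then obtain k where k: "of_int j * x = of_int k" by (auto elim: Ints_cases)
    have "of_int q < (of_int k :: real)" "of_int k < (of_int (q + 1) :: real)"
      using q_less unfolding k by simp_all
    then show False unfolding of_int_less_iff by simp
  qed
  show "\<lfloor>of_int j * x\<rfloor> = (j * a - 1) div r + (if r dvd j * a \<and> v > 0 then 1 else 0)"
    using q_less
    unfolding q_def[unfolded b_def, symmetric] by (intro floor_unique) auto
qed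

lemma mod_of_bounds: "n * r < x \<Longrightarrow> x < (n + 1) * r \<Longrightarrow> x mod r = x - n * r" for x r n :: int
proof -
  assume "n * r < x" "x < (n + 1) * r"
  then have "(x - n * r) mod r = x - n * r" by (intro mod_pos_pos_trivial) (auto simp: distrib_right)
  moreover have "(x - n * r + n * r) mod r = (x - n * r) mod r" by (rule mod_mult_self1)
  ultimately show ?thesis by simp
qed

text \<open>Multiplying \<open>gcd a r\<close> by j gives gcd (j a, j r), so divisibility depends on
  a only through its gcd with r. Hence a4 and a5 have integral multiples at the same j.\<close>

lemma dvd_mult_gcd_iff: "(r::int) dvd j * a \<longleftrightarrow> r dvd j * gcd a r"
proof -
  have "r dvd j * gcd a r \<longleftrightarrow> r dvd \<bar>j\<bar> * gcd a r" by (simp add: abs_if)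
  also have "\<bar>j\<bar> * gcd a r = gcd (j * a) (j * r)" by (rule gcd_mult_distrib_int)
  finally show ?thesis by simp
qed

text \<open>
  The entries \<open>as ! 3\<close> and \<open>as ! 4\<close>, which need not be prime to r, are shifted in opposite
  directions: when both have an integral j-th multiple, one fractional part becomes almost 0
  and the other one almost 1.
\<close>

locale weights =
  fixes r s :: int and as :: "int list" and v :: "real list"
  assumes r: "26 \<le> r" and s: "0 < s" "13 * s < r" "coprime s r"
    and len: "length as = 5" "length v = 5"
    and as: "\<forall>a\<in>set as. 0 < a \<and> a < r" and sum: "sum_list as = 2 * r - s"
    and cop: "coprime (as ! 0) r" "coprime (as ! 1) r" "coprime (as ! 2) r"
    and gcd_eq: "gcd (as ! 3) r = gcd (as ! 4) r"
    and wts: "\<And>j. 1 \<le> j \<Longrightarrow> sum_list as \<le> (\<Sum>a\<leftarrow>as. residue r (j * a))"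
    and zero: "\<And>j. 1 \<le> j \<Longrightarrow> j \<le> 24 \<Longrightarrow> r dvd j * as ! 3 \<Longrightarrow> r dvd j * as ! 4 \<Longrightarrow>
      (\<Sum>a\<leftarrow>as. residue r (j * a)) = 4 * r - j * s mod r"
    and v: "\<forall>t\<in>set v. \<bar>t\<bar> \<le> 2" "v ! 3 > 0" "v ! 4 < 0"
begin

definition pt :: "nat \<Rightarrow> real" where
  "pt i = (of_int (as ! i) + v ! i / 100) / of_int r"

lemma sum5: "sum_list (map f as) = f (as ! 0) + f (as ! 1) + f (as ! 2) + f (as ! 3) + f (as ! 4 :: int)"
  for f :: "int \<Rightarrow> int"
proof -
  obtain a b c d e where "as = [a, b, c, d, e]"
    using len(1) by (auto simp: length_Suc_conv numeral_eq_Suc)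
  then show ?thesis by (simp add: numeral_eq_Suc)
qed

lemma not_dvd:
  assumes "coprime a r" "1 \<le> j" "j < r"
  shows "\<not> r dvd j * a"
proof
  assume "r dvd j * a"
  then have "r dvd j" using assms(1) by (simp add: coprime_commute coprime_dvd_mult_left_iff)
  then show False using zdvd_imp_le[of r j] assms by simp
qed

lemma dvd_iff: "r dvd j * as ! 3 \<longleftrightarrow> r dvd j * as ! 4"
  using gcd_eq dvd_mult_gcd_iff by metis

lemma floor_pt:
  assumes "1 \<le> j" "j \<le> 24" "i < 5"
  shows "\<lfloor>of_int j * pt i\<rfloor> = (j * as ! i - 1) div r + (if i = 3 \<and> r dvd j * as ! 3 then 1 else 0)"
    and "of_int j * pt i \<notin> \<int>"
proof -
  have i: "i \<in> {0, 1, 2, 3, 4}" using assms(3) by auto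
  have vi: "\<bar>v ! i\<bar> \<le> 2" using v len assms(3) by simp
  have nd: "\<not> r dvd j * as ! i" if "i < 3"
  proof -
    have "i \<in> {0, 1, 2}" using that by auto
    then show ?thesis using cop r assms not_dvd[of "as ! i" j] by auto
  qed
  have vn: "v ! i \<noteq> 0" if "r dvd j * as ! i"
    using i nd that v by auto
  have "(if r dvd j * as ! i \<and> v ! i > 0 then 1 else (0::int)) = (if i = 3 \<and> r dvd j * as ! 3 then 1 else 0)"
    using i nd v by auto
  with floor_shifted[of r j "v ! i" "as ! i"] vn vi assms r
  show "\<lfloor>of_int j * pt i\<rfloor> = (j * as ! i - 1) div r + (if i = 3 \<and> r dvd j * as ! 3 then 1 else 0)"
    and "of_int j * pt i \<notin> \<int>"
    unfolding pt_def by simp_all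
qed

text \<open>Each j a equals r times \<open>(j * a - 1) div r\<close> plus its residue. At an
  integral multiple the upward shift of entry 3 raises its floor by 1, hence the additional
  r.\<close>

lemma sum_floor:
  assumes "1 \<le> j" "j \<le> 24"
  shows "r * (\<Sum>i\<leftarrow>[0..<5]. \<lfloor>of_int j * pt i\<rfloor>) =
    j * (2 * r - s) - (\<Sum>a\<leftarrow>as. residue r (j * a)) + (if r dvd j * as ! 3 then r else 0)"
proof -
  have "j * (2 * r - s) = (\<Sum>a\<leftarrow>as. j * a)"
    using sum_list_const_mult[of j "\<lambda>a. a" as] by (simp add: sum)
  moreover have "[0..<5] = [0, 1, 2, 3, 4 :: nat]" by (simp add: upt_rec)
  ultimately show ?thesis
    unfolding sum5 using assms
    by (simp add: floor_pt residue_eq algebra_simps del: One_nat_def)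
qed

text \<open>The weight inequality at j puts the left side strictly below \<open>2 * j - 2\<close>,
  and it is an integer.\<close>

lemma upper_floor:
  assumes j: "2 \<le> j" "j \<le> 24" and n: "n * r < (j - 1) * s" "j * s < (n + 1) * r"
  shows "(\<Sum>i\<leftarrow>[0..<5]. \<lfloor>of_int j * pt i\<rfloor>) + n \<le> 2 * j - 3"
proof -
  let ?F = "\<Sum>i\<leftarrow>[0..<5]. \<lfloor>of_int j * pt i\<rfloor>"
  show ?thesis
  proof (cases "r dvd j * as ! 3")
    case False
    have "r * ?F \<le> (j - 1) * (2 * r - s)"
      using sum_floor[of j] wts[of j] sum j False by (simp add: algebra_simps)
    then have "r * (?F + n) < r * (2 * j - 2)"
      using n by (simp add: algebra_simps)
    then show ?thesis using r by (simp add: mult_less_cancel_left)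
  next
    case True
    \<comment> \<open>At integral multiples \<open>zero\<close> and the opposite shifts give
      equality with \<open>2 * j - 3\<close>; the same computation serves the lower bound.\<close>
    have "j * s mod r = j * s - n * r"
      using n r s by (intro mod_of_bounds) (auto simp: algebra_simps)
    then have "r * ?F = r * (2 * j - 3 - n)"
      using sum_floor[of j] zero[of j] dvd_iff[of j] j True by (simp add: algebra_simps)
    then show ?thesis using r by simp
  qed
qed

text \<open>The weight inequality is applied at r - j, a positive representative of -j; residues of
  opposite numbers not divisible by r add up to r.\<close>

lemma lower_floor:
  assumes j: "2 \<le> j" "j \<le> 24" and n: "n * r < j * s" "(j + 1) * s < (n + 1) * r"
  shows "2 * j - 3 \<le> (\<Sum>i\<leftarrow>[0..<5]. \<lfloor>of_int j * pt i\<rfloor>) + n"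
proof -
  let ?F = "\<Sum>i\<leftarrow>[0..<5]. \<lfloor>of_int j * pt i\<rfloor>"
  show ?thesis
  proof (cases "r dvd j * as ! 3")
    case False
    have nd: "\<not> r dvd j * as ! i" if "i < 5" for i
    proof -
      have "i \<in> {0, 1, 2, 3, 4}" using that by auto
      then show ?thesis using cop r j not_dvd[of "as ! i" j] False dvd_iff[of j] by auto
    qed
    have neg: "residue r ((r - j) * as ! i) = r - residue r (j * as ! i)" if "i < 5" for i
    proof -
      have "residue r ((r - j) * as ! i) = residue r (- (j * as ! i))"
        using r by (intro residue_cong) (auto simp: algebra_simps)
      then show ?thesis using residue_minus[OF _ nd[OF that]] r by simp
    qed
    have "2 * r - s \<le> 5 * r - (\<Sum>a\<leftarrow>as. residue r (j * a))"
      using wts[of "r - j"] sum r j neg unfolding sum5 by simp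
    then have "r * (2 * j - 4) < r * (?F + n)"
      using sum_floor[of j] n j False by (simp add: algebra_simps)
    then show ?thesis using r by (simp add: mult_less_cancel_left)
  next
    case True
    have "j * s mod r = j * s - n * r"
      using n r s by (intro mod_of_bounds) (auto simp: algebra_simps)
    then have "r * ?F = r * (2 * j - 3 - n)"
      using sum_floor[of j] zero[of j] dvd_iff[of j] j True by (simp add: algebra_simps)
    then show ?thesis using r by simp
  qed
qed

lemma pattern_pt: "pattern (of_int s / of_int r) (map pt [0..<5])"
  unfolding pattern_def
proof (intro conjI ballI allI impI)
  have r0: "(0::real) < of_int r" using r by simp
  show "0 < of_int s / (of_int r :: real)" using r s by simp
  have "of_int (13 * s) < (of_int r :: real)" using s by (simp only: of_int_less_iff)
  then show "13 * (of_int s / of_int r) < (1 :: real)" using r0 by (simp add: field_simps)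
  show "of_int j * (of_int s / of_int r) \<notin> (\<int> :: real set)" if "j \<in> {1..25}" for j
  proof
    assume "of_int j * (of_int s / of_int r) \<in> (\<int> :: real set)"
    then obtain m where "of_int (j * s) / of_int r = (of_int m :: real)" by (auto elim: Ints_cases)
    then have "of_int (j * s) = (of_int (r * m) :: real)" using r0 by (simp add: field_simps)
    then have "j * s = r * m" by (simp only: of_int_eq_iff)
    then have "r dvd j * s" by simp
    \<comment> \<open>Here r \<ge> 26 enters: j \<le> 25 is below r, and s is prime to r.\<close>
    then show False using not_dvd[OF s(3), of j] that r by auto
  qed
  show "of_int j * x \<notin> \<int>" if "j \<in> {1..24}" "x \<in> set (map pt [0..<5])" for j x
    using that floor_pt(2) by auto
  fix x assume "x \<in> set (map pt [0..<5])"
  then obtain i where i: "i < 5" "x = pt i" by auto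
  have "as ! i \<in> set as" "v ! i \<in> set v" using i len by auto
  then have a: "1 \<le> as ! i" "as ! i + 1 \<le> r" "\<bar>v ! i\<bar> \<le> 2" using as v by fastforce+
  then have "of_int 1 \<le> (of_int (as ! i) :: real)" "of_int (as ! i + 1) \<le> (of_int r :: real)"
    by (simp_all only: of_int_le_iff)
  then show "0 < x" "x < 1" using a(3) r0 unfolding i(2) pt_def by (auto simp: field_simps abs_le_iff)
next
  fix j n :: int assume j: "j \<in> {2..24}"
  have r0: "(0::real) < of_int r" using r by simp
  have lt: "of_int m < of_int k * (of_int s / of_int r :: real) \<longleftrightarrow> m * r < k * s"
    "of_int k * (of_int s / of_int r :: real) < of_int m \<longleftrightarrow> k * s < m * r" for m k
    using r0 by (simp_all add: pos_less_divide_eq pos_divide_less_eq flip: of_int_mult)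
  show "(\<Sum>x\<leftarrow>map pt [0..<5]. \<lfloor>of_int j * x\<rfloor>) + n \<le> 2 * j - 3"
    if "of_int n < of_int (j - 1) * (of_int s / of_int r :: real)"
      "of_int j * (of_int s / of_int r) < (of_int n + 1 :: real)"
    using upper_floor[of j n] that j lt(1)[of n "j - 1"] lt(2)[of j "n + 1"] by (simp add: comp_def)
  show "2 * j - 3 \<le> (\<Sum>x\<leftarrow>map pt [0..<5]. \<lfloor>of_int j * x\<rfloor>) + n"
    if "of_int n < of_int j * (of_int s / of_int r :: real)"
      "of_int (j + 1) * (of_int s / of_int r) < (of_int n + 1 :: real)"
    using lower_floor[of j n] that j lt(1)[of n j] lt(2)[of "j + 1" "n + 1"] by (simp add: comp_def)
qed simp

end

section \<open>Correctness of the enumeration for small r\<close>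

lemma survive_if_weights:
  assumes "r > 0" and as: "\<forall>a\<in>set as. 0 < a \<and> a < r"
    and wts: "\<And>j. 1 \<le> j \<Longrightarrow> S \<le> (\<Sum>a\<leftarrow>as. residue r (j * a))" and "1 \<le> j"
  shows "survive m r S as (map (\<lambda>a. residue r (j * a)) as)"
  using \<open>1 \<le> j\<close>
proof (induction "nat m" arbitrary: m j)
  case 0
  then show ?case by (subst survive.simps) simp
next
  case (Suc n)
  \<comment> \<open>As 0 < a < r, adding a to a residue in 1..r requires at most one subtraction of
    r.\<close>
  have step: "(if a + residue r (j * a) \<le> r then a + residue r (j * a) else a + residue r (j * a) - r) =
    residue r ((j + 1) * a)" if "a \<in> set as" for a
  proof (rule sym, rule residue_eqI)
    have "0 < a" "a < r" using as that by auto
    moreover have "1 \<le> residue r (j * a)" "residue r (j * a) \<le> r"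
      using residue_bounds[OF assms(1)] by auto
    ultimately show "1 \<le> (if a + residue r (j * a) \<le> r then a + residue r (j * a) else a + residue r (j * a) - r)"
      "(if a + residue r (j * a) \<le> r then a + residue r (j * a) else a + residue r (j * a) - r) \<le> r" by auto
    have "r dvd j * a - residue r (j * a)" "r dvd j * a - residue r (j * a) + r"
      using residue_dvd_diff[of r "j * a"] by simp_all
    then show "r dvd (j + 1) * a - (if a + residue r (j * a) \<le> r then a + residue r (j * a) else a + residue r (j * a) - r)"
      by (auto simp: algebra_simps)
  qed
  have "map2 (\<lambda>a w. if a + w \<le> r then a + w else a + w - r) as (map (\<lambda>a. residue r (j * a)) as) =
      map (\<lambda>a. residue r ((j + 1) * a)) as"
    using step by (simp add: list_eq_iff_nth_eq)
  moreover have "n = nat (m - 1)" using Suc by simp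
  ultimately show ?case
    using Suc.hyps(1)[of "m - 1" "j + 1"] Suc.prems wts[of "j + 1"]
    by (subst survive.simps) (simp add: Let_def)
qed

lemma admissible_if_weights:
  assumes "r > 0" "\<forall>a\<in>set as. 0 < a \<and> a < r" "sum_list as = 2 * r - 1"
    and "\<And>j. 1 \<le> j \<Longrightarrow> sum_list as \<le> (\<Sum>a\<leftarrow>as. residue r (j * a))"
  shows "admissible r as"
proof -
  have "residue r (1 * a) = a" if "a \<in> set as" for a
    using assms(2) that by (intro residue_eqI) (auto simp: less_imp_le)
  then have "map (\<lambda>a. residue r (1 * a)) as = as" by (simp add: map_idI)
  then show ?thesis
    using survive_if_weights[OF assms(1,2,4), of 1 "r - 2"] by (simp add: admissible_def assms(3))
qed

lemma units_modI: "0 < a \<Longrightarrow> a < r \<Longrightarrow> gcd a r = 1 \<Longrightarrow> a \<in> set (units_mod r)"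
  by (simp add: units_mod_def)

lemma small_A:
  assumes "14 \<le> r" "r \<le> 25" and adm: "admissible r [a1, a2, a3, a4, a5]"
    and a: "0 < a1" "0 < a2" "0 < a3" "0 < a4" "0 < a5"
    and "gcd a1 r = 1" "gcd a2 r = 1" "gcd a3 r = 1" "gcd a4 r = gcd a5 r"
    and sums: "a1 + a2 + a5 = r" "a3 + a4 + 1 = r" and "a1 \<le> a2"
  shows False
proof -
  have "r \<in> set [14..25]" using assms(1,2) by (simp only: set_upto atLeastAtMost_iff simp_thms)
  then have "searchA r" using searchA_range unfolding list_all_iff by blast
  moreover have "a1 \<in> set (units_mod r)" "a2 \<in> set (units_mod r)" "a3 \<in> set (units_mod r)"
    using assms by (auto intro!: units_modI)
  ultimately have *: "a2 < a1 \<or> r \<le> a1 + a2 \<or> r - 1 \<le> a3 \<or>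
      \<not> admissible r [a1, a2, a3, r - 1 - a3, r - a1 - a2] \<or> gcd (r - 1 - a3) r \<noteq> gcd (r - a1 - a2) r"
    unfolding searchA_def Let_def list_all_iff by blast
  have e: "r - 1 - a3 = a4" "r - a1 - a2 = a5" using sums by auto
  have "\<not> a2 < a1" "\<not> r \<le> a1 + a2" "\<not> r - 1 \<le> a3" using sums a \<open>a1 \<le> a2\<close> by linarith+
  with *[unfolded e] adm \<open>gcd a4 r = gcd a5 r\<close> show False by blast
qed

lemma exceptional_mset:
  assumes "List.member exceptional (r, sort as)"
  shows "(r, mset as) \<in> {(19, {#3, 4, 5, 7, 18#}), (17, {#2, 3, 5, 7, 16#}), (14, {#3, 5, 13, 2, 4#})}"
proof -
  have "(r, sort as) \<in> set exceptional" using assms by (simp add: List.member_iff)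
  then have "r = 19 \<and> sort as = [3, 4, 5, 7, 18] \<or> r = 17 \<and> sort as = [2, 3, 5, 7, 16] \<or>
      r = 14 \<and> sort as = [2, 3, 4, 5, 13]"
    unfolding exceptional_def by auto
  moreover have "mset as = mset xs" if "sort as = xs" for xs
    using that by (metis mset_sort)
  ultimately have "r = 19 \<and> mset as = mset [3, 4, 5, 7, 18] \<or> r = 17 \<and> mset as = mset [2, 3, 5, 7, 16] \<or>
      r = 14 \<and> mset as = mset [2, 3, 4, 5, 13]"
    by blast
  then show ?thesis by (auto simp: add_mset_commute)
qed

lemma small_B:
  assumes "14 \<le> r" "r \<le> 25" and adm: "admissible r [a1, a2, a3, a4, a5]"
    and a: "0 < a1" "0 < a2" "0 < a3" "0 < a4" "a1 < r" "a2 < r" "a3 < r" "a4 < r"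
    and "gcd a1 r = 1" "gcd a2 r = 1" "gcd a3 r = 1" "gcd a4 r = gcd a5 r"
    and a5: "a5 = (if 2 * a1 < r then r - 2 * a1 else 2 * r - 2 * a1)"
    and sum: "a1 + a2 + a3 + a4 + a5 = 2 * r - 1" and "a2 \<le> a3"
  shows "List.member exceptional (r, sort [a1, a2, a3, a4, a5])"
proof -
  have "r \<in> set [14..25]" using assms(1,2) by (simp only: set_upto atLeastAtMost_iff simp_thms)
  then have search: "searchB r" using searchB_range unfolding list_all_iff by blast
  have units: "a1 \<in> set (units_mod r)" "a2 \<in> set (units_mod r)" "a3 \<in> set (units_mod r)"
    using assms by (auto intro!: units_modI)
  have a4: "2 * r - 1 - a1 - a2 - a3 - a5 = a4" using sum by auto
  have "a3 < a2 \<or> a4 \<le> 0 \<or> r \<le> a4 \<or> \<not> admissible r [a1, a2, a3, a4, a5] \<or>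
      gcd a4 r \<noteq> gcd a5 r \<or> List.member exceptional (r, sort [a1, a2, a3, a4, a5])"
    using search[unfolded searchB_def Let_def list_all_iff, THEN bspec, OF units(1), THEN bspec, OF units(2),
        THEN bspec, OF units(3)] unfolding a5[symmetric] a4 .
  moreover have "\<not> a3 < a2" "\<not> a4 \<le> 0" "\<not> r \<le> a4" using assms by linarith+
  ultimately show ?thesis using adm \<open>gcd a4 r = gcd a5 r\<close> by blast
qed

lemma small_C:
  assumes "14 \<le> r" "r \<le> 25" and adm: "admissible r [a1, a2, a3, a4, a5]"
    and a: "0 < a1" "0 < a2" "0 < a3" "0 < a4" "a1 < r" "a2 < r" "a3 < r" "a4 < r"
    and "gcd a1 r = 1" "gcd a2 r = 1" "gcd a3 r = 1" "gcd a4 r = gcd a5 r"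
    and a5: "a5 = (if 2 * a4 < r then r - 2 * a4 else 2 * r - 2 * a4)"
    and sum: "a1 + a2 + a3 + a4 + a5 = 2 * r - 1" and "a1 \<le> a2" "a2 \<le> a3"
  shows "List.member exceptional (r, sort [a1, a2, a3, a4, a5])"
proof -
  have "r \<in> set [14..25]" using assms(1,2) by (simp only: set_upto atLeastAtMost_iff simp_thms)
  then have search: "searchC r" using searchC_range unfolding list_all_iff by blast
  have units: "a1 \<in> set (units_mod r)" "a2 \<in> set (units_mod r)"
    using assms by (auto intro!: units_modI)
  have range: "a4 \<in> set [1..r - 1]" using a by simp
  have a3: "2 * r - 1 - a1 - a2 - a4 - a5 = a3" using sum by auto
  have "a2 < a1 \<or> a3 < a2 \<or> r \<le> a3 \<or> \<not> admissible r [a1, a2, a3, a4, a5] \<or> gcd a3 r \<noteq> 1 \<or>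
      gcd a4 r \<noteq> gcd a5 r \<or> List.member exceptional (r, sort [a1, a2, a3, a4, a5])"
    using search[unfolded searchC_def Let_def list_all_iff, THEN bspec, OF range, THEN bspec, OF units(1),
        THEN bspec, OF units(2)] unfolding a5[symmetric] a3 .
  moreover have "\<not> a2 < a1" "\<not> a3 < a2" "\<not> r \<le> a3" using assms by linarith+
  ultimately show ?thesis using adm \<open>gcd a4 r = gcd a5 r\<close> \<open>gcd a3 r = 1\<close> by blast
qed

section \<open>The classification\<close>

locale weighted_sum =
  fixes r s a1 a2 a3 a4 a5 :: int
  assumes r_ge: "26 \<le> r" and s: "0 < s" "13 * s < r" "coprime s r"
    and pos: "0 < a1" "0 < a2" "0 < a3" "0 < a4" "0 < a5"
    and less: "a1 < r" "a2 < r" "a3 < r" "a4 < r" "a5 < r"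
    and cop: "coprime a1 r" "coprime a2 r" "coprime a3 r"
    and gcd_eq: "gcd a4 r = gcd a5 r"
    and total: "a1 + a2 + a3 + a4 + a5 = 2 * r - s"
    and wts: "\<And>j. 1 \<le> j \<Longrightarrow> a1 + a2 + a3 + a4 + a5 \<le>
      residue r (j * a1) + residue r (j * a2) + residue r (j * a3) + residue r (j * a4) + residue r (j * a5)"
begin

text \<open>A number prime to the even modulus r is odd, so j (a - 1) is a multiple of 2 j =
  r.\<close>

lemma residue_half:
  assumes "coprime a r" "r = 2 * j"
  shows "residue r (j * a) = j"
proof (rule residue_eqI)
  have "odd a"
  proof
    assume "even a"
    moreover have "even r" using assms(2) by simp
    ultimately have "is_unit (2::int)" using assms(1) coprime_common_divisor by blast
    then show False by simp
  qed
  then have "2 dvd a - 1" by simp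
  then show "r dvd j * a - j" unfolding assms(2) right_diff_distrib[of j a 1, simplified, symmetric]
    by (subst mult.commute) (intro mult_dvd_mono, simp_all)
qed (use assms r_ge in auto)

lemma mod_half:
  assumes "r = 2 * j"
  shows "j * s mod r = j"
proof -
  have "r dvd j * s - residue r (j * s)" by (rule residue_dvd_diff)
  then have "j * s mod r = residue r (j * s) mod r" by (simp add: mod_eq_dvd_iff)
  then show ?thesis using residue_half[OF s(3) assms] assms r_ge by simp
qed

text \<open>As 2 j \<le> 48 < 2 * 26, the quotient of 2 j by r can only be 1.\<close>

lemma half_if_dvd:
  assumes "1 \<le> j" "j \<le> 24" "r dvd 2 * j"
  shows "r = 2 * j"
proof -
  obtain k where k: "2 * j = r * k" using assms(3) by blast
  have "0 < k" using k assms(1) r_ge by (metis mult_pos_pos zero_less_mult_pos less_le_trans zero_less_numeral zero_less_one)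
  moreover have "k < 2"
  proof (rule ccontr)
    assume "\<not> k < 2"
    then have "r * 2 \<le> r * k" using r_ge by (intro mult_left_mono) auto
    then show False using k assms(2) r_ge by linarith
  qed
  ultimately have "k = 1" by simp
  then show ?thesis using k by simp
qed

text \<open>With r = 2 j the three units contribute r / 2 each and the two multiples r each, in
  total 7 r / 2; s is prime to r, hence odd, so j s mod r = r / 2.\<close>

lemma zero_half:
  assumes "1 \<le> j" "j \<le> 24" "r dvd 2 * j" "r dvd j * a4" "r dvd j * a5"
  shows "residue r (j * a1) + residue r (j * a2) + residue r (j * a3) + residue r (j * a4) + residue r (j * a5)
    = 4 * r - j * s mod r"
proof -
  have r: "r = 2 * j" using half_if_dvd assms by blast
  show ?thesis
    using residue_half[OF cop(1) r] residue_half[OF cop(2) r] residue_half[OF cop(3) r]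
      residue_of_multiple[OF _ assms(4)] residue_of_multiple[OF _ assms(5)] mod_half[OF r] r r_ge
    by linarith
qed

lemma weights_if:
  assumes "\<And>j. 1 \<le> j \<Longrightarrow> j \<le> 24 \<Longrightarrow> r dvd j * a4 \<Longrightarrow> r dvd j * a5 \<Longrightarrow>
      residue r (j * a1) + residue r (j * a2) + residue r (j * a3) + residue r (j * a4) + residue r (j * a5)
      = 4 * r - j * s mod r"
    and "length v = 5" "\<forall>t\<in>set v. \<bar>t\<bar> \<le> 2" "v ! 3 > 0" "v ! 4 < 0"
  shows "weights r s [a1, a2, a3, a4, a5] v"
proof
  show "sum_list [a1, a2, a3, a4, a5] \<le> (\<Sum>a\<leftarrow>[a1, a2, a3, a4, a5]. residue r (j * a))" if "1 \<le> j" for j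
    using wts[OF that] by simp
  show "(\<Sum>a\<leftarrow>[a1, a2, a3, a4, a5]. residue r (j * a)) = 4 * r - j * s mod r"
    if "1 \<le> j" "j \<le> 24" "r dvd j * [a1, a2, a3, a4, a5] ! 3" "r dvd j * [a1, a2, a3, a4, a5] ! 4" for j
    using assms(1)[of j] that by (simp add: numeral_eq_Suc)
qed (use r_ge s pos less cop gcd_eq total assms in \<open>simp_all add: numeral_eq_Suc\<close>)

lemma no_large_A:
  assumes "a1 + a2 + a5 = r" "a3 + a4 + s = r"
  shows False
proof -
  have zero: "residue r (j * a1) + residue r (j * a2) + residue r (j * a3) + residue r (j * a4) + residue r (j * a5)
      = 4 * r - j * s mod r"
    if j: "1 \<le> j" "j \<le> 24" and d: "r dvd j * a4" "r dvd j * a5" for j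
  proof -
    have r0: "0 < r" using r_ge by simp
    have nd: "\<not> r dvd j * a1"
    proof
      assume "r dvd j * a1"
      then have "r dvd j" using cop(1) by (simp add: coprime_commute coprime_dvd_mult_left_iff)
      then show False using zdvd_imp_le[of r j] j r_ge by simp
    qed
    \<comment> \<open>Modulo r, j a2 is opposite to j a1 because r divides j a5, so their residues
      add up to r; likewise j a3 is congruent to -j s because r divides j a4.\<close>
    have "j * a2 - - (j * a1) = j * r - j * a5" unfolding assms(1)[symmetric] by (simp add: algebra_simps)
    then have "r dvd j * a2 - - (j * a1)" using d(2) by simp
    then have "residue r (j * a2) = residue r (- (j * a1))" by (rule residue_cong[OF r0])
    then have 12: "residue r (j * a1) + residue r (j * a2) = r" using residue_minus[OF r0 nd] by simp
    have 3: "residue r (j * a3) = r - j * s mod r"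
    proof (rule residue_eqI)
      have "j * a3 - (r - j * s mod r) = (j * r - j * a4) - r - (j * s - j * s mod r)"
        unfolding assms(2)[symmetric] by (simp add: algebra_simps)
      moreover have "r dvd j * s - j * s mod r" by simp
      ultimately show "r dvd j * a3 - (r - j * s mod r)" using d(1) by (simp only: dvd_diff dvd_triv_right dvd_refl)
    qed (use r0 pos_mod_bound[OF r0, of "j * s"] pos_mod_sign[OF r0, of "j * s"] in linarith)+
    show ?thesis
      using 12 3 residue_of_multiple[OF r0 d(1)] residue_of_multiple[OF r0 d(2)] by linarith
  qed
  \<comment> \<open>The shift preserves both relations: its entries 0, 1, 4 add up to 0, and so do
    its entries 2, 3.\<close>
  interpret weights r s "[a1, a2, a3, a4, a5]" "[1, 0, - 1, 1, - 1]"
    by (rule weights_if) (use zero in \<open>auto simp: numeral_eq_Suc\<close>)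
  have r0: "(0::real) < of_int r" using r_ge by simp
  have "map pt [0..<5] = [pt 0, pt 1, pt 2, pt 3, pt 4]" by (simp add: upt_rec numeral_eq_Suc)
  then have "pattern (of_int s / of_int r) [pt 0, pt 1, pt 4, pt 2, pt 3]"
    using pattern_pt by (intro pattern_perm[OF _ pattern_pt]) (simp add: add_mset_commute)
  moreover have "pt 0 + pt 1 + pt 4 = 1"
    using arg_cong[OF assms(1), of "of_int :: int \<Rightarrow> real"] r0 by (simp add: pt_def numeral_eq_Suc flip: add_divide_distrib)
  moreover have "pt 2 + pt 3 + of_int s / of_int r = 1"
    using arg_cong[OF assms(2), of "of_int :: int \<Rightarrow> real"] r0 by (simp add: pt_def numeral_eq_Suc flip: add_divide_distrib)
  ultimately show False by (rule no_pattern_A)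
qed

lemma no_large_B:
  assumes "r dvd 2 * a1 + a5"
  shows False
proof -
  have zero: "residue r (j * a1) + residue r (j * a2) + residue r (j * a3) + residue r (j * a4) + residue r (j * a5)
      = 4 * r - j * s mod r"
    if j: "1 \<le> j" "j \<le> 24" and d: "r dvd j * a4" "r dvd j * a5" for j
  proof -
    have "r dvd j * (2 * a1 + a5) - j * a5" by (rule dvd_diff[OF dvd_mult[OF assms] d(2)])
    then have "r dvd 2 * j * a1" by (simp add: algebra_simps)
    then have "r dvd 2 * j" using cop(1) by (simp add: coprime_commute coprime_dvd_mult_left_iff)
    then show ?thesis by (rule zero_half[OF j _ d])
  qed
  \<comment> \<open>The shift has sum 0 and satisfies \<open>2 * v ! 0 + v ! 4 = 0\<close>, so the
    total and the relation between a1 and a5 persist.\<close>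
  interpret weights r s "[a1, a2, a3, a4, a5]" "[1, 0, 0, 1, - 2]"
    by (rule weights_if) (use zero in \<open>auto simp: numeral_eq_Suc\<close>)
  have r0: "(0::real) < of_int r" using r_ge by simp
  have "map pt [0..<5] = [pt 0, pt 1, pt 2, pt 3, pt 4]" by (simp add: upt_rec numeral_eq_Suc)
  then have "pattern (of_int s / of_int r) [pt 0, pt 4, pt 1, pt 2, pt 3]"
    by (intro pattern_perm[OF _ pattern_pt]) (simp add: add_mset_commute)
  moreover have "pt 4 = 1 - 2 * pt 0 \<or> pt 4 = 2 - 2 * pt 0"
  proof -
    obtain k where k: "2 * a1 + a5 = r * k" using assms by blast
    have "0 < r * k" "r * k < r * 3" using k pos less by linarith+
    then have "0 < k" "k < 3" using r_ge by (simp_all add: zero_less_mult_iff)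
    then have "k = 1 \<or> k = 2" by auto
    moreover have "of_int r * (pt 4 + 2 * pt 0) = (of_int (2 * a1 + a5) :: real)"
      using r0 by (simp add: pt_def numeral_eq_Suc distrib_left add_divide_distrib)
    then have "pt 4 + 2 * pt 0 = of_int k" unfolding k using r0 by simp
    ultimately show ?thesis by auto
  qed
  moreover have "pt 0 + pt 4 + pt 1 + pt 2 + pt 3 + of_int s / of_int r = 2"
  proof -
    have "of_int r * (pt 0 + pt 4 + pt 1 + pt 2 + pt 3 + of_int s / of_int r) = (of_int (a1 + a2 + a3 + a4 + a5 + s) :: real)"
      using r0 by (simp add: pt_def numeral_eq_Suc distrib_left add_divide_distrib)
    also have "a1 + a2 + a3 + a4 + a5 + s = 2 * r" using total by simp
    finally show ?thesis using r0 by simp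
  qed
  ultimately show False by (rule no_pattern_B)
qed

lemma no_large_C:
  assumes "r dvd 2 * a4 + a5" "gcd a4 r \<le> 2"
  shows False
proof -
  have zero: "residue r (j * a1) + residue r (j * a2) + residue r (j * a3) + residue r (j * a4) + residue r (j * a5)
      = 4 * r - j * s mod r"
    if j: "1 \<le> j" "j \<le> 24" and d: "r dvd j * a4" "r dvd j * a5" for j
  proof -
    \<comment> \<open>Here the bound on the gcd enters: r divides j or 2 j, hence 2 j.\<close>
    have "r dvd j * gcd a4 r" using d(1) dvd_mult_gcd_iff by blast
    moreover have "0 < gcd a4 r" using r_ge by simp
    then have "gcd a4 r = 1 \<or> gcd a4 r = 2" using assms(2) by linarith
    ultimately have "r dvd 2 * j" by (auto simp: mult.commute)
    then show ?thesis by (rule zero_half[OF j _ d])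
  qed
  \<comment> \<open>The same shift also satisfies \<open>2 * v ! 3 + v ! 4 = 0\<close>.\<close>
  interpret weights r s "[a1, a2, a3, a4, a5]" "[1, 0, 0, 1, - 2]"
    by (rule weights_if) (use zero in \<open>auto simp: numeral_eq_Suc\<close>)
  have r0: "(0::real) < of_int r" using r_ge by simp
  have "map pt [0..<5] = [pt 0, pt 1, pt 2, pt 3, pt 4]" by (simp add: upt_rec numeral_eq_Suc)
  then have "pattern (of_int s / of_int r) [pt 3, pt 4, pt 0, pt 1, pt 2]"
    by (intro pattern_perm[OF _ pattern_pt]) (simp add: add_mset_commute)
  moreover have "pt 4 = 1 - 2 * pt 3 \<or> pt 4 = 2 - 2 * pt 3"
  proof -
    obtain k where k: "2 * a4 + a5 = r * k" using assms by blast
    have "0 < r * k" "r * k < r * 3" using k pos less by linarith+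
    then have "0 < k" "k < 3" using r_ge by (simp_all add: zero_less_mult_iff)
    then have "k = 1 \<or> k = 2" by auto
    moreover have "of_int r * (pt 4 + 2 * pt 3) = (of_int (2 * a4 + a5) :: real)"
      using r0 by (simp add: pt_def numeral_eq_Suc distrib_left add_divide_distrib)
    then have "pt 4 + 2 * pt 3 = of_int k" unfolding k using r0 by simp
    ultimately show ?thesis by auto
  qed
  moreover have "pt 3 + pt 4 + pt 0 + pt 1 + pt 2 + of_int s / of_int r = 2"
  proof -
    have "of_int r * (pt 3 + pt 4 + pt 0 + pt 1 + pt 2 + of_int s / of_int r) = (of_int (a1 + a2 + a3 + a4 + a5 + s) :: real)"
      using r0 by (simp add: pt_def numeral_eq_Suc distrib_left add_divide_distrib)
    also have "a1 + a2 + a3 + a4 + a5 + s = 2 * r" using total by simp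
    finally show ?thesis using r0 by simp
  qed
  ultimately show False by (rule no_pattern_B)
qed

end

lemma dvd_three_cases:
  fixes r x :: int
  assumes "r dvd x" "0 < x" "x < 3 * r"
  shows "x = r \<or> x = 2 * r"
proof -
  obtain k where k: "x = r * k" using assms(1) by blast
  have r: "0 < r" using assms by simp
  have "0 < r * k" "r * k < r * 3" using assms k by linarith+
  then have "0 < k" "k < 3"
    using zero_less_mult_pos[of r k] r by (simp_all only: mult_less_cancel_left_pos)
  then have "k = 1 \<or> k = 2" by auto
  then show ?thesis using k by auto
qed

text \<open>The purely arithmetic form of the theorem: the minimal log discrepancy survives only in
  \<open>wts\<close> and in the bounds on the total.\<close>

lemma weights_classification:
  fixes r a1 a2 a3 a4 a5 :: int
  assumes pos: "0 < a1" "0 < a2" "0 < a3" "0 < a4" "0 < a5"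
    and le: "a1 \<le> r" "a2 \<le> r" "a3 \<le> r" "a4 \<le> r" "a5 \<le> r"
    and g: "gcd a1 r = 1" "gcd a2 r = 1" "gcd a3 r = 1" "gcd a4 r = gcd a5 r"
    and gS: "gcd (a1 + a2 + a3 + a4 + a5) r = 1"
    and S: "25 * r < 13 * (a1 + a2 + a3 + a4 + a5)" "a1 + a2 + a3 + a4 + a5 < 2 * r"
    and wts: "\<And>j. 1 \<le> j \<Longrightarrow> a1 + a2 + a3 + a4 + a5 \<le>
      residue r (j * a1) + residue r (j * a2) + residue r (j * a3) + residue r (j * a4) + residue r (j * a5)"
    and cond: "r dvd a1 + a2 + a5 \<or> r dvd 2 * a1 + a5 \<or> r dvd 2 * a4 + a5 \<and> gcd a4 r \<le> 2"
  shows "(r, {#a1, a2, a3, a4, a5#}) \<in>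
    {(19, {#3, 4, 5, 7, 18#}), (17, {#2, 3, 5, 7, 16#}), (14, {#3, 5, 13, 2, 4#})}"
proof -
  \<comment> \<open>In these integers \<delta> = s / r, so the bounds on the total become 0 < 13 s <
    r.\<close>
  define s where "s = 2 * r - (a1 + a2 + a3 + a4 + a5)"
  have total: "a1 + a2 + a3 + a4 + a5 = 2 * r - s" by (simp add: s_def)
  have s: "0 < s" "13 * s < r" using S by (simp_all add: s_def)
  have r14: "14 \<le> r" using s by simp
  have cop_s: "coprime s r"
  proof (rule coprimeI)
    fix c assume c: "c dvd s" "c dvd r"
    then have "c dvd 2 * r - s" by (intro dvd_diff dvd_mult)
    then have "c dvd gcd (a1 + a2 + a3 + a4 + a5) r" using c by (simp add: total)
    then show "is_unit c" by (simp add: gS)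
  qed
  have less: "a1 < r" "a2 < r" "a3 < r"
  proof -
    have "a \<noteq> r" if "gcd a r = 1" for a using that r14 by auto
    then show "a1 < r" "a2 < r" "a3 < r" using g le by (simp_all add: order.strict_iff_order)
  qed
  have less4: "a4 < r" "a5 < r"
  proof -
    \<comment> \<open>If a4 or a5 were r, the common gcd would make both of them r, and the total
      would exceed 2 r.\<close>
    have "a4 = r \<longleftrightarrow> a5 = r"
    proof -
      have eq: "a = r \<longleftrightarrow> gcd a r = r" if "0 < a" "a \<le> r" for a
      proof
        assume "gcd a r = r"
        then have "r dvd a" by (metis gcd_dvd1)
        then show "a = r" using zdvd_imp_le[of r a] that by simp
      qed (use that in simp)
      show ?thesis using eq[OF pos(4) le(4)] eq[OF pos(5) le(5)] g(4) by simp
    qed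
    then show "a4 < r" "a5 < r" using le pos S(2) by linarith+
  qed
  have sums_A: "a1 + a2 + a5 = r \<and> a3 + a4 + s = r" if "r dvd a1 + a2 + a5"
  proof -
    \<comment> \<open>The value 2 r is excluded because the total of all five weights is below 2
      r.\<close>
    have "a1 + a2 + a5 = r \<or> a1 + a2 + a5 = 2 * r"
      using that pos less less4 by (intro dvd_three_cases) auto
    then show ?thesis using total pos s by linarith
  qed
  show ?thesis
  proof (cases "r \<le> 25")
    case False
    have r26: "26 \<le> r" using False by simp
    have cop: "coprime a1 r" "coprime a2 r" "coprime a3 r"
      using g by (simp_all only: coprime_iff_gcd_eq_1)
    interpret weighted_sum r s a1 a2 a3 a4 a5
      by unfold_locales (fact r26 s cop_s pos less less4 cop g total | erule wts)+
    show ?thesis using cond no_large_A no_large_B no_large_C sums_A by blast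
  next
    case True
    then have s1: "s = 1" using s by simp
    have adm: "admissible r as" if "mset as = {#a1, a2, a3, a4, a5#}" for as
    proof (rule admissible_if_weights)
      have sum: "(\<Sum>a\<leftarrow>as. f a) = f a1 + f a2 + f a3 + f a4 + f a5" for f :: "int \<Rightarrow> int"
      proof -
        have "(\<Sum>a\<leftarrow>as. f a) = sum_mset (image_mset f (mset as))"
          by (metis mset_map sum_mset_sum_list)
        then show ?thesis unfolding that by (simp add: add_ac)
      qed
      show "sum_list as = 2 * r - 1" using sum[of "\<lambda>a. a"] total s1 by simp
      show "sum_list as \<le> (\<Sum>a\<leftarrow>as. residue r (j * a))" if "1 \<le> j" for j
        using sum[of "\<lambda>a. a"] sum[of "\<lambda>a. residue r (j * a)"] wts[OF that] by simp
      have "set as = {a1, a2, a3, a4, a5}" unfolding set_mset_mset[symmetric] that by simp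
      then show "\<forall>a\<in>set as. 0 < a \<and> a < r" using pos less less4 by auto
    qed (use r14 in simp)
    have exc: ?thesis if "List.member exceptional (r, sort as)" "mset as = {#a1, a2, a3, a4, a5#}" for as
      using exceptional_mset[OF that(1)] that(2) by simp
    have double: "b = (if 2 * a < r then r - 2 * a else 2 * r - 2 * a)" if "r dvd 2 * a + b" "0 < a" "0 < b" "a < r" "b < r" for a b
    proof -
      have "2 * a + b = r \<or> 2 * a + b = 2 * r"
        by (rule dvd_three_cases[OF that(1)]) (use that in linarith)+
      then show ?thesis using that by (cases "2 * a < r") simp_all
    qed
    consider (A) "r dvd a1 + a2 + a5" | (B) "r dvd 2 * a1 + a5" | (C) "r dvd 2 * a4 + a5" using cond by blast
    then show ?thesis
    proof cases
      case A
      have False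
      proof (cases "a1 \<le> a2")
        case True
        show False
          by (rule small_A[OF r14 \<open>r \<le> 25\<close> adm[of "[a1, a2, a3, a4, a5]"]])
            (use True sums_A[OF A] s1 pos g in simp_all)
      next
        case False
        show False
          by (rule small_A[OF r14 \<open>r \<le> 25\<close> adm[of "[a2, a1, a3, a4, a5]"]])
            (use False sums_A[OF A] s1 pos g in \<open>simp_all add: add_mset_commute add.commute\<close>)
      qed
      then show ?thesis ..
    next
      case B
      have a5: "a5 = (if 2 * a1 < r then r - 2 * a1 else 2 * r - 2 * a1)"
        using double[OF B] pos less less4 by simp
      show ?thesis
      proof (cases "a2 \<le> a3")
        case True
        have "List.member exceptional (r, sort [a1, a2, a3, a4, a5])"
          by (rule small_B[OF r14 \<open>r \<le> 25\<close> adm _ _ _ _ _ _ _ _ _ _ _ _ a5])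
            (use True pos less less4 g total s1 in simp_all)
        then show ?thesis by (rule exc) simp
      next
        case False
        have "List.member exceptional (r, sort [a1, a3, a2, a4, a5])"
          by (rule small_B[OF r14 \<open>r \<le> 25\<close> adm _ _ _ _ _ _ _ _ _ _ _ _ a5])
            (use False pos less less4 g total s1 in \<open>simp_all add: add_mset_commute\<close>)
        then show ?thesis by (rule exc) (simp add: add_mset_commute)
      qed
    next
      case C
      have a5: "a5 = (if 2 * a4 < r then r - 2 * a4 else 2 * r - 2 * a4)"
        using double[OF C] pos less less4 by simp
      have sorted: ?thesis
        if m: "mset [x, y, z] = mset [a1, a2, a3]" and le: "x \<le> y" "y \<le> z" and sum: "x + y + z = a1 + a2 + a3"
          and xyz: "\<forall>t\<in>{x, y, z}. 0 < t \<and> t < r \<and> gcd t r = 1" for x y z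
      proof (rule exc)
        have "mset ([x, y, z] @ [a4, a5]) = mset ([a1, a2, a3] @ [a4, a5])" by (simp only: mset_append m)
        then show mm: "mset [x, y, z, a4, a5] = {#a1, a2, a3, a4, a5#}" by simp
        show "List.member exceptional (r, sort [x, y, z, a4, a5])"
          by (rule small_C[OF r14 \<open>r \<le> 25\<close> adm[OF mm] _ _ _ _ _ _ _ _ _ _ _ _ a5])
            (use le sum xyz pos less4 g total s1 in simp_all)
      qed
      have all: "\<forall>t\<in>{a1, a2, a3}. 0 < t \<and> t < r \<and> gcd t r = 1" using pos less g by simp
      consider "a1 \<le> a2" "a2 \<le> a3" | "a1 \<le> a3" "a3 \<le> a2" | "a2 \<le> a1" "a1 \<le> a3" | "a2 \<le> a3" "a3 \<le> a1"
        | "a3 \<le> a1" "a1 \<le> a2" | "a3 \<le> a2" "a2 \<le> a1" by linarith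
      then show ?thesis
      proof cases
        case 1
        show ?thesis by (rule sorted[OF _ 1]) (use all in simp_all)
      next
        case 2
        show ?thesis by (rule sorted[OF _ 2]) (use all in \<open>simp_all add: add_mset_commute\<close>)
      next
        case 3
        show ?thesis by (rule sorted[OF _ 3]) (use all in \<open>simp_all add: add_mset_commute\<close>)
      next
        case 4
        show ?thesis by (rule sorted[OF _ 4]) (use all in \<open>simp_all add: add_mset_commute\<close>)
      next
        case 5
        show ?thesis by (rule sorted[OF _ 5]) (use all in \<open>simp_all add: add_mset_commute\<close>)
      next
        case 6
        show ?thesis by (rule sorted[OF _ 6]) (use all in \<open>simp_all add: add_mset_commute\<close>)
      qed
    qed
  qed
qed

section \<open>The index type 5 and the passage between natural numbers and integers\<close>

lemma exhaust_5:
  fixes x :: 5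
  shows "x = 1 \<or> x = 2 \<or> x = 3 \<or> x = 4 \<or> x = 5"
proof (induct x)
  case (of_int z)
  \<comment> \<open>Representatives run from 0 to 4, and 0 is the index 5.\<close>
  then have "z = 0 \<or> z = 1 \<or> z = 2 \<or> z = 3 \<or> z = 4" by fastforce
  then show ?case by auto
qed

lemma UNIV_5: "UNIV = {1, 2, 3, 4, 5 :: 5}"
  using exhaust_5 by auto

lemma sum_5: "sum f (UNIV :: 5 set) = f 1 + f 2 + f 3 + f 4 + f 5"
  unfolding UNIV_5 by (simp add: ac_simps)

lemma residue_of_nat:
  assumes "1 \<le> j" "0 < (a::nat)"
  shows "residue (int r) (int j * int a) = int ((j * a - 1) mod r + 1)"
proof -
  have "1 \<le> j * a" using assms by (simp add: Suc_le_eq)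
  then have "int (j * a - 1) = int j * int a - 1" by (simp add: of_nat_diff)
  then show ?thesis unfolding residue_def by (simp add: zmod_int)
qed

theorem theorem1p6:
  fixes r :: nat and a :: "5 \<Rightarrow> nat"
  assumes "r > 0" and "\<forall>i. a i > 0"
    and "\<forall>i. a i \<le> r"
    and "gcd (a 1) r = 1" and "gcd (a 2) r = 1" and "gcd (a 3) r = 1"
    and "gcd (a 4) r = gcd (a 5) r"
    and "gcd (\<Sum>i\<in>UNIV. a i) r = 1"
    and "ereal (2 - 1 / 13) < mld r a"
    and "mld r a = ereal (1 / real r * (\<Sum>i\<in>UNIV. real (a i)))"
    and "ereal (1 / real r * (\<Sum>i\<in>UNIV. real (a i))) < 2"
    and "r dvd a 1 + a 2 + a 5 \<or> r dvd 2 * a 1 + a 5 \<or>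
         (r dvd 2 * a 4 + a 5 \<and> gcd (a 4) r = gcd (a 5) r \<and> gcd (a 5) r \<le> 2)"
  shows "(r, {#a 1, a 2, a 3, a 4, a 5#}) \<in>
           {(19, {#3, 4, 5, 7, 18#}), (17, {#2, 3, 5, 7, 16#}), (14, {#3, 5, 13, 2, 4#})}"
proof -
  let ?b = "\<lambda>i. int (a i)"
  define S where "S = a 1 + a 2 + a 3 + a 4 + a 5"
  have sum_a: "(\<Sum>i\<in>UNIV. a i) = S" by (simp add: sum_5 S_def)
  have sum_real: "(\<Sum>i\<in>UNIV. real (a i)) = real S" by (simp add: sum_5 S_def)
  have r0: "0 < real r" using assms(1) by simp
  have "2 - 1 / 13 < real S / real r" using assms(9) unfolding assms(10) sum_real by simp
  then have "real (25 * r) < real (13 * S)" using r0 by (simp add: field_simps)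
  then have S1: "25 * r < 13 * S" by (simp only: of_nat_less_iff)
  have "ereal (real S / real r) < ereal 2" using assms(11) unfolding sum_real by simp
  then have "real S < real (2 * r)" using r0 by (simp add: field_simps)
  then have S2: "S < 2 * r" by (simp only: of_nat_less_iff)
  have S_le: "int S \<le> residue (int r) (j * ?b 1) + residue (int r) (j * ?b 2) + residue (int r) (j * ?b 3) +
      residue (int r) (j * ?b 4) + residue (int r) (j * ?b 5)" if "1 \<le> j" for j
  proof -
    define k where "k = nat j"
    have k: "j = int k" "1 \<le> k" using that by (simp_all add: k_def)
    let ?w = "\<lambda>i. (k * a i - 1) mod r + 1"
    \<comment> \<open>The prescribed value of \<open>mld r a\<close> meets the toric upper bound for
      k; only here does the definition of \<open>mld\<close> enter.\<close>
    have "ereal (real S / real r) \<le> ereal (real (\<Sum>i\<in>UNIV. ?w i) / real r)"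
      using mld_le_weights[of r a k] assms(1,2) k(2) unfolding assms(10) sum_real by simp
    then have "real S \<le> real (\<Sum>i\<in>UNIV. ?w i)" using r0 by (simp add: divide_le_cancel)
    then have "S \<le> (\<Sum>i\<in>UNIV. ?w i)" by (simp only: of_nat_le_iff)
    then have "int S \<le> int (?w 1) + int (?w 2) + int (?w 3) + int (?w 4) + int (?w 5)"
      unfolding sum_5 by linarith
    then show ?thesis using residue_of_nat[OF k(2)] assms(2) by (simp add: k(1))
  qed
  have dvd: "int r dvd ?b i + ?b j + ?b k \<longleftrightarrow> r dvd a i + a j + a k" for i j k
    by (simp only: of_nat_dvd_iff flip: of_nat_add)
  have "int r dvd ?b 1 + ?b 2 + ?b 5 \<or> int r dvd ?b 1 + ?b 1 + ?b 5 \<or>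
      int r dvd ?b 4 + ?b 4 + ?b 5 \<and> gcd (?b 4) (int r) \<le> 2"
    unfolding dvd gcd_int_int_eq using assms(12) unfolding mult_2 by (elim disjE conjE) simp_all
  then have cond: "int r dvd ?b 1 + ?b 2 + ?b 5 \<or> int r dvd 2 * ?b 1 + ?b 5 \<or>
      int r dvd 2 * ?b 4 + ?b 5 \<and> gcd (?b 4) (int r) \<le> 2"
    by (simp only: mult_2)
  have "(int r, {#?b 1, ?b 2, ?b 3, ?b 4, ?b 5#}) \<in>
    {(19, {#3, 4, 5, 7, 18#}), (17, {#2, 3, 5, 7, 16#}), (14, {#3, 5, 13, 2, 4#})}"
  proof (rule weights_classification[OF _ _ _ _ _ _ _ _ _ _ _ _ _ _ _ _ _ _ cond])
    have S: "?b 1 + ?b 2 + ?b 3 + ?b 4 + ?b 5 = int S" by (simp add: S_def)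
    show "0 < ?b 1" "0 < ?b 2" "0 < ?b 3" "0 < ?b 4" "0 < ?b 5"
      "?b 1 \<le> int r" "?b 2 \<le> int r" "?b 3 \<le> int r" "?b 4 \<le> int r" "?b 5 \<le> int r"
      using assms(2,3) by simp_all
    show "gcd (?b 1) (int r) = 1" "gcd (?b 2) (int r) = 1" "gcd (?b 3) (int r) = 1"
      "gcd (?b 4) (int r) = gcd (?b 5) (int r)"
      using assms(4-7) by (simp_all only: gcd_int_int_eq of_nat_1)
    show "gcd (?b 1 + ?b 2 + ?b 3 + ?b 4 + ?b 5) (int r) = 1"
      unfolding S gcd_int_int_eq using assms(8) by (simp only: sum_a of_nat_1)
    show "25 * int r < 13 * (?b 1 + ?b 2 + ?b 3 + ?b 4 + ?b 5)"
      "?b 1 + ?b 2 + ?b 3 + ?b 4 + ?b 5 < 2 * int r"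
      unfolding S using S1 S2 by linarith+
    show "?b 1 + ?b 2 + ?b 3 + ?b 4 + ?b 5 \<le> residue (int r) (j * ?b 1) + residue (int r) (j * ?b 2) +
        residue (int r) (j * ?b 3) + residue (int r) (j * ?b 4) + residue (int r) (j * ?b 5)" if "1 \<le> j" for j
      unfolding S using S_le[OF that] .
  qed
  then consider "int r = 19" "{#?b 1, ?b 2, ?b 3, ?b 4, ?b 5#} = {#3, 4, 5, 7, 18#}"
    | "int r = 17" "{#?b 1, ?b 2, ?b 3, ?b 4, ?b 5#} = {#2, 3, 5, 7, 16#}"
    | "int r = 14" "{#?b 1, ?b 2, ?b 3, ?b 4, ?b 5#} = {#3, 5, 13, 2, 4#}"
    by (elim insertE emptyE Pair_inject)
  note cases = this
  have nat: "{#a 1, a 2, a 3, a 4, a 5#} = image_mset nat {#?b 1, ?b 2, ?b 3, ?b 4, ?b 5#}"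
    by simp
  show ?thesis
  proof (cases rule: cases)
    case 1
    then show ?thesis unfolding nat 1(2) by simp
  next
    case 2
    then show ?thesis unfolding nat 2(2) by simp
  next
    case 3
    then show ?thesis unfolding nat 3(2) by simp
  qed
qed

end
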